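(* Let $M$ be a finite structure of order $n$ whose vocabulary has maximum relation arity $k$. If $$\sigma(M)\le\left(1-\frac1{2k}\right)n+(k-1)^2+1,$$ then $D_1(M)\le\left(1-\frac1{2k}\right)n+k^2-k+2$. Otherwise $$\sigma(M)+1\le D(M)\le D_1(M)\le\sigma(M)+k.$$
   Context: A vocabulary $L$ is a finite list of relation symbols with positive integer arities; maximum relation arity = largest arity. An $L$-structure $M$ has a finite universe $V(M)$ and relations $R^M:V(M)^l\to\{0,1\}$ for each $l$-ary symbol; its order is $|V(M)|$. For $a,b\in V(M)$, $a\sim b$ means the transposition of $a$ and $b$ is an automorphism of $M$; this is an equivalence relation and $\sigma(M)$ is the maximum size of a $\sim$-class. First-order formulas are over $L\cup\{=\}$ with $\neg,\wedge,\vee$. For a formula $\Phi$, $\mathrm{nest}(\Phi)$: $\{\text{empty word}\}$ for atomic; swap $\exists,\forall$ for negation; union for $\wedge,\vee$; prefix the quantifier for $\exists x\Phi$/$\forall x\Phi$. Quantifier rank = maximum word length; alternation number = maximum number of consecutive occurrences of $\exists\forall$ or $\forall\exists$ in a word of $\mathrm{nest}(\Phi)$. A closed formula defines $M$ if it is true on $M$ and false on every $L$-structure not isomorphic to $M$. $D(M)$ is the minimum quantifier rank of a formula defining $M$; $D_1(M)$ is the minimum quantifier rank of a formula with alternation number at most 1 defining $M$. *)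

theory Defs
  imports Complex_Main "HOL-Combinatorics.Transposition"
begin

text \<open>A vocabulary is the list of the arities of its relation symbols; the symbols themselves
  are the positions in the list.\<close>

type_synonym vocabulary = "nat list"

definition is_vocabulary :: "vocabulary \<Rightarrow> bool" where
  "is_vocabulary L \<longleftrightarrow> (\<forall>l\<in>set L. 0 < l)"

definition max_arity :: "vocabulary \<Rightarrow> nat" where
  "max_arity L = Max (set L)"

text \<open>The value \<^term>\<open>rel M i xs\<close> is meaningful only for a symbol \<^term>\<open>i < length L\<close> and a
  tuple of elements of the universe of length \<^term>\<open>L ! i\<close>; all notions below ignore \<open>rel M\<close>
  elsewhere. The empty universe is allowed.\<close>

record 'a struct =
  univ :: "'a set"
  rel :: "nat \<Rightarrow> 'a list \<Rightarrow> bool"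

definition is_structure :: "vocabulary \<Rightarrow> 'a struct \<Rightarrow> bool" where
  "is_structure L M \<longleftrightarrow> is_vocabulary L \<and> finite (univ M)"

definition is_iso :: "vocabulary \<Rightarrow> 'a struct \<Rightarrow> 'b struct \<Rightarrow> ('a \<Rightarrow> 'b) \<Rightarrow> bool" where
  "is_iso L M N f \<longleftrightarrow> bij_betw f (univ M) (univ N) \<and>
     (\<forall>i<length L. \<forall>xs. length xs = L ! i \<and> set xs \<subseteq> univ M \<longrightarrow>
        rel M i xs = rel N i (map f xs))"

definition isomorphic :: "vocabulary \<Rightarrow> 'a struct \<Rightarrow> 'b struct \<Rightarrow> bool" where
  "isomorphic L M N \<longleftrightarrow> (\<exists>f. is_iso L M N f)"

definition similar :: "vocabulary \<Rightarrow> 'a struct \<Rightarrow> ('a \<times> 'a) set" where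
  "similar L M = {(a, b). a \<in> univ M \<and> b \<in> univ M \<and> is_iso L M M (transpose a b)}"

text \<open>The element \<open>0\<close> matters only for the empty universe, which has no classes.\<close>

definition sigma :: "vocabulary \<Rightarrow> 'a struct \<Rightarrow> nat" where
  "sigma L M = Max (insert 0 (card ` (univ M // similar L M)))"

datatype fm =
    Rel nat "nat list"
  | Eq nat nat
  | Neg fm
  | And fm fm
  | Or fm fm
  | Exists nat fm
  | Forall nat fm

fun is_formula :: "vocabulary \<Rightarrow> fm \<Rightarrow> bool" where
  "is_formula L (Rel i xs) \<longleftrightarrow> i < length L \<and> length xs = L ! i"
| "is_formula L (Eq x y) \<longleftrightarrow> True"
| "is_formula L (Neg p) \<longleftrightarrow> is_formula L p"
| "is_formula L (And p q) \<longleftrightarrow> is_formula L p \<and> is_formula L q"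
| "is_formula L (Or p q) \<longleftrightarrow> is_formula L p \<and> is_formula L q"
| "is_formula L (Exists x p) \<longleftrightarrow> is_formula L p"
| "is_formula L (Forall x p) \<longleftrightarrow> is_formula L p"

fun free_vars :: "fm \<Rightarrow> nat set" where
  "free_vars (Rel i xs) = set xs"
| "free_vars (Eq x y) = {x, y}"
| "free_vars (Neg p) = free_vars p"
| "free_vars (And p q) = free_vars p \<union> free_vars q"
| "free_vars (Or p q) = free_vars p \<union> free_vars q"
| "free_vars (Exists x p) = free_vars p - {x}"
| "free_vars (Forall x p) = free_vars p - {x}"

fun sat :: "'a struct \<Rightarrow> (nat \<Rightarrow> 'a) \<Rightarrow> fm \<Rightarrow> bool" where
  "sat M s (Rel i xs) \<longleftrightarrow> rel M i (map s xs)"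
| "sat M s (Eq x y) \<longleftrightarrow> s x = s y"
| "sat M s (Neg p) \<longleftrightarrow> \<not> sat M s p"
| "sat M s (And p q) \<longleftrightarrow> sat M s p \<and> sat M s q"
| "sat M s (Or p q) \<longleftrightarrow> sat M s p \<or> sat M s q"
| "sat M s (Exists x p) \<longleftrightarrow> (\<exists>a\<in>univ M. sat M (s(x := a)) p)"
| "sat M s (Forall x p) \<longleftrightarrow> (\<forall>a\<in>univ M. sat M (s(x := a)) p)"

definition closed_formula :: "vocabulary \<Rightarrow> fm \<Rightarrow> bool" where
  "closed_formula L p \<longleftrightarrow> is_formula L p \<and> free_vars p = {}"

text \<open>Only used for closed formulas, whose truth does not depend on the assignment
  (lemma \<open>sat_cong\<close>), so the quantifier over \<open>s\<close> is immaterial.\<close>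

definition true_on :: "'a struct \<Rightarrow> fm \<Rightarrow> bool" where
  "true_on M p \<longleftrightarrow> (\<forall>s. sat M s p)"

text \<open>The competitors \<open>N\<close> have universes of natural numbers, since HOL cannot quantify over types
  here. Every finite structure is isomorphic to one of these; lemma \<open>defining_formula_any\<close> shows that
  nothing is lost.\<close>

definition defining_formula :: "vocabulary \<Rightarrow> fm \<Rightarrow> 'a struct \<Rightarrow> bool" where
  "defining_formula L p M \<longleftrightarrow> closed_formula L p \<and> true_on M p \<and>
     (\<forall>N :: nat struct. is_structure L N \<and> \<not> isomorphic L M N \<longrightarrow> \<not> true_on N p)"

datatype quantifier = QEx | QAll

fun swap_quantifier :: "quantifier \<Rightarrow> quantifier" where
  "swap_quantifier QEx = QAll"
| "swap_quantifier QAll = QEx"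

fun nest :: "fm \<Rightarrow> quantifier list set" where
  "nest (Rel i xs) = {[]}"
| "nest (Eq x y) = {[]}"
| "nest (Neg p) = map swap_quantifier ` nest p"
| "nest (And p q) = nest p \<union> nest q"
| "nest (Or p q) = nest p \<union> nest q"
| "nest (Exists x p) = Cons QEx ` nest p"
| "nest (Forall x p) = Cons QAll ` nest p"

definition quantifier_rank :: "fm \<Rightarrow> nat" where
  "quantifier_rank p = Max (length ` nest p)"

definition alternations :: "quantifier list \<Rightarrow> nat" where
  "alternations w = card {i. Suc i < length w \<and> w ! i \<noteq> w ! Suc i}"

definition alternation_number :: "fm \<Rightarrow> nat" where
  "alternation_number p = Max (alternations ` nest p)"

definition D :: "vocabulary \<Rightarrow> 'a struct \<Rightarrow> nat" where
  "D L M = (LEAST r. \<exists>p. defining_formula L p M \<and> quantifier_rank p = r)"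

definition D1 :: "vocabulary \<Rightarrow> 'a struct \<Rightarrow> nat" where
  "D1 L M = (LEAST r. \<exists>p. defining_formula L p M \<and> alternation_number p \<le> 1 \<and> quantifier_rank p = r)"

lemma sat_cong:
  assumes "\<And>x. x \<in> free_vars p \<Longrightarrow> s x = t x"
  shows "sat M s p \<longleftrightarrow> sat M t p"
  using assms
proof (induction p arbitrary: s t)
  case (Rel i xs)
  then have "map s xs = map t xs" by simp
  then show ?case by (simp only: sat.simps)
next
  case (Neg p)
  then show ?case by (metis sat.simps(3) free_vars.simps(3))
next
  case (And p q)
  then show ?case by (metis sat.simps(4) free_vars.simps(4) UnI1 UnI2)
next
  case (Or p q)
  then show ?case by (metis sat.simps(5) free_vars.simps(5) UnI1 UnI2)
next
  case (Exists x p)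
  have "sat M (s(x := a)) p \<longleftrightarrow> sat M (t(x := a)) p" for a
    by (rule Exists.IH) (use Exists.prems in auto)
  then show ?case by simp
next
  case (Forall x p)
  have "sat M (s(x := a)) p \<longleftrightarrow> sat M (t(x := a)) p" for a
    by (rule Forall.IH) (use Forall.prems in auto)
  then show ?case by simp
qed simp

lemma sat_iso:
  assumes iso: "is_iso L M N f" and "is_formula L p"
    and "\<And>x. x \<in> free_vars p \<Longrightarrow> s x \<in> univ M"
  shows "sat M s p \<longleftrightarrow> sat N (f \<circ> s) p"
  using assms(2,3)
proof (induction p arbitrary: s)
  case (Rel i xs)
  then have "rel M i (map s xs) = rel N i (map f (map s xs))"
    using iso unfolding is_iso_def by (auto simp: image_subset_iff)
  then show ?case by (simp add: comp_def)
next
  case (Eq x y)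
  then show ?case
    using iso unfolding is_iso_def bij_betw_def inj_on_def by auto
next
  case (Exists x p)
  have im: "univ N = f ` univ M" using iso by (auto simp: is_iso_def bij_betw_def)
  have "sat M (s(x := a)) p \<longleftrightarrow> sat N ((f \<circ> s)(x := f a)) p" if "a \<in> univ M" for a
  proof -
    have "sat M (s(x := a)) p \<longleftrightarrow> sat N (f \<circ> s(x := a)) p"
      by (rule Exists.IH) (use Exists.prems that in auto)
    then show ?thesis by (simp add: fun_upd_comp)
  qed
  then have "\<And>a. a \<in> univ M \<Longrightarrow> sat M (s(x := a)) p \<longleftrightarrow> sat N ((\<lambda>y. f (s y))(x := f a)) p"
    by (simp only: comp_def)
  then show ?case by (auto simp: im comp_def)
next
  case (Forall x p)
  have im: "univ N = f ` univ M" using iso by (auto simp: is_iso_def bij_betw_def)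
  have "sat M (s(x := a)) p \<longleftrightarrow> sat N ((f \<circ> s)(x := f a)) p" if "a \<in> univ M" for a
  proof -
    have "sat M (s(x := a)) p \<longleftrightarrow> sat N (f \<circ> s(x := a)) p"
      by (rule Forall.IH) (use Forall.prems that in auto)
    then show ?thesis by (simp add: fun_upd_comp)
  qed
  then have "\<And>a. a \<in> univ M \<Longrightarrow> sat M (s(x := a)) p \<longleftrightarrow> sat N ((\<lambda>y. f (s y))(x := f a)) p"
    by (simp only: comp_def)
  then show ?case by (auto simp: im comp_def)
qed auto

lemma true_on_iso:
  assumes "is_iso L M N f" and "closed_formula L p"
  shows "true_on M p \<longleftrightarrow> true_on N p"
proof -
  have "sat M s p \<longleftrightarrow> sat N t p" for s t
    using sat_iso[OF assms(1), of p s] sat_cong[of p "f \<circ> s" t N] assms(2)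
    by (auto simp: closed_formula_def)
  then show ?thesis by (auto simp: true_on_def)
qed

lemma is_iso_trans:
  assumes "is_iso L M N f" and "is_iso L N K g"
  shows "is_iso L M K (g \<circ> f)"
  unfolding is_iso_def
proof (intro conjI allI impI)
  show "bij_betw (g \<circ> f) (univ M) (univ K)"
    using assms bij_betw_trans unfolding is_iso_def by blast
  fix i xs assume i: "i < length L" and xs: "length xs = L ! i \<and> set xs \<subseteq> univ M"
  have "set (map f xs) \<subseteq> univ N"
    using xs assms(1) by (auto simp: is_iso_def bij_betw_def)
  moreover have "rel M i xs = rel N i (map f xs)"
    using i xs assms(1) by (simp add: is_iso_def)
  moreover have "\<And>ys. length ys = L ! i \<Longrightarrow> set ys \<subseteq> univ N \<Longrightarrow> rel N i ys = rel K i (map g ys)"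
    using i assms(2) by (simp add: is_iso_def)
  ultimately show "rel M i xs = rel K i (map (g \<circ> f) xs)"
    using xs by (metis length_map map_map)
qed

lemma isomorphic_nat_structure:
  assumes "is_structure L (N :: 'b struct)"
  obtains K :: "nat struct" and f g
  where "is_structure L K" "is_iso L N K f" "is_iso L K N g"
proof -
  have "finite (univ N)" using assms by (simp add: is_structure_def)
  then obtain f :: "'b \<Rightarrow> nat" and m where inj: "inj_on f (univ N)"
    using finite_imp_inj_to_nat_seg by metis
  let ?g = "inv_into (univ N) f"
  let ?K = "\<lparr>univ = f ` univ N, rel = \<lambda>i xs. rel N i (map ?g xs)\<rparr> :: nat struct"
  have inv: "map (?g \<circ> f) xs = xs" if "set xs \<subseteq> univ N" for xs
    using that inj by (intro map_idI) auto
  have bij: "bij_betw f (univ N) (f ` univ N)" using inj by (simp add: bij_betw_def)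
  have "is_structure L ?K" using assms by (simp add: is_structure_def)
  moreover have "is_iso L N ?K f" using bij inv by (simp add: is_iso_def)
  moreover have "is_iso L ?K N ?g" using bij_betw_inv_into[OF bij] by (simp add: is_iso_def)
  ultimately show ?thesis by (rule that)
qed

lemma defining_formula_any:
  assumes "defining_formula L p (M :: 'a struct)" and "is_structure L (N :: 'b struct)"
    and "\<not> isomorphic L M N"
  shows "\<not> true_on N p"
proof -
  obtain K :: "nat struct" and f g
    where K: "is_structure L K" "is_iso L N K f" "is_iso L K N g"
    using isomorphic_nat_structure[OF assms(2)] by blast
  have "\<not> isomorphic L M K"
    using assms(3) K(3) is_iso_trans unfolding isomorphic_def by blast
  then show ?thesis
    using assms(1) K true_on_iso[OF K(2)] by (auto simp: defining_formula_def)
qed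

end

theory Submission
  imports Defs
begin

text \<open>
  The upper bound is a descent through atomic types. Two elements of \<open>M\<close> are similar iff they are
  interchangeable in every tuple. From each similarity class with at least \<open>k\<close> elements fix a core
  of \<open>k - 1\<close> elements, and then run \<open>k\<close> stages: enlarge the current set by at most \<open>k - 1\<close> elements
  per newly created atomic type until no further type can be split, and retire the type classes with
  at most \<open>k\<close> elements that contain no non-core element of a big class. A tuple that still separates
  two elements of the same type must meet every retired layer, so after \<open>k - 1\<close> stages all its
  parameters lie in retired layers, which is absurd; hence outside the resulting set \<open>U\<close> equality
  of types is similarity. One representative of every retired class is determined by the rest, which
  leaves a set \<open>U - Y\<close> with at most \<open>(1 - 1 / (2 * k)) * n\<close> elements.

  The defining formula says that a copy of \<open>U - Y\<close> exists over which \<open>M\<close> and the other structure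
  realise the same things in a bounded number of further one-sided moves; the retired representatives
  are then recovered layer by layer, and all classes except a strictly largest one are counted. The
  strictly largest class, of size \<open>\<sigma>\<close>, is counted without any parameters: \<open>\<sigma>\<close> elements (and not
  \<open>\<sigma> + 1\<close>) are pairwise similar, where a failure of similarity is witnessed by \<open>k - 1\<close> further elements.

  For the lower bound, duplicating an element of a class of size \<open>\<sigma>\<close> cannot be noticed with \<open>\<sigma>\<close>
  nested quantifiers.
\<close>

subsection \<open>Similarity\<close>

text \<open>With one alternation, an ordinary back-and-forth description of a tuple is out of reach:
  the tests available are games in which the first player never leaves one structure, existential in
  one direction and universal in the other. Pinned elements join the two directions: their partner
  is forced in every position of either game. They can be appended to a position whichever structure
  is being played, so they act as further parameters absent from the prefix; the price is a number
  of rounds that depends on \<open>k\<close> alone. On the constant: a representative in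
  \<open>Y\<close> is charged \<open>2 * (k - 1)\<close> named elements, half for the rest of its
  type class and half for the type that vanishes with that class although its creation was paid for.
  A big class is charged the same, half for its core and half for the type of its free elements, of
  which it has at least one. This alone would give the denominator \<open>2 * k - 1\<close>; the
  value \<open>2 * k\<close> also covers the counting of classes, which may consume about half of
  the free elements and is the main cost when \<open>k = 1\<close>.\<close>

definition same_pattern :: "'a list \<Rightarrow> 'b list \<Rightarrow> bool" where
  "same_pattern xs ys \<longleftrightarrow> length xs = length ys \<and>
     (\<forall>i<length xs. \<forall>j<length xs. xs ! i = xs ! j \<longleftrightarrow> ys ! i = ys ! j)"

lemma same_pattern_sym: "same_pattern xs ys \<Longrightarrow> same_pattern ys xs"
  by (auto simp: same_pattern_def)

lemma same_pattern_trans: "same_pattern xs ys \<Longrightarrow> same_pattern ys zs \<Longrightarrow> same_pattern xs zs"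
  by (auto simp: same_pattern_def)

lemma same_pattern_map: "inj_on f (set xs) \<Longrightarrow> same_pattern xs (map f xs)"
  by (auto simp: same_pattern_def inj_on_eq_iff)

lemma same_pattern_maps:
  assumes "\<And>x y. x \<in> set xs \<Longrightarrow> y \<in> set xs \<Longrightarrow> f x = f y \<longleftrightarrow> g x = g y"
  shows "same_pattern (map f xs) (map g xs)"
  using assms by (auto simp: same_pattern_def)

lemma same_pattern_appendD: "same_pattern (xs @ [x]) (ys @ [y]) \<Longrightarrow> same_pattern xs ys"
proof -
  assume p: "same_pattern (xs @ [x]) (ys @ [y])"
  then have len: "length xs = length ys" by (simp add: same_pattern_def)
  have "xs ! i = xs ! j \<longleftrightarrow> ys ! i = ys ! j" if "i < length xs" "j < length xs" for i j
  proof -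
    have "(xs @ [x]) ! i = (xs @ [x]) ! j \<longleftrightarrow> (ys @ [y]) ! i = (ys @ [y]) ! j"
      using p that unfolding same_pattern_def by (simp del: nth_append_length)
    then show ?thesis using that len by (simp add: nth_append)
  qed
  then show ?thesis using len by (simp add: same_pattern_def)
qed

lemma same_pattern_distinct: "same_pattern xs ys \<Longrightarrow> distinct xs \<Longrightarrow> distinct ys"
  by (auto simp: same_pattern_def distinct_conv_nth)

lemma transpose_mem: "a \<in> A \<Longrightarrow> b \<in> A \<Longrightarrow> x \<in> A \<Longrightarrow> transpose a b x \<in> A"
  by (auto simp: transpose_def)

lemma bij_betw_transpose: "a \<in> A \<Longrightarrow> b \<in> A \<Longrightarrow> bij_betw (transpose a b) A A"
  by (rule bij_betw_byWitness[where f' = "transpose a b"]) (auto intro: transpose_mem)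

lemma equiv_similar: "equiv (univ M) (similar L M)"
proof (rule equivI)
  show "refl_on (univ M) (similar L M)"
    by (auto simp: refl_on_def similar_def is_iso_def)
  show "similar L M \<subseteq> univ M \<times> univ M" by (auto simp: similar_def)
  show "sym (similar L M)"
    by (auto simp: sym_def similar_def transpose_commute)
  show "trans (similar L M)"
  proof (rule transI)
    fix a b c assume ab: "(a, b) \<in> similar L M" and bc: "(b, c) \<in> similar L M"
    show "(a, c) \<in> similar L M"
    proof (cases "a = c \<or> a = b \<or> b = c")
      case True
      then show ?thesis using ab bc by (auto simp: similar_def is_iso_def)
    next
      case False
      have "transpose a c = transpose a b \<circ> (transpose b c \<circ> transpose a b)"
        using False by (auto simp: transpose_def fun_eq_iff)
      moreover have "is_iso L M M (transpose a b \<circ> (transpose b c \<circ> transpose a b))"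
        using ab bc by (auto simp: similar_def intro!: is_iso_trans[where N = M])
      ultimately show ?thesis using ab bc by (auto simp: similar_def)
    qed
  qed
qed

lemma similar_refl: "a \<in> univ M \<Longrightarrow> (a, a) \<in> similar L M"
  using equiv_similar[of M L] by (auto simp: equiv_def refl_on_def)

lemma similar_sym: "(a, b) \<in> similar L M \<Longrightarrow> (b, a) \<in> similar L M"
  using equiv_similar[of M L] by (auto simp: equiv_def sym_def)

lemma similar_trans:
  "(a, b) \<in> similar L M \<Longrightarrow> (b, c) \<in> similar L M \<Longrightarrow> (a, c) \<in> similar L M"
  using equiv_similar[of M L] by (auto simp: equiv_def trans_def)

lemma similar_univ: "(a, b) \<in> similar L M \<Longrightarrow> a \<in> univ M \<and> b \<in> univ M"
  by (auto simp: similar_def)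

lemma similar_rel:
  assumes "(a, b) \<in> similar L M" "i < length L" "length xs = L ! i" "set xs \<subseteq> univ M"
  shows "rel M i (map (transpose a b) xs) = rel M i xs"
  using assms by (auto simp: similar_def is_iso_def)

lemma similarI:
  assumes "a \<in> univ M" "b \<in> univ M"
    and "\<And>i xs. i < length L \<Longrightarrow> length xs = L ! i \<Longrightarrow> set xs \<subseteq> univ M \<Longrightarrow>
      rel M i xs = rel M i (map (transpose a b) xs)"
  shows "(a, b) \<in> similar L M"
  using assms by (auto simp: similar_def is_iso_def intro: bij_betw_transpose)

text \<open>Automorphic transpositions generate every relabelling inside the similarity classes: swap the
  two entries of a position where the tuples differ; by equality of the patterns this never
  destroys an agreement.\<close>

lemma rel_similar_pattern:
  assumes "i < length L" "length xs = L ! i" "same_pattern xs ys"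
    and "\<And>j. j < length xs \<Longrightarrow> (xs ! j, ys ! j) \<in> similar L M"
  shows "rel M i xs = rel M i ys"
  using assms(2-)
proof (induction "card {j. j < length xs \<and> xs ! j \<noteq> ys ! j}" arbitrary: xs rule: less_induct)
  case less
  note sim = less.prems(3) and pat = less.prems(2)
  have len: "length ys = length xs" using pat by (auto simp: same_pattern_def)
  have un: "set xs \<subseteq> univ M" using sim similar_univ by (metis in_set_conv_nth subsetI)
  show ?case
  proof (cases "\<exists>j<length xs. xs ! j \<noteq> ys ! j")
    case False
    then have "xs = ys" using len by (auto intro: nth_equalityI)
    then show ?thesis by simp
  next
    case True
    then obtain j where j: "j < length xs" "xs ! j \<noteq> ys ! j" by blast
    let ?t = "transpose (xs ! j) (ys ! j)"
    let ?zs = "map ?t xs"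
    have pj: "xs ! l = xs ! j \<longleftrightarrow> ys ! l = ys ! j" if "l < length xs" for l
      using pat j that by (auto simp: same_pattern_def)
    have agree: "?zs ! l = ys ! l" if "l < length xs" "xs ! l = ys ! l" for l
      using pj[OF that(1)] j that by (auto simp: transpose_def)
    have "{l. l < length ?zs \<and> ?zs ! l \<noteq> ys ! l} \<subset> {l. l < length xs \<and> xs ! l \<noteq> ys ! l}"
    proof (rule psubsetI)
      show "{l. l < length ?zs \<and> ?zs ! l \<noteq> ys ! l} \<subseteq> {l. l < length xs \<and> xs ! l \<noteq> ys ! l}"
        using agree by auto
      have "j \<in> {l. l < length xs \<and> xs ! l \<noteq> ys ! l}" "j \<notin> {l. l < length ?zs \<and> ?zs ! l \<noteq> ys ! l}"
        using j by auto
      then show "{l. l < length ?zs \<and> ?zs ! l \<noteq> ys ! l} \<noteq> {l. l < length xs \<and> xs ! l \<noteq> ys ! l}"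
        by blast
    qed
    then have "card {l. l < length ?zs \<and> ?zs ! l \<noteq> ys ! l} < card {l. l < length xs \<and> xs ! l \<noteq> ys ! l}"
      by (rule psubset_card_mono[rotated]) auto
    moreover have "length ?zs = L ! i" using less.prems(1) by simp
    moreover have "same_pattern ?zs ys"
    proof -
      have "inj_on ?t (set xs)" by (metis inj_onI transpose_involutory)
      then show ?thesis using same_pattern_trans[OF same_pattern_sym[OF same_pattern_map] pat] by blast
    qed
    moreover have "(?zs ! l, ys ! l) \<in> similar L M" if "l < length ?zs" for l
    proof -
      have l: "l < length xs" using that by simp
      consider "xs ! l = xs ! j" | "xs ! l = ys ! j" "xs ! l \<noteq> xs ! j" | "?zs ! l = xs ! l"
        using l by (cases "xs ! l = xs ! j"; cases "xs ! l = ys ! j") auto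
      then show ?thesis
      proof cases
        case 1
        then have "?zs ! l = ys ! l" using pj[OF l] l by simp
        then show ?thesis using sim[OF l] similar_univ similar_refl by metis
      next
        case 2
        then have "?zs ! l = xs ! j" using l by simp
        then show ?thesis using 2 sim[OF l] sim[OF j(1)] similar_trans by metis
      next
        case 3
        then show ?thesis using sim[OF l] by simp
      qed
    qed
    ultimately have "rel M i ?zs = rel M i ys" by (rule less.hyps)
    then show ?thesis
      using similar_rel[OF sim[OF j(1)] assms(1) less.prems(1) un] by simp
  qed
qed

subsection \<open>One-sided games and their formulas\<close>

definition same_atoms :: "vocabulary \<Rightarrow> 'a struct \<Rightarrow> 'a list \<Rightarrow> 'b struct \<Rightarrow> 'b list \<Rightarrow> bool" where
  "same_atoms L M xs N ys \<longleftrightarrow> same_pattern xs ys \<and>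
     (\<forall>r<length L. \<forall>is. length is = L ! r \<and> set is \<subseteq> {..<length xs} \<longrightarrow>
        rel M r (map ((!) xs) is) = rel N r (map ((!) ys) is))"

text \<open>The second player survives \<open>m\<close> further rounds in which the first player moves only in \<open>M\<close>.\<close>

fun survives :: "vocabulary \<Rightarrow> nat \<Rightarrow> 'a struct \<Rightarrow> 'a list \<Rightarrow> 'b struct \<Rightarrow> 'b list \<Rightarrow> bool" where
  "survives L 0 M xs N ys = same_atoms L M xs N ys"
| "survives L (Suc m) M xs N ys =
     (\<forall>a\<in>univ M. \<exists>b\<in>univ N. survives L m M (xs @ [a]) N (ys @ [b]))"

lemma same_atoms_sym: "same_atoms L M xs N ys \<Longrightarrow> same_atoms L N ys M xs"
  by (auto simp: same_atoms_def same_pattern_def)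

lemma same_atoms_commute: "same_atoms L M xs N ys \<longleftrightarrow> same_atoms L N ys M xs"
  by (blast intro: same_atoms_sym)

lemma same_atoms_rel:
  assumes "same_atoms L M xs N ys" "r < length L" "length cs = L ! r"
    and "\<And>c. c \<in> set cs \<Longrightarrow> \<exists>l<length xs. g c = xs ! l \<and> g' c = ys ! l"
  shows "rel M r (map g cs) = rel N r (map g' cs)"
proof -
  obtain f where f: "\<And>c. c \<in> set cs \<Longrightarrow> f c < length xs \<and> g c = xs ! f c \<and> g' c = ys ! f c"
    using assms(4) by metis
  have "rel M r (map ((!) xs) (map f cs)) = rel N r (map ((!) ys) (map f cs))"
  proof -
    have "length (map f cs) = L ! r \<and> set (map f cs) \<subseteq> {..<length xs}"
      using assms(3) f by auto
    then show ?thesis using assms(1,2) unfolding same_atoms_def by blast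
  qed
  moreover have "map ((!) xs) (map f cs) = map g cs" "map ((!) ys) (map f cs) = map g' cs"
    using f by auto
  ultimately show ?thesis by metis
qed

lemma same_atoms_appendD:
  assumes "same_atoms L M (xs @ [x]) N (ys @ [y])"
  shows "same_atoms L M xs N ys"
proof -
  have pat: "same_pattern xs ys" using assms same_pattern_appendD by (auto simp: same_atoms_def)
  have "rel M r (map ((!) xs) is) = rel N r (map ((!) ys) is)"
    if "r < length L" "length is = L ! r" "set is \<subseteq> {..<length xs}" for r "is"
    by (rule same_atoms_rel[OF assms that(1,2)])
      (use that pat in \<open>auto simp: same_pattern_def nth_append intro!: exI\<close>)
  then show ?thesis using pat by (auto simp: same_atoms_def)
qed

text \<open>Any move of the first player yields a longer tuple that can be restricted. If
  \<open>univ M\<close> were empty, surviving one or more rounds would be vacuous; nonemptiness is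
  therefore carried along wherever rounds are discarded.\<close>

lemma survives_same_atoms:
  "survives L m M xs N ys \<Longrightarrow> univ M \<noteq> {} \<Longrightarrow> same_atoms L M xs N ys"
proof (induction m arbitrary: xs ys)
  case (Suc m)
  then obtain a b where "survives L m M (xs @ [a]) N (ys @ [b])" by fastforce
  then have "same_atoms L M (xs @ [a]) N (ys @ [b])" using Suc.IH Suc.prems(2) by metis
  then show ?case by (rule same_atoms_appendD)
qed simp

lemma survives_Suc:
  "survives L (Suc m) M xs N ys \<Longrightarrow> univ M \<noteq> {} \<Longrightarrow> survives L m M xs N ys"
proof (induction m arbitrary: xs ys)
  case 0
  then show ?case using survives_same_atoms by fastforce
next
  case (Suc m)
  then show ?case by (metis survives.simps(2))
qed

lemma survives_mono:
  assumes "survives L m M xs N ys" "univ M \<noteq> {}" "m' \<le> m"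
  shows "survives L m' M xs N ys"
  using assms(3,1) by (induction rule: inc_induct) (use assms(2) survives_Suc in blast)+

lemma survives_refl: "survives L m M xs M xs"
  by (induction m arbitrary: xs) (auto simp: same_atoms_def same_pattern_def)

lemma survives_append:
  assumes "survives L (m + length zs) M xs N ys" "set zs \<subseteq> univ M"
  shows "\<exists>zs'. length zs' = length zs \<and> set zs' \<subseteq> univ N \<and> survives L m M (xs @ zs) N (ys @ zs')"
  using assms
proof (induction zs arbitrary: xs ys)
  case (Cons z zs)
  then obtain b where b: "b \<in> univ N" "survives L (m + length zs) M (xs @ [z]) N (ys @ [b])"
    by auto
  then obtain zs' where "length zs' = length zs" "set zs' \<subseteq> univ N"
      "survives L m M ((xs @ [z]) @ zs) N ((ys @ [b]) @ zs')"
    using Cons.IH[OF b(2)] Cons.prems by auto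
  then show ?case using b by (intro exI[of _ "b # zs'"]) auto
qed simp

section \<open>Formulas expressing the one-sided games\<close>

fun conj_list :: "fm list \<Rightarrow> fm" where
  "conj_list [] = Eq 0 0"
| "conj_list [p] = p"
| "conj_list (p # q # ps) = And p (conj_list (q # ps))"

fun disj_list :: "fm list \<Rightarrow> fm" where
  "disj_list [] = Neg (Eq 0 0)"
| "disj_list [p] = p"
| "disj_list (p # q # ps) = Or p (disj_list (q # ps))"

lemma sat_conj_list: "sat M s (conj_list ps) \<longleftrightarrow> (\<forall>p\<in>set ps. sat M s p)"
  by (induction ps rule: conj_list.induct) auto

lemma sat_disj_list: "sat M s (disj_list ps) \<longleftrightarrow> (\<exists>p\<in>set ps. sat M s p)"
  by (induction ps rule: disj_list.induct) auto

lemma is_formula_conj_list: "is_formula L (conj_list ps) \<longleftrightarrow> (\<forall>p\<in>set ps. is_formula L p)"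
  by (induction ps rule: conj_list.induct) auto

lemma is_formula_disj_list: "is_formula L (disj_list ps) \<longleftrightarrow> (\<forall>p\<in>set ps. is_formula L p)"
  by (induction ps rule: disj_list.induct) auto

lemma free_vars_conj_list:
  "ps \<noteq> [] \<Longrightarrow> free_vars (conj_list ps) = (\<Union>p\<in>set ps. free_vars p)"
  by (induction ps rule: conj_list.induct) auto

lemma free_vars_disj_list:
  "ps \<noteq> [] \<Longrightarrow> free_vars (disj_list ps) = (\<Union>p\<in>set ps. free_vars p)"
  by (induction ps rule: disj_list.induct) auto

lemma nest_conj_list: "ps \<noteq> [] \<Longrightarrow> nest (conj_list ps) = (\<Union>p\<in>set ps. nest p)"
  by (induction ps rule: conj_list.induct) auto

lemma nest_disj_list: "ps \<noteq> [] \<Longrightarrow> nest (disj_list ps) = (\<Union>p\<in>set ps. nest p)"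
  by (induction ps rule: disj_list.induct) auto

definition literal :: "bool \<Rightarrow> fm \<Rightarrow> fm" where
  "literal b p = (if b then p else Neg p)"

lemma sat_literal: "sat M s (literal b p) \<longleftrightarrow> sat M s p = b"
  by (simp add: literal_def)

definition diagram_list :: "vocabulary \<Rightarrow> 'a struct \<Rightarrow> 'a list \<Rightarrow> fm list" where
  "diagram_list L M xs =
     [literal (xs ! i = xs ! j) (Eq i j). i \<leftarrow> [0..<length xs], j \<leftarrow> [0..<length xs]] @
     [literal (rel M r (map ((!) xs) is)) (Rel r is).
        r \<leftarrow> [0..<length L], is \<leftarrow> List.n_lists (L ! r) [0..<length xs]]"

definition assign :: "(nat \<Rightarrow> 'a) \<Rightarrow> 'a list \<Rightarrow> nat \<Rightarrow> 'a" where
  "assign t ys i = (if i < length ys then ys ! i else t i)"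

lemma assign_upd: "(assign t ys)(length ys := a) = assign t (ys @ [a])"
  by (auto simp: assign_def fun_eq_iff nth_append)

lemma assign_Nil: "assign t [] = t"
  by (auto simp: assign_def fun_eq_iff)

lemma sat_diagram:
  assumes "length ys = length xs"
  shows "sat N (assign t ys) (conj_list (diagram_list L M xs)) \<longleftrightarrow> same_atoms L M xs N ys"
proof -
  have m: "map (assign t ys) is = map ((!) ys) is" if "set is \<subseteq> {..<length xs}" for "is"
    using that assms by (auto simp: assign_def)
  have "sat N (assign t ys) (conj_list (diagram_list L M xs)) \<longleftrightarrow>
     (\<forall>i<length xs. \<forall>j<length xs. (ys ! i = ys ! j) = (xs ! i = xs ! j)) \<and>
     (\<forall>r<length L. \<forall>is. length is = L ! r \<and> set is \<subseteq> {..<length xs} \<longrightarrow>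
        rel N r (map (assign t ys) is) = rel M r (map ((!) xs) is))"
    unfolding sat_conj_list diagram_list_def
    by (auto simp: ball_Un sat_literal set_n_lists assign_def assms atLeast0LessThan)
  also have "\<dots> \<longleftrightarrow> same_atoms L M xs N ys"
    unfolding same_atoms_def same_pattern_def by (simp add: assms m eq_commute[of "rel N _ _"]) blast
  finally show ?thesis .
qed

lemma diagram_list_Nil: "xs \<noteq> [] \<Longrightarrow> diagram_list L M xs \<noteq> []"
  by (cases xs) (auto simp: diagram_list_def upt_conv_Cons)

lemma nest_diagram: "nest (conj_list (diagram_list L M xs)) = {[]}"
proof (cases "diagram_list L M xs = []")
  case False
  have "nest p = {[]}" if "p \<in> set (diagram_list L M xs)" for p
    using that by (auto simp: diagram_list_def literal_def)
  then show ?thesis using False by (auto simp: nest_conj_list neq_Nil_conv)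
qed simp

lemma is_formula_diagram: "is_formula L (conj_list (diagram_list L M xs))"
  by (auto simp: is_formula_conj_list diagram_list_def literal_def set_n_lists)

lemma free_vars_diagram:
  "xs \<noteq> [] \<Longrightarrow> free_vars (conj_list (diagram_list L M xs)) \<subseteq> {..<length xs}"
  by (auto simp: free_vars_conj_list diagram_list_Nil)
    (auto simp: diagram_list_def literal_def set_n_lists split: if_splits)

text \<open>One-sided Hintikka formulas, with \<open>vs\<close> enumerating the universe of
  \<open>M\<close>: here every move in \<open>M\<close> must be answered in the other structure,
  while \<open>all_type\<close> dually asks for an answer in \<open>M\<close> to every move outside.
  Neither mixes quantifiers, so a block put in front of them costs at most one alternation.\<close>

fun ex_type :: "vocabulary \<Rightarrow> 'a struct \<Rightarrow> 'a list \<Rightarrow> nat \<Rightarrow> 'a list \<Rightarrow> fm" where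
  "ex_type L M vs 0 xs = conj_list (diagram_list L M xs)"
| "ex_type L M vs (Suc m) xs =
     conj_list (map (\<lambda>a. Exists (length xs) (ex_type L M vs m (xs @ [a]))) vs)"

fun all_type :: "vocabulary \<Rightarrow> 'a struct \<Rightarrow> 'a list \<Rightarrow> nat \<Rightarrow> 'a list \<Rightarrow> fm" where
  "all_type L M vs 0 xs = conj_list (diagram_list L M xs)"
| "all_type L M vs (Suc m) xs =
     Forall (length xs) (disj_list (map (\<lambda>a. all_type L M vs m (xs @ [a])) vs))"

lemma sat_ex_type:
  assumes "set vs = univ M" "length ys = length xs"
  shows "sat N (assign t ys) (ex_type L M vs m xs) \<longleftrightarrow> survives L m M xs N ys"
  using assms(2)
proof (induction m arbitrary: xs ys)
  case (Suc m)
  have "sat N ((assign t ys)(length xs := b)) (ex_type L M vs m (xs @ [a])) \<longleftrightarrow>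
     survives L m M (xs @ [a]) N (ys @ [b])" for a b
    using Suc.IH[of "ys @ [b]" "xs @ [a]"] Suc.prems assign_upd[of t ys b] by simp
  then show ?case by (auto simp: sat_conj_list assms(1))
qed (simp add: sat_diagram)

lemma sat_all_type:
  assumes "set vs = univ M" "length ys = length xs"
  shows "sat N (assign t ys) (all_type L M vs m xs) \<longleftrightarrow> survives L m N ys M xs"
  using assms(2)
proof (induction m arbitrary: xs ys)
  case 0
  then show ?case by (simp add: sat_diagram same_atoms_commute[of L M])
next
  case (Suc m)
  have "sat N ((assign t ys)(length xs := b)) (all_type L M vs m (xs @ [a])) \<longleftrightarrow>
     survives L m N (ys @ [b]) M (xs @ [a])" for a b
    using Suc.IH[of "ys @ [b]" "xs @ [a]"] Suc.prems assign_upd[of t ys b] by simp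
  then show ?case by (auto simp: sat_disj_list assms(1))
qed

lemma nest_ex_type: "vs \<noteq> [] \<Longrightarrow> nest (ex_type L M vs m xs) = {replicate m QEx}"
  by (induction m arbitrary: xs) (auto simp: nest_diagram nest_conj_list neq_Nil_conv)

lemma nest_all_type: "vs \<noteq> [] \<Longrightarrow> nest (all_type L M vs m xs) = {replicate m QAll}"
  by (induction m arbitrary: xs) (auto simp: nest_diagram nest_disj_list neq_Nil_conv)

lemma is_formula_ex_type: "is_formula L (ex_type L M vs m xs)"
proof (induction m arbitrary: xs)
  case 0
  then show ?case by (simp add: is_formula_diagram)
qed (simp add: is_formula_conj_list)

lemma is_formula_all_type: "is_formula L (all_type L M vs m xs)"
  by (induction m arbitrary: xs) (simp_all add: is_formula_diagram is_formula_disj_list)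

lemma free_vars_ex_type:
  "vs \<noteq> [] \<Longrightarrow> xs \<noteq> [] \<or> m > 0 \<Longrightarrow> free_vars (ex_type L M vs m xs) \<subseteq> {..<length xs}"
proof (induction m arbitrary: xs)
  case (Suc m)
  then have "free_vars (ex_type L M vs m (xs @ [a])) \<subseteq> {..<Suc (length xs)}" for a
    by (metis length_append_singleton snoc_eq_iff_butlast)
  then show ?case using Suc.prems by (fastforce simp: free_vars_conj_list)
qed (use free_vars_diagram in auto)

lemma free_vars_all_type:
  "vs \<noteq> [] \<Longrightarrow> xs \<noteq> [] \<or> m > 0 \<Longrightarrow> free_vars (all_type L M vs m xs) \<subseteq> {..<length xs}"
proof (induction m arbitrary: xs)
  case (Suc m)
  then have "free_vars (all_type L M vs m (xs @ [a])) \<subseteq> {..<Suc (length xs)}" for a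
    by (metis length_append_singleton snoc_eq_iff_butlast)
  then show ?case using Suc.prems by (fastforce simp: free_vars_disj_list)
qed (use free_vars_diagram in auto)

fun ex_prefix :: "nat \<Rightarrow> fm \<Rightarrow> fm" where
  "ex_prefix 0 p = p"
| "ex_prefix (Suc b) p = ex_prefix b (Exists b p)"

fun all_prefix :: "nat \<Rightarrow> fm \<Rightarrow> fm" where
  "all_prefix 0 p = p"
| "all_prefix (Suc b) p = all_prefix b (Forall b p)"

lemma ex_list_Suc:
  "(\<exists>ys. length ys = Suc b \<and> set ys \<subseteq> A \<and> P ys) \<longleftrightarrow>
   (\<exists>ys. length ys = b \<and> set ys \<subseteq> A \<and> (\<exists>a\<in>A. P (ys @ [a])))"
proof
  assume "\<exists>ys. length ys = Suc b \<and> set ys \<subseteq> A \<and> P ys"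
  then obtain ys where "length ys = Suc b" "set ys \<subseteq> A" "P ys" by blast
  then show "\<exists>ys. length ys = b \<and> set ys \<subseteq> A \<and> (\<exists>a\<in>A. P (ys @ [a]))"
    by (cases ys rule: rev_cases) auto
next
  assume "\<exists>ys. length ys = b \<and> set ys \<subseteq> A \<and> (\<exists>a\<in>A. P (ys @ [a]))"
  then obtain ys a where "length ys = b" "set ys \<subseteq> A" "a \<in> A" "P (ys @ [a])" by blast
  then show "\<exists>ys. length ys = Suc b \<and> set ys \<subseteq> A \<and> P ys" by (intro exI[of _ "ys @ [a]"]) auto
qed

lemma sat_ex_prefix:
  "sat N t (ex_prefix b p) \<longleftrightarrow> (\<exists>ys. length ys = b \<and> set ys \<subseteq> univ N \<and> sat N (assign t ys) p)"
proof (induction b arbitrary: p)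
  case 0
  then show ?case by (auto simp: assign_Nil)
next
  case (Suc b)
  have "sat N t (ex_prefix (Suc b) p) \<longleftrightarrow>
    (\<exists>ys. length ys = b \<and> set ys \<subseteq> univ N \<and> (\<exists>a\<in>univ N. sat N (assign t (ys @ [a])) p))"
    using Suc by (auto simp flip: assign_upd)
  then show ?case using ex_list_Suc[of b "univ N" "\<lambda>ys. sat N (assign t ys) p"] by blast
qed

lemma sat_all_prefix:
  "sat N t (all_prefix b p) \<longleftrightarrow> (\<forall>ys. length ys = b \<and> set ys \<subseteq> univ N \<longrightarrow> sat N (assign t ys) p)"
proof (induction b arbitrary: p)
  case 0
  then show ?case by (auto simp: assign_Nil)
next
  case (Suc b)
  have "sat N t (all_prefix (Suc b) p) \<longleftrightarrow>
    (\<forall>ys. length ys = b \<and> set ys \<subseteq> univ N \<longrightarrow> (\<forall>a\<in>univ N. sat N (assign t (ys @ [a])) p))"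
    using Suc by (auto simp flip: assign_upd)
  then show ?case using ex_list_Suc[of b "univ N" "\<lambda>ys. \<not> sat N (assign t ys) p"] by blast
qed

lemma nest_ex_prefix: "nest (ex_prefix b p) = (\<lambda>w. replicate b QEx @ w) ` nest p"
  by (induction b arbitrary: p) (auto simp: image_image replicate_app_Cons_same)

lemma nest_all_prefix: "nest (all_prefix b p) = (\<lambda>w. replicate b QAll @ w) ` nest p"
  by (induction b arbitrary: p) (auto simp: image_image replicate_app_Cons_same)

lemma is_formula_ex_prefix: "is_formula L (ex_prefix b p) \<longleftrightarrow> is_formula L p"
  by (induction b arbitrary: p) auto

lemma is_formula_all_prefix: "is_formula L (all_prefix b p) \<longleftrightarrow> is_formula L p"
  by (induction b arbitrary: p) auto

lemma free_vars_ex_prefix: "free_vars (ex_prefix b p) = free_vars p - {..<b}"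
  by (induction b arbitrary: p) (auto simp: less_Suc_eq)

lemma free_vars_all_prefix: "free_vars (all_prefix b p) = free_vars p - {..<b}"
  by (induction b arbitrary: p) (auto simp: less_Suc_eq)

lemma alternations_two_blocks: "alternations (replicate a q @ replicate b q') \<le> 1"
proof -
  let ?w = "replicate a q @ replicate b q'"
  have "i = a - 1" if "Suc i < length ?w" "?w ! i \<noteq> ?w ! Suc i" for i
    using that by (cases "Suc i < a"; cases "i < a") (auto simp: nth_append)
  then have "{i. Suc i < length ?w \<and> ?w ! i \<noteq> ?w ! Suc i} \<subseteq> {a - 1}" by blast
  from card_mono[OF _ this] show ?thesis by (simp add: alternations_def)
qed

lemma finite_nest: "finite (nest p)" and nest_nonempty: "nest p \<noteq> {}"
  by (induction p) auto

lemma two_block_bounds: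
  assumes "\<And>w. w \<in> nest p \<Longrightarrow> length w \<le> r \<and> (\<exists>a q b q'. w = replicate a q @ replicate b q')"
  shows "quantifier_rank p \<le> r" "alternation_number p \<le> 1"
proof -
  show "quantifier_rank p \<le> r"
    using assms finite_nest[of p] nest_nonempty[of p] by (auto simp: quantifier_rank_def)
  have "alternations w \<le> 1" if "w \<in> nest p" for w
    using assms[OF that] alternations_two_blocks by metis
  then show "alternation_number p \<le> 1"
    using finite_nest[of p] nest_nonempty[of p] by (auto simp: alternation_number_def)
qed

lemma D1_le:
  assumes "defining_formula L p M" "alternation_number p \<le> 1" "quantifier_rank p \<le> r"
  shows "D1 L M \<le> r"
  using assms unfolding D1_def by (metis (mono_tags, lifting) Least_le le_trans)

lemma D_le_D1:
  assumes "defining_formula L p M" "alternation_number p \<le> 1"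
  shows "D L M \<le> D1 L M"
proof -
  have "\<exists>p. defining_formula L p M \<and> alternation_number p \<le> 1 \<and> quantifier_rank p = D1 L M"
    unfolding D1_def by (rule LeastI_ex) (use assms in blast)
  then show ?thesis unfolding D_def by (metis (mono_tags, lifting) Least_le)
qed

text \<open>Each conjunct is a block of quantifiers followed by one-sided types, so no word of its
  nest has more than two blocks. The tuple \<open>bs\<close> is tested in both directions. The tuple
  \<open>cs\<close> prepares the count of one class: some copy of it survives \<open>q\<close> moves
  in \<open>N\<close>, and every tuple of \<open>N\<close> with one more entry resembles a tuple of
  \<open>M\<close> for \<open>q\<close> moves in \<open>M\<close>. Requiring \<open>e > 0\<close>
  and \<open>cs \<noteq> []\<close> keeps the sentence closed, since the empty conjunction contains
  the variable \<open>0\<close>.\<close>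

lemma two_block_sentence:
  assumes M: "finite (univ M)" "univ M \<noteq> {}"
    and bs: "set bs \<subseteq> univ M" and cs: "set cs \<subseteq> univ M" and "e > 0" "cs \<noteq> []"
  obtains p where "closed_formula L p" "alternation_number p \<le> 1"
    "quantifier_rank p \<le> max (length bs + e) (length cs + 1 + q)"
    "true_on M p"
    "\<And>N :: nat struct. true_on N p \<Longrightarrow>
       (\<exists>bs'. set bs' \<subseteq> univ N \<and> survives L e M bs N bs' \<and> survives L e N bs' M bs \<and>
         length bs' = length bs) \<and>
       (\<exists>cs'. set cs' \<subseteq> univ N \<and> survives L q N cs' M cs \<and> length cs' = length cs) \<and>
       (\<forall>ys. length ys = length cs + 1 \<and> set ys \<subseteq> univ N \<longrightarrow>
         (\<exists>xs. length xs = length ys \<and> set xs \<subseteq> univ M \<and> survives L q M xs N ys))"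
proof -
  obtain vs where vs: "set vs = univ M" using M finite_list by blast
  then have vs0: "vs \<noteq> []" using M by auto
  define ts where "ts = List.n_lists (length cs + 1) vs"
  have ts: "set ts = {xs. length xs = length cs + 1 \<and> set xs \<subseteq> univ M}"
    unfolding ts_def set_n_lists vs by simp
  have ts0: "ts \<noteq> []"
  proof -
    have "replicate (length cs + 1) (hd vs) \<in> set ts" using ts vs vs0 by auto
    then show ?thesis by auto
  qed
  define p1 where "p1 = ex_prefix (length bs) (And (ex_type L M vs e bs) (all_type L M vs e bs))"
  define p2 where "p2 = ex_prefix (length cs) (all_type L M vs q cs)"
  define p3 where "p3 = all_prefix (length cs + 1) (disj_list (map (ex_type L M vs q) ts))"
  define p where "p = And p1 (And p2 p3)"
  have 1: "sat N t p1 \<longleftrightarrow> (\<exists>bs'. length bs' = length bs \<and> set bs' \<subseteq> univ N \<and>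
       survives L e M bs N bs' \<and> survives L e N bs' M bs)" for N :: "'b struct" and t
    by (auto simp: p1_def sat_ex_prefix sat_ex_type[OF vs] sat_all_type[OF vs])
  have 2: "sat N t p2 \<longleftrightarrow> (\<exists>cs'. length cs' = length cs \<and> set cs' \<subseteq> univ N \<and>
       survives L q N cs' M cs)" for N :: "'b struct" and t
    by (auto simp: p2_def sat_ex_prefix sat_all_type[OF vs])
  have 3: "sat N t p3 \<longleftrightarrow> (\<forall>ys. length ys = length cs + 1 \<and> set ys \<subseteq> univ N \<longrightarrow>
       (\<exists>xs. length xs = length ys \<and> set xs \<subseteq> univ M \<and> survives L q M xs N ys))"
    for N :: "'b struct" and t
  proof -
    have "sat N (assign t ys) (disj_list (map (ex_type L M vs q) ts)) \<longleftrightarrow>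
       (\<exists>xs. length xs = length ys \<and> set xs \<subseteq> univ M \<and> survives L q M xs N ys)"
      if "length ys = length cs + 1" for ys :: "'b list"
      unfolding sat_disj_list using that by (auto simp: ts sat_ex_type[OF vs])
    then show ?thesis unfolding p3_def sat_all_prefix by blast
  qed
  have n1: "w \<in> nest p1 \<Longrightarrow> w = replicate (length bs) QEx @ replicate e QEx \<or>
      w = replicate (length bs) QEx @ replicate e QAll" for w
    by (auto simp: p1_def nest_ex_prefix nest_ex_type[OF vs0] nest_all_type[OF vs0])
  have n2: "w \<in> nest p2 \<Longrightarrow> w = replicate (length cs) QEx @ replicate q QAll" for w
    by (auto simp: p2_def nest_ex_prefix nest_all_type[OF vs0])
  have n3: "w \<in> nest p3 \<Longrightarrow> w = replicate (length cs + 1) QAll @ replicate q QEx" for w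
    unfolding p3_def nest_all_prefix using ts0 by (auto simp: nest_disj_list nest_ex_type[OF vs0])
  have w: "length w \<le> max (length bs + e) (length cs + 1 + q) \<and>
      (\<exists>a q b q'. w = replicate a q @ replicate b q')" if "w \<in> nest p" for w
  proof -
    have "w \<in> nest p1 \<or> w \<in> nest p2 \<or> w \<in> nest p3" using that by (auto simp: p_def)
    then consider "w = replicate (length bs) QEx @ replicate e QEx"
      | "w = replicate (length bs) QEx @ replicate e QAll"
      | "w = replicate (length cs) QEx @ replicate q QAll"
      | "w = replicate (length cs + 1) QAll @ replicate q QEx" using n1 n2 n3 by blast
    then show ?thesis
    proof cases
      case 1 then show ?thesis by (metis length_append length_replicate max.cobounded1)
    next
      case 2 then show ?thesis by (metis length_append length_replicate max.cobounded1)
    next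
      case 3
      then have "length w \<le> max (length bs + e) (length cs + 1 + q)" by simp
      then show ?thesis using 3 by blast
    next
      case 4
      then have "length w \<le> max (length bs + e) (length cs + 1 + q)" by simp
      then show ?thesis using 4 by blast
    qed
  qed
  have "is_formula L p"
    by (auto simp: p_def p1_def p2_def p3_def is_formula_ex_prefix is_formula_all_prefix
        is_formula_disj_list is_formula_ex_type is_formula_all_type)
  moreover have "free_vars p = {}"
  proof -
    have "free_vars (ex_type L M vs q xs) \<subseteq> {..<length cs + 1}" if "xs \<in> set ts" for xs
      using free_vars_ex_type[OF vs0, of xs q L M] that ts by fastforce
    then have "free_vars p3 = {}"
      using ts0 unfolding p3_def free_vars_all_prefix by (auto simp: free_vars_disj_list)
    then show ?thesis
      using free_vars_ex_type[OF vs0, of bs e L M] free_vars_all_type[OF vs0, of bs e L M]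
        free_vars_all_type[OF vs0, of cs q L M] assms
      by (auto simp: p_def p1_def p2_def free_vars_ex_prefix)
  qed
  ultimately have "closed_formula L p" by (simp add: closed_formula_def)
  moreover have "quantifier_rank p \<le> max (length bs + e) (length cs + 1 + q)"
    "alternation_number p \<le> 1"
    using two_block_bounds[of p, OF w] by blast+
  moreover have "true_on M p"
    unfolding true_on_def p_def sat.simps 1 2 3 using survives_refl bs cs by blast
  moreover have "(\<exists>bs'. set bs' \<subseteq> univ N \<and> survives L e M bs N bs' \<and> survives L e N bs' M bs \<and>
         length bs' = length bs) \<and>
       (\<exists>cs'. set cs' \<subseteq> univ N \<and> survives L q N cs' M cs \<and> length cs' = length cs) \<and>
       (\<forall>ys. length ys = length cs + 1 \<and> set ys \<subseteq> univ N \<longrightarrow>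
         (\<exists>xs. length xs = length ys \<and> set xs \<subseteq> univ M \<and> survives L q M xs N ys))"
    if "true_on N p" for N :: "nat struct"
    using that unfolding true_on_def p_def sat.simps 1 2 3 by blast
  ultimately show ?thesis using that by blast
qed

subsection \<open>Cloning an element\<close>

lemma finite_free_vars: "finite (free_vars p)"
  by (induction p) auto

lemma similar_class_iff:
  assumes "A \<in> univ M // similar L M" "a \<in> A"
  shows "b \<in> A \<longleftrightarrow> (a, b) \<in> similar L M"
proof -
  obtain x where "A = similar L M `` {x}" using assms(1) by (rule quotientE)
  then show ?thesis using assms(2) similar_sym similar_trans by (metis Image_singleton_iff)
qed

lemma similar_class_nonempty: "A \<in> univ M // similar L M \<Longrightarrow> A \<noteq> {}"
  using equiv_similar[of M L] in_quotient_imp_non_empty by blast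

lemma similar_class_subset: "A \<in> univ M // similar L M \<Longrightarrow> A \<subseteq> univ M"
  using equiv_similar[of M L] in_quotient_imp_subset by blast

definition collapse :: "'a \<Rightarrow> 'a option \<Rightarrow> 'a" where
  "collapse a0 y = (case y of None \<Rightarrow> a0 | Some v \<Rightarrow> v)"

text \<open>The new element \<open>None\<close> is a second copy of \<open>a0\<close>. Evaluating
  \<open>rel M\<close> on the collapsed tuple would wrongly identify \<open>None\<close> with
  \<open>Some a0\<close>; instead any tuple \<open>xs\<close> with the same equalities and the right
  classes is consulted, and by \<open>rel_similar_pattern\<close> its choice does not
  matter.\<close>

definition clone :: "vocabulary \<Rightarrow> 'a struct \<Rightarrow> 'a \<Rightarrow> 'a option struct" where
  "clone L M a0 = \<lparr>univ = insert None (Some ` univ M),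
     rel = \<lambda>i ys. \<exists>xs. same_pattern xs ys \<and> rel M i xs \<and>
       (\<forall>j<length ys. (collapse a0 (ys ! j), xs ! j) \<in> similar L M)\<rparr>"

definition clone_match :: "'a set \<Rightarrow> 'a \<Rightarrow> 'a \<Rightarrow> 'a option \<Rightarrow> bool" where
  "clone_match A a0 a b \<longleftrightarrow> (a \<in> A \<and> collapse a0 b \<in> A) \<or> (a \<notin> A \<and> b = Some a)"

text \<open>The partners occupy at most as many elements of the enlarged class as the assigned
  values occupy in \<open>A\<close>, so a fresh element of \<open>A\<close> finds a fresh partner.
  Outside \<open>A\<close> an element answers itself.\<close>

lemma clone_forth:
  assumes "finite X" "finite A" "A \<subseteq> V" "a0 \<in> A" "card (s ` X \<inter> A) < card A"
    and match: "\<And>y. y \<in> X \<Longrightarrow> clone_match A a0 (s y) (s' y)"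
    and eq: "\<And>y z. y \<in> X \<Longrightarrow> z \<in> X \<Longrightarrow> s y = s z \<longleftrightarrow> s' y = s' z"
    and X: "\<And>y. y \<in> X \<Longrightarrow> s' y \<in> insert None (Some ` V)"
    and a: "a \<in> V"
  shows "\<exists>b\<in>insert None (Some ` V). clone_match A a0 a b \<and> (\<forall>y\<in>X. a = s y \<longleftrightarrow> b = s' y)"
proof (cases "a \<in> s ` X")
  case True
  then obtain y where y: "y \<in> X" "a = s y" by blast
  show ?thesis by (rule bexI[of _ "s' y"]) (use y match eq X in auto)
next
  case False
  show ?thesis
  proof (cases "a \<in> A")
    case True
    let ?A = "insert None (Some ` A)"
    define g where "g v = s' (SOME y. y \<in> X \<and> s y = v)" for v
    have g: "g (s y) = s' y" if "y \<in> X" for y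
    proof -
      have "(SOME z. z \<in> X \<and> s z = s y) \<in> X \<and> s (SOME z. z \<in> X \<and> s z = s y) = s y"
        by (rule someI[of _ y]) (use that in auto)
      then show ?thesis using eq that by (auto simp: g_def)
    qed
    have "s' ` X \<inter> ?A \<subseteq> g ` (s ` X \<inter> A)"
    proof
      fix b assume b: "b \<in> s' ` X \<inter> ?A"
      then obtain y where y: "y \<in> X" "b = s' y" by blast
      have "s y \<in> A" using match[OF y(1)] b y by (auto simp: clone_match_def)
      then show "b \<in> g ` (s ` X \<inter> A)" using g[OF y(1)] y by force
    qed
    then have "card (s' ` X \<inter> ?A) \<le> card (s ` X \<inter> A)"
      using assms(1) by (meson card_image_le card_mono finite_Int finite_imageI le_trans)
    also have "\<dots> < card ?A" using assms(2,5) by (simp add: card_image)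
    finally have "\<not> ?A \<subseteq> s' ` X" by (metis inf.absorb_iff2 less_irrefl)
    then obtain b where b: "b \<in> ?A" "b \<notin> s' ` X" by blast
    show ?thesis
      by (rule bexI[of _ b]) (use b True False assms(3,4) in \<open>auto simp: clone_match_def collapse_def\<close>)
  next
    case nA: False
    have "Some a \<noteq> s' y" if "y \<in> X" for y
      using match[OF that] that False nA by (auto simp: clone_match_def collapse_def split: option.splits)
    then show ?thesis
      by (intro bexI[of _ "Some a"]) (use False nA a in \<open>auto simp: clone_match_def\<close>)
  qed
qed

text \<open>Here the enlarged class has to be matched inside the smaller one; since fewer than
  \<open>card A\<close> elements of \<open>A\<close> are occupied, one is still left for a fresh
  element of the clone.\<close>

lemma clone_back:
  assumes "finite X" "finite A" "A \<subseteq> V" "a0 \<in> A" "card (s ` X \<inter> A) < card A"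
    and match: "\<And>y. y \<in> X \<Longrightarrow> clone_match A a0 (s y) (s' y)"
    and eq: "\<And>y z. y \<in> X \<Longrightarrow> z \<in> X \<Longrightarrow> s y = s z \<longleftrightarrow> s' y = s' z"
    and X: "\<And>y. y \<in> X \<Longrightarrow> s y \<in> V"
    and b: "b \<in> insert None (Some ` V)"
  shows "\<exists>a\<in>V. clone_match A a0 a b \<and> (\<forall>y\<in>X. a = s y \<longleftrightarrow> b = s' y)"
proof (cases "b \<in> s' ` X")
  case True
  then obtain y where y: "y \<in> X" "b = s' y" by blast
  show ?thesis by (rule bexI[of _ "s y"]) (use y match eq X in auto)
next
  case False
  show ?thesis
  proof (cases "collapse a0 b \<in> A")
    case True
    have "\<not> A \<subseteq> s ` X" using assms(5) by (metis inf.absorb_iff2 less_irrefl)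
    then obtain a where "a \<in> A" "a \<notin> s ` X" by blast
    then show ?thesis
      by (intro bexI[of _ a]) (use True False assms(3) in \<open>auto simp: clone_match_def\<close>)
  next
    case nA: False
    then obtain a where a: "b = Some a" "a \<in> V" "a \<notin> A"
      using b assms(4) by (auto simp: collapse_def)
    have "a \<noteq> s y" if "y \<in> X" for y
      using match[OF that] that False a by (metis clone_match_def imageI)
    then show ?thesis
      by (intro bexI[of _ a]) (use False a in \<open>auto simp: clone_match_def\<close>)
  qed
qed

definition clone_agree :: "vocabulary \<Rightarrow> 'a struct \<Rightarrow> 'a set \<Rightarrow> 'a \<Rightarrow> nat set \<Rightarrow> (nat \<Rightarrow> 'a) \<Rightarrow>
    (nat \<Rightarrow> 'a option) \<Rightarrow> nat \<Rightarrow> bool" where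
  "clone_agree L M A a0 X s s' m \<longleftrightarrow> card (s ` X \<inter> A) + m \<le> card A \<and>
     (\<forall>x\<in>X. s x \<in> univ M \<and> s' x \<in> univ (clone L M a0) \<and> clone_match A a0 (s x) (s' x) \<and>
        (\<forall>y\<in>X. s x = s y \<longleftrightarrow> s' x = s' y))"

lemma clone_agree_mono:
  assumes "clone_agree L M A a0 X s s' m" "Y \<subseteq> X" "finite X"
  shows "clone_agree L M A a0 Y s s' m"
proof -
  have "card (s ` Y \<inter> A) \<le> card (s ` X \<inter> A)" by (intro card_mono) (use assms in auto)
  then show ?thesis using assms unfolding clone_agree_def by (auto simp: subset_iff)
qed

lemma clone_agree_extend:
  assumes fin: "finite (univ M)" and A: "A \<in> univ M // similar L M" and a0: "a0 \<in> A"
    and agree: "clone_agree L M A a0 (X - {x}) s s' m" and m: "m > 0" and X: "finite X"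
  shows "\<And>a. a \<in> univ M \<Longrightarrow> \<exists>b\<in>univ (clone L M a0). clone_agree L M A a0 X (s(x := a)) (s'(x := b)) (m - 1)"
    and "\<And>b. b \<in> univ (clone L M a0) \<Longrightarrow> \<exists>a\<in>univ M. clone_agree L M A a0 X (s(x := a)) (s'(x := b)) (m - 1)"
proof -
  let ?X = "X - {x}"
  have finX: "finite ?X" and finA: "finite A"
    using X fin similar_class_subset[OF A] finite_subset by auto
  have lt: "card (s ` ?X \<inter> A) < card A" using agree m by (simp add: clone_agree_def)
  have step: "clone_agree L M A a0 X (s(x := a)) (s'(x := b)) (m - 1)"
    if ab: "a \<in> univ M" "b \<in> univ (clone L M a0)" "clone_match A a0 a b"
      "\<forall>y\<in>?X. a = s y \<longleftrightarrow> b = s' y" for a b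
  proof -
    have "(s(x := a)) ` X \<inter> A \<subseteq> insert a (s ` ?X \<inter> A)" by auto
    then have "card ((s(x := a)) ` X \<inter> A) \<le> card (insert a (s ` ?X \<inter> A))"
      by (intro card_mono) (use finX in auto)
    also have "\<dots> \<le> Suc (card (s ` ?X \<inter> A))" by (rule card_insert_le_m1) auto
    finally have "card ((s(x := a)) ` X \<inter> A) + (m - 1) \<le> card A"
      using agree m unfolding clone_agree_def by linarith
    moreover have "(s(x := a)) y = (s(x := a)) z \<longleftrightarrow> (s'(x := b)) y = (s'(x := b)) z"
      if "y \<in> X" "z \<in> X" for y z
      using that ab(4) agree by (auto simp: clone_agree_def)
    ultimately show ?thesis using ab agree by (auto simp: clone_agree_def)
  qed
  have match: "\<And>y. y \<in> ?X \<Longrightarrow> clone_match A a0 (s y) (s' y)"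
    and eq: "\<And>y z. y \<in> ?X \<Longrightarrow> z \<in> ?X \<Longrightarrow> s y = s z \<longleftrightarrow> s' y = s' z"
    and u: "\<And>y. y \<in> ?X \<Longrightarrow> s y \<in> univ M"
    and u': "\<And>y. y \<in> ?X \<Longrightarrow> s' y \<in> insert None (Some ` univ M)"
    using agree by (auto simp: clone_agree_def clone_def)
  show "\<exists>b\<in>univ (clone L M a0). clone_agree L M A a0 X (s(x := a)) (s'(x := b)) (m - 1)"
    if "a \<in> univ M" for a
  proof -
    from clone_forth[OF finX finA similar_class_subset[OF A] a0 lt match eq u' that]
    obtain b where "b \<in> univ (clone L M a0)" "clone_match A a0 a b" "\<forall>y\<in>?X. a = s y \<longleftrightarrow> b = s' y"
      by (auto simp: clone_def)
    then show ?thesis using step that by blast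
  qed
  show "\<exists>a\<in>univ M. clone_agree L M A a0 X (s(x := a)) (s'(x := b)) (m - 1)"
    if "b \<in> univ (clone L M a0)" for b
  proof -
    have "b \<in> insert None (Some ` univ M)" using that by (simp add: clone_def)
    from clone_back[OF finX finA similar_class_subset[OF A] a0 lt match eq u this]
    obtain a where "a \<in> univ M" "clone_match A a0 a b" "\<forall>y\<in>?X. a = s y \<longleftrightarrow> b = s' y"
      by auto
    then show ?thesis using step that by blast
  qed
qed

text \<open>The rank enters as a length bound on all words of \<open>nest p\<close>, which passes
  through negation and the binary connectives with the same \<open>m\<close>. In the atomic case the
  current tuple of \<open>M\<close> is itself a witness for the relation of the clone.\<close>

lemma sat_clone:
  assumes fin: "finite (univ M)" and A: "A \<in> univ M // similar L M" and a0: "a0 \<in> A"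
    and "is_formula L p" "\<And>w. w \<in> nest p \<Longrightarrow> length w \<le> m"
    and "clone_agree L M A a0 (free_vars p) s s' m"
  shows "sat M s p \<longleftrightarrow> sat (clone L M a0) s' p"
  using assms(4-)
proof (induction p arbitrary: s s' m)
  case (Rel i xs)
  have ag: "s x \<in> univ M" "clone_match A a0 (s x) (s' x)" if "x \<in> set xs" for x
    using Rel.prems(3) that by (auto simp: clone_agree_def)
  have sim: "(collapse a0 (s' x), s x) \<in> similar L M" if "x \<in> set xs" for x
    using ag[OF that] similar_class_iff[OF A] similar_refl[of "s x" M L]
    by (auto simp: clone_match_def collapse_def)
  have pat: "same_pattern (map s xs) (map s' xs)"
    using Rel.prems(3) by (intro same_pattern_maps) (auto simp: clone_agree_def)
  show ?case
  proof
    assume "sat M s (Rel i xs)"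
    then show "sat (clone L M a0) s' (Rel i xs)"
      using pat sim by (auto simp: clone_def intro!: exI[of _ "map s xs"])
  next
    assume "sat (clone L M a0) s' (Rel i xs)"
    then obtain zs where zs: "same_pattern zs (map s' xs)" "rel M i zs"
        "\<And>j. j < length xs \<Longrightarrow> (collapse a0 (s' (xs ! j)), zs ! j) \<in> similar L M"
      by (auto simp: clone_def)
    have len: "length zs = length xs" using zs(1) by (simp add: same_pattern_def)
    have "rel M i zs = rel M i (map s xs)"
    proof (rule rel_similar_pattern)
      show "same_pattern zs (map s xs)"
        using same_pattern_trans[OF zs(1) same_pattern_sym[OF pat]] .
      show "(zs ! j, map s xs ! j) \<in> similar L M" if "j < length zs" for j
        using that len similar_trans[OF similar_sym[OF zs(3)[of j]] sim[of "xs ! j"]] by simp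
    qed (use Rel.prems len in auto)
    then show "sat M s (Rel i xs)" using zs(2) by simp
  qed
next
  case (Eq x y)
  then show ?case by (simp add: clone_agree_def)
next
  case (Neg p)
  have "length w \<le> m" if "w \<in> nest p" for w using Neg.prems(2)[of "map swap_quantifier w"] that by simp
  then show ?case using Neg.IH[of m s s'] Neg.prems by simp
next
  case (And p q)
  have "clone_agree L M A a0 (free_vars p) s s' m" "clone_agree L M A a0 (free_vars q) s s' m"
    using clone_agree_mono[OF And.prems(3)] finite_free_vars by auto
  then show ?case using And.IH(1)[of m s s'] And.IH(2)[of m s s'] And.prems by simp
next
  case (Or p q)
  have "clone_agree L M A a0 (free_vars p) s s' m" "clone_agree L M A a0 (free_vars q) s s' m"
    using clone_agree_mono[OF Or.prems(3)] finite_free_vars by auto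
  then show ?case using Or.IH(1)[of m s s'] Or.IH(2)[of m s s'] Or.prems by simp
next
  case (Exists x p)
  have w: "length w < m" if "w \<in> nest p" for w using Exists.prems(2)[of "QEx # w"] that by simp
  then have m: "m > 0" using nest_nonempty[of p] by fastforce
  have step: "sat M (s(x := a)) p \<longleftrightarrow> sat (clone L M a0) (s'(x := b)) p"
    if "clone_agree L M A a0 (free_vars p) (s(x := a)) (s'(x := b)) (m - 1)" for a b
    using Exists.IH[OF _ _ that] Exists.prems(1) w by fastforce
  show ?case
    unfolding sat.simps
    using clone_agree_extend[OF fin A a0 Exists.prems(3)[unfolded free_vars.simps] m finite_free_vars] step
    by meson
next
  case (Forall x p)
  have w: "length w < m" if "w \<in> nest p" for w using Forall.prems(2)[of "QAll # w"] that by simp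
  then have m: "m > 0" using nest_nonempty[of p] by fastforce
  have step: "sat M (s(x := a)) p \<longleftrightarrow> sat (clone L M a0) (s'(x := b)) p"
    if "clone_agree L M A a0 (free_vars p) (s(x := a)) (s'(x := b)) (m - 1)" for a b
    using Forall.IH[OF _ _ that] Forall.prems(1) w by fastforce
  show ?case
    unfolding sat.simps
    using clone_agree_extend[OF fin A a0 Forall.prems(3)[unfolded free_vars.simps] m finite_free_vars] step
    by meson
qed

text \<open>The clone has one element more than \<open>M\<close>, yet a sentence of rank at most
  \<open>card A\<close> starts with the full budget and cannot tell the two apart. The formula
  \<open>q\<close> guarantees that the minimum defining \<open>D\<close> is attained.\<close>

lemma card_class_less_D:
  assumes M: "is_structure L M" and A: "A \<in> univ M // similar L M"
    and ex: "defining_formula L q M"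
  shows "card A < D L M"
proof (rule ccontr)
  assume "\<not> card A < D L M"
  moreover obtain p where p: "defining_formula L p M" "quantifier_rank p = D L M"
    using LeastI_ex[of "\<lambda>r. \<exists>p. defining_formula L p M \<and> quantifier_rank p = r"] ex
    unfolding D_def by blast
  ultimately have r: "quantifier_rank p \<le> card A" by simp
  have fin: "finite (univ M)" using M by (simp add: is_structure_def)
  obtain a0 where a0: "a0 \<in> A" using similar_class_nonempty[OF A] by blast
  let ?N = "clone L M a0"
  have N: "is_structure L ?N" using M by (simp add: is_structure_def clone_def)
  have "\<not> isomorphic L M ?N"
  proof
    assume "isomorphic L M ?N"
    then have "card (univ M) = card (univ ?N)"
      by (auto simp: isomorphic_def is_iso_def intro: bij_betw_same_card)
    then show False using fin by (simp add: clone_def card_image)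
  qed
  then have "\<not> true_on ?N p" using defining_formula_any[OF p(1) N] by blast
  moreover have cl: "is_formula L p" "free_vars p = {}" "true_on M p"
    using p(1) by (auto simp: defining_formula_def closed_formula_def)
  moreover have "sat M s p \<longleftrightarrow> sat ?N s' p" for s s'
  proof (rule sat_clone[OF fin A a0 cl(1), where m = "card A"])
    show "length w \<le> card A" if "w \<in> nest p" for w
      using r Max_ge[OF finite_imageI[OF finite_nest] imageI[OF that], of length]
      by (simp add: quantifier_rank_def)
  qed (use cl in \<open>auto simp: clone_agree_def\<close>)
  ultimately show False by (auto simp: true_on_def)
qed

subsection \<open>Atomic types and stages\<close>

text \<open>The atomic type of \<open>x\<close> over \<open>S\<close>, where \<open>\<phi>\<close> places the parameters into the structure and
  \<open>None\<close> marks the occurrences of \<open>x\<close>. Only tuples in which \<open>x\<close> occurs are recorded, so at most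
  \<open>k - 1\<close> parameters are involved.\<close>

definition type_over ::
  "vocabulary \<Rightarrow> 'b struct \<Rightarrow> ('a \<Rightarrow> 'b) \<Rightarrow> 'a set \<Rightarrow> 'b \<Rightarrow> (nat \<times> 'a option list) set" where
  "type_over L N \<phi> S x = {(i, cs). i < length L \<and> length cs = L ! i \<and> None \<in> set cs \<and>
     set cs \<subseteq> insert None (Some ` S) \<and> rel N i (map (case_option x \<phi>) cs)}"

abbreviation tp :: "vocabulary \<Rightarrow> 'a struct \<Rightarrow> 'a set \<Rightarrow> 'a \<Rightarrow> (nat \<times> 'a option list) set" where
  "tp L M \<equiv> type_over L M id"

definition names :: "'a option list \<Rightarrow> 'a set" where
  "names cs = {w. Some w \<in> set cs}"

lemma finite_names: "finite (names cs)"
proof -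
  have "Some ` names cs \<subseteq> set cs" by (auto simp: names_def)
  then have "finite (Some ` names cs)" using finite_subset by blast
  then show ?thesis using finite_imageD inj_Some by blast
qed

lemma set_subset_names: "set cs \<subseteq> insert None (Some ` S) \<longleftrightarrow> names cs \<subseteq> S"
  unfolding names_def by (auto simp: subset_iff) (metis image_eqI option.exhaust)

lemma card_names_less:
  assumes "None \<in> set cs" shows "card (names cs) < length cs"
proof -
  have "insert None (Some ` names cs) \<subseteq> set cs" using assms by (auto simp: names_def)
  then have "card (insert None (Some ` names cs)) \<le> card (set cs)" by (intro card_mono) auto
  then have "Suc (card (names cs)) \<le> card (set cs)" by (simp add: card_image finite_names)
  then show ?thesis using card_length[of cs] by linarith
qed

lemma type_over_eqI:
  assumes "\<And>i cs. i < length L \<Longrightarrow> length cs = L ! i \<Longrightarrow> None \<in> set cs \<Longrightarrow> names cs \<subseteq> S \<Longrightarrow>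
    rel N i (map (case_option x \<phi>) cs) = rel N' i (map (case_option y \<psi>) cs)"
  shows "type_over L N \<phi> S x = type_over L N' \<psi> S y"
  using assms by (auto simp: type_over_def set_subset_names)

lemma type_over_eqD:
  assumes "type_over L N \<phi> S x = type_over L N' \<psi> S y" "i < length L" "length cs = L ! i"
    "None \<in> set cs" "names cs \<subseteq> S"
  shows "rel N i (map (case_option x \<phi>) cs) = rel N' i (map (case_option y \<psi>) cs)"
proof -
  have "(i, cs) \<in> type_over L N \<phi> S x \<longleftrightarrow> (i, cs) \<in> type_over L N' \<psi> S y" using assms(1) by simp
  then show ?thesis using assms(2-) by (auto simp: type_over_def set_subset_names)
qed

lemma type_over_mono:
  assumes "type_over L N \<phi> S' x = type_over L N' \<psi> S' y" "S \<subseteq> S'"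
  shows "type_over L N \<phi> S x = type_over L N' \<psi> S y"
  by (rule type_over_eqI) (rule type_over_eqD[OF assms(1)], use assms(2) in auto)

text \<open>On \<open>X\<close> the map \<open>g\<close> factors through \<open>f\<close>, and the
  inequality is strict once the factor merges two values of \<open>f\<close>. The main use is with
  types: a larger parameter set refines them.\<close>

lemma card_image_refine:
  assumes "finite X" "\<And>x y. x \<in> X \<Longrightarrow> y \<in> X \<Longrightarrow> f x = f y \<Longrightarrow> g x = g y"
  shows "card (g ` X) \<le> card (f ` X)"
    and "x \<in> X \<Longrightarrow> y \<in> X \<Longrightarrow> g x = g y \<Longrightarrow> f x \<noteq> f y \<Longrightarrow> card (g ` X) < card (f ` X)"
proof -
  define h where "h t = g (SOME z. z \<in> X \<and> f z = t)" for t
  have h: "h (f z) = g z" if "z \<in> X" for z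
  proof -
    have "(SOME y. y \<in> X \<and> f y = f z) \<in> X \<and> f (SOME y. y \<in> X \<and> f y = f z) = f z"
      by (rule someI[of _ z]) (use that in auto)
    from assms(2)[OF this[THEN conjunct1] that this[THEN conjunct2]]
    show ?thesis by (simp add: h_def)
  qed
  then have im: "g ` X = h ` f ` X" by (force simp: image_image)
  then show "card (g ` X) \<le> card (f ` X)" using assms(1) by (simp add: card_image_le)
  assume xy: "x \<in> X" "y \<in> X" "g x = g y" "f x \<noteq> f y"
  have "\<not> inj_on h (f ` X)"
  proof
    assume "inj_on h (f ` X)"
    then have "f x = f y" by (rule inj_onD) (use xy h in auto)
    then show False using xy by simp
  qed
  then have "card (h ` f ` X) \<noteq> card (f ` X)"
    using assms(1) eq_card_imp_inj_on by blast
  then show "card (g ` X) < card (f ` X)"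
    using im assms(1) card_image_le[of "f ` X" h] by simp
qed

text \<open>Each round of \<open>levels\<close> pins down the elements of \<open>Y'\<close>: outside \<open>S\<close> and the set \<open>R - Y'\<close> an
  element of \<open>Y'\<close> is the only one of its type over \<open>S\<close>.\<close>

inductive levels :: "vocabulary \<Rightarrow> 'a struct \<Rightarrow> nat \<Rightarrow> 'a set \<Rightarrow> 'a set \<Rightarrow> 'a set \<Rightarrow> bool"
  for L M where
  levels_0: "U \<subseteq> univ M \<Longrightarrow> levels L M 0 {} U {}"
| levels_Suc: "levels L M j S0 U Y \<Longrightarrow> U \<subseteq> S \<Longrightarrow> S \<union> R \<subseteq> univ M \<Longrightarrow> S \<inter> R = {} \<Longrightarrow> Y' \<subseteq> R \<Longrightarrow>
    (\<And>x y. y \<in> Y' \<Longrightarrow> x \<in> univ M - S \<Longrightarrow> tp L M S x = tp L M S y \<Longrightarrow> x = y \<or> x \<in> R - Y') \<Longrightarrow>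
    levels L M (Suc j) S (S \<union> R) (Y \<union> Y')"

section \<open>Cores, free elements and separating tuples\<close>

locale bounded_structure =
  fixes L :: vocabulary and M :: "'a struct" and k :: nat
  assumes fin: "finite (univ M)"
    and arity: "\<And>i. i < length L \<Longrightarrow> L ! i \<le> k"
    and k_pos: "0 < k"
begin

abbreviation "V \<equiv> univ M"
abbreviation "classes \<equiv> V // similar L M"

definition big :: "'a set set" where
  "big = {A \<in> classes. k \<le> card A}"

text \<open>The size \<open>k - 1\<close> serves twice: a core can take up all parameters of a
  separating tuple, and together with two further elements it is too large to fit into one
  tuple.\<close>

definition core :: "'a set \<Rightarrow> 'a set" where
  "core A = (SOME C. C \<subseteq> A \<and> card C = k - 1)"

definition cores :: "'a set" where "cores = (\<Union>A\<in>big. core A)"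

definition free :: "'a set" where "free = (\<Union>A\<in>big. A - core A)"

definition type_count :: "'a set \<Rightarrow> nat" where
  "type_count S = card (tp L M S ` (V - S))"

lemma finite_class: "A \<in> classes \<Longrightarrow> finite A"
  using finite_subset[OF similar_class_subset fin] .

lemma finite_classes: "finite classes"
  by (rule finite_quotient[OF fin equiv_type[OF equiv_similar]])

lemma core: "A \<in> big \<Longrightarrow> core A \<subseteq> A \<and> card (core A) = k - 1"
proof -
  assume "A \<in> big"
  then have "\<exists>C. C \<subseteq> A \<and> card C = k - 1"
    using obtain_subset_with_card_n[of "k - 1" A] unfolding big_def by (metis diff_le_self le_trans mem_Collect_eq)
  then show ?thesis unfolding core_def by (rule someI_ex)
qed

lemma class_eqI: "A \<in> classes \<Longrightarrow> A' \<in> classes \<Longrightarrow> x \<in> A \<Longrightarrow> x \<in> A' \<Longrightarrow> A = A'"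
  using quotient_disj[OF equiv_similar[of M L]] by blast

lemma class_of: "x \<in> V \<Longrightarrow> similar L M `` {x} \<in> classes" "x \<in> V \<Longrightarrow> x \<in> similar L M `` {x}"
  using similar_refl by (auto intro: quotientI)

lemma free_cores: "free \<subseteq> V" "cores \<subseteq> V" "free \<inter> cores = {}"
proof -
  show "free \<subseteq> V" "cores \<subseteq> V"
    using similar_class_subset core by (fastforce simp: free_def cores_def big_def)+
  show "free \<inter> cores = {}"
  proof (rule ccontr)
    assume "free \<inter> cores \<noteq> {}"
    then obtain x A A' where "A \<in> big" "A' \<in> big" "x \<in> A - core A" "x \<in> core A'"
      by (auto simp: free_def cores_def)
    moreover from this have "A = A'" using class_eqI core unfolding big_def by blast
    ultimately show False by blast
  qed
qed

lemma card_cores: "card cores \<le> (k - 1) * card big"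
proof -
  have "finite big" using finite_classes by (simp add: big_def)
  then have "card cores \<le> (\<Sum>A\<in>big. card (core A))"
    unfolding cores_def by (rule card_UN_le)
  also have "\<dots> = (k - 1) * card big" using core by simp
  finally show ?thesis .
qed

lemma similar_type:
  assumes "(u, v) \<in> similar L M" "u \<notin> S" "v \<notin> S" "S \<subseteq> V"
  shows "tp L M S u = tp L M S v"
proof (rule type_over_eqI)
  fix i cs assume cs: "i < length L" "length cs = L ! i" "names cs \<subseteq> S"
  have "set (map (case_option u id) cs) \<subseteq> V"
    using cs(3) assms(4) similar_univ[OF assms(1)] by (auto simp: names_def subset_iff split: option.splits)
  then have "rel M i (map (transpose u v) (map (case_option u id) cs)) = rel M i (map (case_option u id) cs)"
    using cs by (intro similar_rel[OF assms(1)]) auto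
  moreover have "map (transpose u v) (map (case_option u id) cs) = map (case_option v id) cs"
    using cs(3) assms(2,3) by (auto simp: names_def transpose_def split: option.splits)
  ultimately show "rel M i (map (case_option u id) cs) = rel M i (map (case_option v id) cs)" by metis
qed

text \<open>Neither \<open>u\<close> nor \<open>v\<close> may be a parameter. Failures of similarity
  caused by tuples containing both elements are not recorded here; \<open>final_stage\<close> rules
  them out by passing through a third element.\<close>

definition separates :: "nat \<Rightarrow> 'a option list \<Rightarrow> 'a \<Rightarrow> 'a \<Rightarrow> bool" where
  "separates i cs u v \<longleftrightarrow> i < length L \<and> length cs = L ! i \<and> names cs \<subseteq> V - {u, v} \<and>
     rel M i (map (case_option u id) cs) \<noteq> rel M i (map (case_option v id) cs)"

lemma separates_None: "separates i cs u v \<Longrightarrow> None \<in> set cs"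
proof (rule ccontr)
  assume s: "separates i cs u v" and "None \<notin> set cs"
  then have "map (case_option u id) cs = map (case_option v id) cs"
    by (auto split: option.splits)
  then have "rel M i (map (case_option u id) cs) = rel M i (map (case_option v id) cs)" by (rule arg_cong)
  then show False using s by (simp add: separates_def)
qed

lemma card_names_separates: "separates i cs u v \<Longrightarrow> card (names cs) \<le> k - 1"
  using card_names_less[OF separates_None] arity by (fastforce simp: separates_def)

lemma separates_type: "separates i cs u v \<Longrightarrow> names cs \<subseteq> S \<Longrightarrow> tp L M S u \<noteq> tp L M S v"
  using separates_None[of i cs u v] type_over_eqD[of L M id S u M id v i cs]
  unfolding separates_def by blast

text \<open>Parameters in big classes can be moved into the cores by automorphisms fixing \<open>u\<close> and \<open>v\<close>,
  so free elements never help to separate.\<close>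

lemma separates_avoiding_free:
  assumes "separates i cs u v" "u \<notin> cores" "v \<notin> cores" "u \<in> V" "v \<in> V"
  obtains cs' where "separates i cs' u v" "names cs' \<inter> free = {}"
proof -
  let ?W = "names cs"
  let ?cl = "\<lambda>w. similar L M `` {w}"
  have "\<exists>g. inj_on g (?W \<inter> A) \<and> g ` (?W \<inter> A) \<subseteq> core A" if "A \<in> big" for A
  proof -
    have "card (?W \<inter> A) \<le> card ?W" by (intro card_mono finite_names) auto
    then have "card (?W \<inter> A) \<le> card (core A)"
      using card_names_separates[OF assms(1)] core[OF that] by simp
    moreover have "finite (core A)"
      by (rule finite_subset[OF conjunct1[OF core[OF that]] finite_class]) (use that in \<open>simp add: big_def\<close>)
    ultimately show ?thesis using inj_on_iff_card_le[of "?W \<inter> A" "core A"] finite_names[of cs] by simp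
  qed
  then obtain g where g: "\<And>A. A \<in> big \<Longrightarrow> inj_on (g A) (?W \<inter> A) \<and> g A ` (?W \<inter> A) \<subseteq> core A"
    by metis
  define p where "p w = (if ?cl w \<in> big then g (?cl w) w else w)" for w
  have WV: "w \<in> V" if "w \<in> ?W" for w using assms(1) that by (auto simp: separates_def)
  have pc: "p w \<in> core (?cl w)" if "w \<in> ?W" "?cl w \<in> big" for w
    using g[OF that(2)] class_of(2)[OF WV[OF that(1)]] that by (auto simp: p_def)
  have sim: "(w, p w) \<in> similar L M" if "w \<in> ?W" for w
  proof (cases "?cl w \<in> big")
    case True
    then show ?thesis using pc[OF that True] core[OF True] by auto
  qed (use similar_refl[OF WV[OF that]] in \<open>simp add: p_def\<close>)
  have inj: "inj_on p ?W"
  proof (rule inj_onI)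
    fix w w' assume w: "w \<in> ?W" "w' \<in> ?W" "p w = p w'"
    have "(w, w') \<in> similar L M" using sim[OF w(1)] sim[OF w(2)] w(3) similar_sym similar_trans by metis
    then have cl: "?cl w = ?cl w'" by (rule equiv_class_eq[OF equiv_similar])
    show "w = w'"
    proof (cases "?cl w \<in> big")
      case True
      have "w \<in> ?W \<inter> ?cl w" "w' \<in> ?W \<inter> ?cl w" using w(1,2) cl class_of(2) WV by auto
      then show ?thesis using g[OF True] w(3) True cl by (auto simp: p_def dest: inj_onD)
    qed (use w cl in \<open>simp add: p_def\<close>)
  qed
  have nu: "p w \<noteq> u \<and> p w \<noteq> v" if "w \<in> ?W" for w
  proof (cases "?cl w \<in> big")
    case True
    then have "p w \<in> cores" using pc[OF that] by (auto simp: cores_def)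
    then show ?thesis using assms by auto
  qed (use that assms(1) in \<open>auto simp: p_def separates_def\<close>)
  define cs' where "cs' = map (map_option p) cs"
  have names: "names cs' = p ` ?W" 
  proof (rule set_eqI)
    fix w
    have "w \<in> names cs' \<longleftrightarrow> (\<exists>c\<in>set cs. map_option p c = Some w)"
      by (auto simp: cs'_def names_def image_iff eq_commute[of "Some w"])
    also have "\<dots> \<longleftrightarrow> w \<in> p ` ?W" by (auto simp: names_def image_iff)
    finally show "w \<in> names cs' \<longleftrightarrow> w \<in> p ` ?W" .
  qed
  have rel: "rel M i (map (case_option x id) cs') = rel M i (map (case_option x id) cs)"
    if x: "x = u \<or> x = v" for x
  proof -
    have m: "map (case_option x id) cs' = map (case_option x p) cs"
      by (auto simp: cs'_def comp_def split: option.splits)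
    have xV: "x \<in> V" using x assms by auto
    have "rel M i (map (case_option x id) cs) = rel M i (map (case_option x p) cs)"
    proof (rule rel_similar_pattern)
      show "i < length L" "length (map (case_option x id) cs) = L ! i"
        using assms(1) by (auto simp: separates_def)
      have e: "x \<noteq> w \<and> x \<noteq> p w" if "w \<in> ?W" for w
        using nu[OF that] x that assms(1) by (auto simp: separates_def)
      show "same_pattern (map (case_option x id) cs) (map (case_option x p) cs)"
      proof (rule same_pattern_maps)
        fix c d assume "c \<in> set cs" "d \<in> set cs"
        then show "case_option x id c = case_option x id d \<longleftrightarrow> case_option x p c = case_option x p d"
          using e inj by (auto simp: names_def inj_on_eq_iff split: option.splits)
      qed
      have c: "(case_option x id c, case_option x p c) \<in> similar L M" if "c \<in> set cs" for c
        using that sim similar_refl[OF xV] by (auto simp: names_def split: option.splits)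
      fix j assume "j < length (map (case_option x id) cs)"
      then have "cs ! j \<in> set cs" "j < length cs" by auto
      from c[OF this(1)] this(2)
      show "(map (case_option x id) cs ! j, map (case_option x p) cs ! j) \<in> similar L M"
        by simp
    qed
    then show ?thesis using m by simp
  qed
  have "names cs' \<subseteq> V - {u, v}"
    using names nu sim similar_univ by fastforce
  then have "separates i cs' u v"
    using assms(1) rel[of u] rel[of v] by (simp add: separates_def cs'_def del: map_map)
  moreover have "p w \<notin> free" if "w \<in> ?W" for w
  proof (cases "?cl w \<in> big")
    case True
    then have "p w \<in> cores" using pc[OF that] by (auto simp: cores_def)
    then show ?thesis using free_cores by auto
  next
    case False
    then have "p w = w" by (simp add: p_def)
    moreover have "w \<notin> free"
    proof
      assume "w \<in> free"
      then obtain A where "A \<in> big" "w \<in> A" by (auto simp: free_def)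
      then have "A = ?cl w" using class_eqI class_of[OF WV[OF that]] unfolding big_def by blast
      then show False using False \<open>A \<in> big\<close> by simp
    qed
    ultimately show ?thesis by simp
  qed
  then have "names cs' \<inter> free = {}" using names by auto
  ultimately show ?thesis using that by blast
qed

text \<open>By the last assumption no type over \<open>S\<close> is lost when \<open>W\<close> is
  removed from the elements counted. Over the larger parameter set the types refine the old ones,
  and the common type of \<open>u\<close> and \<open>v\<close> is split.\<close>

lemma type_count_less:
  assumes "S \<subseteq> V" "W \<subseteq> V - S" "u \<in> V - (S \<union> W)" "v \<in> V - (S \<union> W)"
    and "tp L M S u = tp L M S v" "tp L M (S \<union> W) u \<noteq> tp L M (S \<union> W) v"
    and "\<And>w. w \<in> W \<Longrightarrow> \<exists>x\<in>V - (S \<union> W). tp L M S x = tp L M S w"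
  shows "type_count S < type_count (S \<union> W)"
proof -
  have "tp L M S ` (V - S) = tp L M S ` (V - (S \<union> W))"
  proof
    show "tp L M S ` (V - S) \<subseteq> tp L M S ` (V - (S \<union> W))"
    proof
      fix t assume "t \<in> tp L M S ` (V - S)"
      then obtain x where x: "x \<in> V - S" "t = tp L M S x" by blast
      then show "t \<in> tp L M S ` (V - (S \<union> W))" using assms(7)[of x] by (cases "x \<in> W") auto
    qed
  qed auto
  moreover have "card (tp L M S ` (V - (S \<union> W))) < card (tp L M (S \<union> W) ` (V - (S \<union> W)))"
  proof (rule card_image_refine(2)[where x = u and y = v])
    show "tp L M S x = tp L M S y" if "tp L M (S \<union> W) x = tp L M (S \<union> W) y" for x y
      by (rule type_over_mono[OF that]) simp
  qed (use assms fin in auto)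
  ultimately show ?thesis by (simp add: type_count_def)
qed

text \<open>Take a set of greatest size among those whose growth is paid for by new types,
  \<open>k - 1\<close> elements for each. If some \<open>W\<close> of at most \<open>k - 1\<close>
  elements still created a type, the larger set would satisfy the same balance.\<close>

lemma saturate:
  assumes "U \<subseteq> V" "U \<inter> free = {}"
  obtains S where "U \<subseteq> S" "S \<subseteq> V" "S \<inter> free = {}"
    "card S + (k - 1) * type_count U \<le> card U + (k - 1) * type_count S"
    "\<And>W. W \<subseteq> V - S \<Longrightarrow> W \<inter> free = {} \<Longrightarrow> card W \<le> k - 1 \<Longrightarrow> type_count (S \<union> W) \<le> type_count S"
proof -
  define P where "P S \<longleftrightarrow> U \<subseteq> S \<and> S \<subseteq> V \<and> S \<inter> free = {} \<and>
    card S + (k - 1) * type_count U \<le> card U + (k - 1) * type_count S" for S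
  have "P U" using assms by (simp add: P_def)
  moreover have "\<forall>S. P S \<longrightarrow> card S < Suc (card V)"
    using fin by (auto simp: P_def less_Suc_eq_le intro: card_mono)
  ultimately obtain S where S: "P S" "\<And>T. P T \<Longrightarrow> card T \<le> card S"
    using ex_has_greatest_nat[of P U card "Suc (card V)"] by blast
  have "type_count (S \<union> W) \<le> type_count S"
    if W: "W \<subseteq> V - S" "W \<inter> free = {}" "card W \<le> k - 1" for W
  proof (rule ccontr)
    assume "\<not> ?thesis"
    then have less: "type_count S < type_count (S \<union> W)" by simp
    then have "W \<noteq> {}" by auto
    have fW: "finite W" "finite S" using W S(1) finite_subset[OF _ fin, of W] finite_subset[OF _ fin, of S] by (auto simp: P_def)
    have card: "card (S \<union> W) = card S + card W"
      using W fW by (intro card_Un_disjoint) auto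
    have "(k - 1) * (type_count S + 1) \<le> (k - 1) * type_count (S \<union> W)"
      using less by (intro mult_le_mono2) simp
    then have "P (S \<union> W)" using S(1) W card by (auto simp: P_def algebra_simps)
    then have "card W = 0" using S(2) card by fastforce
    then show False using \<open>W \<noteq> {}\<close> fW by simp
  qed
  then show ?thesis using that S(1) unfolding P_def by blast
qed

text \<open>On the bound for \<open>U - Y\<close>: every saturation step adds at most \<open>k - 1\<close> elements per new
  type, and every retired type class contributes at most \<open>k - 1\<close> elements besides its
  representative in \<open>Y\<close>. The last conjunct is the measure of progress: at stage \<open>j\<close> every
  separating tuple meets \<open>U\<close> in at least \<open>j\<close> points, while it has at most \<open>k - 1\<close> parameters.\<close>

definition stage :: "nat \<Rightarrow> 'a set \<Rightarrow> 'a set \<Rightarrow> 'a set \<Rightarrow> bool" where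
  "stage j S U Y \<longleftrightarrow> levels L M j S U Y \<and> Y \<subseteq> U \<and> cores \<subseteq> U \<and> U \<subseteq> V \<and> U \<inter> free = {} \<and>
     card (U - Y) + (k - 1) \<le> card cores + (k - 1) * (type_count U + 2 * card Y) \<and>
     (\<forall>u\<in>V - U. \<forall>v\<in>V - U. \<forall>i cs. tp L M U u = tp L M U v \<and> separates i cs u v \<and>
        names cs \<inter> free = {} \<longrightarrow> j \<le> card (names cs \<inter> U))"

definition tp_class :: "'a set \<Rightarrow> 'a \<Rightarrow> 'a set" where
  "tp_class S u = {v \<in> V - S. tp L M S v = tp L M S u}"

text \<open>Either there is no big class, or a core falls short of even the smallest one. So
  something lies outside the cores and at least one type is realised there; it pays for the summand
  \<open>k - 1\<close> on the left of the balance.\<close>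

lemma stage_0:
  assumes "V \<noteq> {}" shows "stage 0 {} cores {}"
proof -
  have "V - cores \<noteq> {}"
  proof (cases "big = {}")
    case True
    then show ?thesis using assms by (simp add: cores_def)
  next
    case False
    then obtain A where A: "A \<in> big" by blast
    have "\<not> A \<subseteq> core A"
    proof
      assume "A \<subseteq> core A"
      then have "card A = k - 1" using core[OF A] by (metis subset_antisym)
      then show False using A k_pos by (auto simp: big_def)
    qed
    then have "free \<noteq> {}" using A by (auto simp: free_def)
    then show ?thesis using free_cores by blast
  qed
  then have "1 \<le> type_count cores" using fin by (simp add: type_count_def Suc_le_eq card_gt_0_iff)
  then have "(k - 1) * 1 \<le> (k - 1) * type_count cores" by (rule mult_le_mono2)
  then show ?thesis using free_cores by (auto simp: stage_def intro: levels_0)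
qed

lemma stage_Suc:
  assumes st: "stage j S0 U Y"
  obtains S R Y' where "U \<subseteq> S" "stage (Suc j) S (S \<union> R) (Y \<union> Y')"
    "\<And>u. u \<in> V - (S \<union> R) \<Longrightarrow> k < card (tp_class S u) \<or> tp_class S u \<inter> free \<noteq> {}"
    "\<And>u. u \<in> V - (S \<union> R) \<Longrightarrow> tp_class S u \<inter> R = {}"
proof -
  have U: "U \<subseteq> V" "U \<inter> free = {}" "Y \<subseteq> U" "cores \<subseteq> U" and lev: "levels L M j S0 U Y"
    and cardU: "card (U - Y) + (k - 1) \<le> card cores + (k - 1) * (type_count U + 2 * card Y)"
    using st by (auto simp: stage_def)
  obtain S where S: "U \<subseteq> S" "S \<subseteq> V" "S \<inter> free = {}"
    and cardS: "card S + (k - 1) * type_count U \<le> card U + (k - 1) * type_count S"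
    and sat: "\<And>W. W \<subseteq> V - S \<Longrightarrow> W \<inter> free = {} \<Longrightarrow> card W \<le> k - 1 \<Longrightarrow> type_count (S \<union> W) \<le> type_count S"
    using saturate[OF U(1,2)] by metis
  \<comment> \<open>Classes of exactly \<open>k\<close> elements are retired too: a surviving class
    without free elements then has more than \<open>k\<close> members and cannot be exhausted by one
    tuple.\<close>
  define R where "R = {u \<in> V - S. card (tp_class S u) \<le> k \<and> tp_class S u \<inter> free = {}}"
  have cl: "tp_class S u = tp_class S v" if "v \<in> tp_class S u" for u v
    using that by (auto simp: tp_class_def)
  have self: "u \<in> tp_class S u" if "u \<in> V - S" for u using that by (auto simp: tp_class_def)
  have R: "R \<subseteq> V - S" by (auto simp: R_def)
  have R_free: "R \<inter> free = {}" using self by (fastforce simp: R_def)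
  have D_closed: "v \<in> R \<longleftrightarrow> u \<in> R" if "v \<in> tp_class S u" "u \<in> V - S" for u v
    using cl[OF that(1)] that by (auto simp: R_def tp_class_def)
  obtain Y' where Y': "Y' \<subseteq> R" "inj_on (tp L M S) Y'" "tp L M S ` R = tp L M S ` Y'"
    using subset_image_inj[of "tp L M S ` R" "tp L M S" R] by auto
  have finD: "finite R" "finite S" "finite Y'" "finite Y" "finite U"
    using R S(2) Y' U fin by (meson Diff_subset finite_subset)+
  have lev': "levels L M (Suc j) S (S \<union> R) (Y \<union> Y')"
  proof (rule levels_Suc[OF lev S(1)])
    fix x y assume xy: "y \<in> Y'" "x \<in> V - S" "tp L M S x = tp L M S y"
    have yD: "y \<in> R" using xy Y' by auto
    have "x \<in> tp_class S y" using xy by (auto simp: tp_class_def)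
    then have "x \<in> R" using D_closed[of x y] yD R by auto
    then show "x = y \<or> x \<in> R - Y'" using xy Y'(2) by (auto dest: inj_onD)
  qed (use S R Y' in auto)
  have cardD: "card R \<le> k * card Y'"
  proof -
    have "R \<subseteq> (\<Union>y\<in>Y'. tp_class S y)"
    proof
      fix d assume d: "d \<in> R"
      then obtain y where "y \<in> Y'" "tp L M S d = tp L M S y" using Y'(3) by (metis imageE imageI)
      then show "d \<in> (\<Union>y\<in>Y'. tp_class S y)" using d R by (auto simp: tp_class_def)
    qed
    moreover have "finite (tp_class S y)" for y
      using fin by (auto simp: tp_class_def)
    ultimately have "card R \<le> card (\<Union>y\<in>Y'. tp_class S y)" using finD by (intro card_mono) auto
    also have "\<dots> \<le> (\<Sum>y\<in>Y'. card (tp_class S y))" using finD by (intro card_UN_le)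
    also have "\<dots> \<le> (\<Sum>y\<in>Y'. k)" using Y'(1) by (intro sum_mono) (auto simp: R_def)
    finally show ?thesis by (simp add: mult.commute)
  qed
  have count: "type_count S \<le> type_count (S \<union> R) + card Y'"
  proof -
    have "tp L M S ` (V - S) = tp L M S ` (V - (S \<union> R)) \<union> tp L M S ` Y'"
    proof -
      have "V - S = (V - (S \<union> R)) \<union> R" using R by blast
      then show ?thesis using Y'(3) by (metis image_Un)
    qed
    then have "type_count S \<le> card (tp L M S ` (V - (S \<union> R))) + card (tp L M S ` Y')"
      by (simp add: type_count_def card_Un_le)
    moreover have "card (tp L M S ` (V - (S \<union> R))) \<le> type_count (S \<union> R)"
      unfolding type_count_def
    proof (rule card_image_refine(1))
      show "tp L M S x = tp L M S y" if "tp L M (S \<union> R) x = tp L M (S \<union> R) y" for x y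
        by (rule type_over_mono[OF that]) simp
    qed (use fin in auto)
    ultimately show ?thesis using finD card_image_le[of Y' "tp L M S"] by linarith
  qed
  \<comment> \<open>The factor 2 arises here: \<open>k - 1\<close> per representative for the rest
    of its class, by \<open>cardD\<close>, and \<open>k - 1\<close> for the type that may disappear
    from \<open>type_count\<close>, by \<open>count\<close>.\<close>
  have card': "card (S \<union> R - (Y \<union> Y')) + (k - 1) \<le>
      card cores + (k - 1) * (type_count (S \<union> R) + 2 * card (Y \<union> Y'))"
  proof -
    have dYY: "Y \<inter> Y' = {}" using U S R Y' by blast
    have "S \<union> R - (Y \<union> Y') = (U - Y) \<union> (S - U) \<union> (R - Y')" using U S R Y' by blast
    moreover have "card ((U - Y) \<union> (S - U) \<union> (R - Y')) \<le> card (U - Y) + card (S - U) + card (R - Y')"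
      by (meson add_mono card_Un_le le_refl le_trans)
    moreover have "card (S - U) = card S - card U" "card U \<le> card S"
      using S finD by (auto simp: card_Diff_subset card_mono)
    moreover have "card (R - Y') = card R - card Y'" using Y' finD by (simp add: card_Diff_subset)
    moreover have "card (Y \<union> Y') = card Y + card Y'" using dYY finD by (simp add: card_Un_disjoint)
    moreover have "k * card Y' = (k - 1) * card Y' + card Y'"
      using k_pos by (cases k) auto
    moreover have "(k - 1) * type_count S \<le> (k - 1) * type_count (S \<union> R) + (k - 1) * card Y'"
      using mult_le_mono2[OF count, of "k - 1"] by (simp add: algebra_simps)
    ultimately show ?thesis using cardU cardS cardD by (simp only: add_mult_distrib2) linarith
  qed
  have sep: "Suc j \<le> card (names cs \<inter> (S \<union> R))"
    if uv: "u \<in> V - (S \<union> R)" "v \<in> V - (S \<union> R)" "tp L M (S \<union> R) u = tp L M (S \<union> R) v"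
      and cs: "separates i cs u v" "names cs \<inter> free = {}" for u v i cs
  proof -
    have eqS: "tp L M S u = tp L M S v" using type_over_mono[OF uv(3)] by auto
    have "j \<le> card (names cs \<inter> U)"
      using st uv type_over_mono[OF uv(3), of U] S(1) cs unfolding stage_def by blast
    \<comment> \<open>If the tuple avoided \<open>R\<close>, adding its parameters outside
      \<open>S\<close> would split the type of \<open>u\<close> and \<open>v\<close>, against
      saturation. No type would be lost: a type class contained in \<open>W\<close> has at most
      \<open>k - 1\<close> members, none of them free, and would have been retired.\<close>
    moreover have "names cs \<inter> R \<noteq> {}"
    proof
      assume disj: "names cs \<inter> R = {}"
      define W where "W = names cs - S"
      have W: "W \<subseteq> V - S" using cs by (auto simp: W_def separates_def)
      have cW: "card W \<le> k - 1"
        using card_names_separates[OF cs(1)] card_mono[OF finite_names, of W cs] by (auto simp: W_def)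
      have "\<exists>x\<in>V - (S \<union> W). tp L M S x = tp L M S w" if w: "w \<in> W" for w
      proof (rule ccontr)
        assume "\<not> ?thesis"
        then have sub: "tp_class S w \<subseteq> W" using W by (auto simp: tp_class_def)
        then have "card (tp_class S w) \<le> card W"
          by (intro card_mono) (auto simp: W_def finite_names)
        then have "w \<in> R" using cW sub cs w W by (auto simp: R_def W_def)
        then show False using disj w by (auto simp: W_def)
      qed
      moreover have "tp L M (S \<union> W) u \<noteq> tp L M (S \<union> W) v"
        using separates_type[OF cs(1)] by (simp add: W_def)
      moreover have "u \<in> V - (S \<union> W)" "v \<in> V - (S \<union> W)"
        using uv cs by (auto simp: W_def separates_def)
      ultimately have "type_count S < type_count (S \<union> W)"
        using type_count_less[OF S(2) W] eqS by blast
      then show False using sat[OF W _ cW] cs(2) by (auto simp: W_def)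
    qed
    then obtain w where w: "w \<in> names cs" "w \<in> R" by blast
    moreover have "card (insert w (names cs \<inter> U)) = Suc (card (names cs \<inter> U))"
      using w R S finite_names[of cs] by (subst card_insert_disjoint) auto
    moreover have "card (insert w (names cs \<inter> U)) \<le> card (names cs \<inter> (S \<union> R))"
      by (intro card_mono) (use w S finite_names[of cs] in auto)
    ultimately show ?thesis by linarith
  qed
  have "stage (Suc j) S (S \<union> R) (Y \<union> Y')"
    unfolding stage_def
  proof (intro conjI ballI allI impI)
    show "Y \<union> Y' \<subseteq> S \<union> R" "cores \<subseteq> S \<union> R" using U S Y' by auto
    show "S \<union> R \<subseteq> V" "(S \<union> R) \<inter> free = {}" using S R R_free by auto
    fix u v i cs
    assume "u \<in> V - (S \<union> R)" "v \<in> V - (S \<union> R)"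
      "tp L M (S \<union> R) u = tp L M (S \<union> R) v \<and> separates i cs u v \<and> names cs \<inter> free = {}"
    then show "Suc j \<le> card (names cs \<inter> (S \<union> R))" using sep[of u v i cs] by blast
  qed (use lev' card' in simp_all)
  moreover have "k < card (tp_class S u) \<or> tp_class S u \<inter> free \<noteq> {}" if "u \<in> V - (S \<union> R)" for u
    using that by (auto simp: R_def)
  moreover have "tp_class S u \<inter> R = {}" if "u \<in> V - (S \<union> R)" for u
    using that D_closed[of _ u] by auto
  ultimately show ?thesis using that S(1) by blast
qed

lemma not_separates_rel:
  assumes ns: "\<And>i cs. \<not> separates i cs u v"
    and i: "i < length L" "length xs = L ! i" "set xs \<subseteq> V" and v: "v \<notin> set xs"
  shows "rel M i xs = rel M i (map (transpose u v) xs)"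
proof -
  define cs where "cs = map (\<lambda>x. if x = u then None else Some x) xs"
  have 1: "map (case_option u id) cs = xs" unfolding cs_def map_map by (rule map_idI) auto
  have 2: "map (case_option v id) cs = map (transpose u v) xs"
    using v by (auto simp: cs_def transpose_def)
  have "names cs \<subseteq> V - {u, v}" using i(3) v by (auto simp: names_def cs_def split: if_splits)
  moreover have "length cs = L ! i" using i by (simp add: cs_def)
  ultimately show ?thesis using ns[of i cs] i unfolding separates_def 1 2 by blast
qed

lemma stage_exists: "V \<noteq> {} \<Longrightarrow> \<exists>S U Y. stage j S U Y"
proof (induction j)
  case 0
  then show ?case using stage_0 by blast
next
  case (Suc j)
  then show ?case using stage_Suc by metis
qed

text \<open>At stage \<open>k - 1\<close> all parameters of a separating tuple that avoids
  \<open>free\<close> lie in \<open>U0\<close>, so over the next saturated set \<open>S\<close>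
  nothing separates elements of equal type. The last stage is still wanted for its retirement:
  afterwards every remaining type class is large or contains a free element, and either property
  upgrades the absence of separating tuples to similarity.\<close>

lemma final_stage:
  assumes "V \<noteq> {}"
  obtains S U Y where "levels L M k S U Y" "S \<subseteq> U" "U \<subseteq> V" "Y \<subseteq> U" "V - U = free"
    "\<forall>u\<in>V - U. \<forall>v\<in>V - U. tp L M S u = tp L M S v \<longrightarrow> (u, v) \<in> similar L M"
    "card (U - Y) + (k - 1) \<le> (k - 1) * (2 * card big + 2 * card Y)"
proof -
  obtain S0 U0 Y0 where st0: "stage (k - 1) S0 U0 Y0" using stage_exists[OF assms] by blast
  obtain S R Y' where S: "U0 \<subseteq> S" and st: "stage (Suc (k - 1)) S (S \<union> R) (Y0 \<union> Y')"
    and large: "\<And>u. u \<in> V - (S \<union> R) \<Longrightarrow> k < card (tp_class S u) \<or> tp_class S u \<inter> free \<noteq> {}"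
    and disj: "\<And>u. u \<in> V - (S \<union> R) \<Longrightarrow> tp_class S u \<inter> R = {}"
    using stage_Suc[OF st0] by metis
  define U where "U = S \<union> R"
  define Y where "Y = Y0 \<union> Y'"
  have st: "stage k S U Y" using st k_pos by (simp add: U_def Y_def)
  have coresS: "cores \<subseteq> S" using st0 S by (auto simp: stage_def)
  have ns: "\<not> separates i cs u v"
    if uv: "u \<in> V - S" "v \<in> V - S" "tp L M S u = tp L M S v" for i cs u v
  proof
    assume "separates i cs u v"
    then obtain cs' where cs': "separates i cs' u v" "names cs' \<inter> free = {}"
      using separates_avoiding_free uv coresS by blast
    have "k - 1 \<le> card (names cs' \<inter> U0)"
      using st0 uv S cs' type_over_mono[OF uv(3) S] unfolding stage_def by blast
    then have "names cs' \<inter> U0 = names cs'"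
      using card_names_separates[OF cs'(1)] finite_names by (intro card_seteq) auto
    then show False using separates_type[OF cs'(1)] uv(3) S by blast
  qed
  have NS: "rel M i xs = rel M i (map (transpose u v) xs)"
    if "u \<in> V - S" "v \<in> V - S" "tp L M S u = tp L M S v" "u \<noteq> v"
      "i < length L" "length xs = L ! i" "set xs \<subseteq> V" "u \<notin> set xs \<or> v \<notin> set xs" for u v i xs
  proof (cases "v \<in> set xs")
    case False
    then show ?thesis using not_separates_rel[of u v i xs] ns that by auto
  next
    case True
    then have "rel M i xs = rel M i (map (transpose v u) xs)"
      using not_separates_rel[of v u i xs] ns that by auto
    then show ?thesis by (simp add: transpose_commute)
  qed
  have len: "card (set xs) \<le> k" if "i < length L" "length xs = L ! i" for i and xs :: "'a list"
    using arity[OF that(1)] that(2) card_length[of xs] by simp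
  have sim_free: "(f, v) \<in> similar L M"
    if f: "f \<in> free" and fv: "f \<in> V - S" "v \<in> V - S" "tp L M S f = tp L M S v" for f v
  proof (cases "f = v")
    case True
    then show ?thesis using fv similar_refl by auto
  next
    case ne: False
    obtain A where A: "A \<in> big" "f \<in> A" "f \<notin> core A" using f by (auto simp: free_def)
    have coreS: "core A \<subseteq> S" using A coresS by (auto simp: cores_def)
    show ?thesis
    proof (rule similarI)
      fix i and xs :: "'a list" assume xs: "i < length L" "length xs = L ! i" "set xs \<subseteq> V"
      show "rel M i xs = rel M i (map (transpose f v) xs)"
      proof (cases "f \<in> set xs \<and> v \<in> set xs")
        case False
        then show ?thesis using NS[OF fv ne xs] by blast
      next
        case True
        \<comment> \<open>The core together with \<open>f\<close> and \<open>v\<close> has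
          \<open>k + 1\<close> elements, more than a tuple can contain; hence some element
          \<open>a\<close> similar to \<open>f\<close> does not occur in \<open>xs\<close>.\<close>
        have "\<not> core A \<subseteq> set xs"
        proof
          assume sub: "core A \<subseteq> set xs"
          then have "card (insert f (insert v (core A))) \<le> card (set xs)"
            using True by (intro card_mono) auto
          moreover have "finite (core A)" using sub finite_subset by blast
          moreover have "v \<notin> core A" using coreS fv by auto
          ultimately show False
            using len[OF xs(1,2)] core[OF A(1)] A(3) ne k_pos by simp
        qed
        then obtain a where a: "a \<in> core A" "a \<notin> set xs" by blast
        have A': "A \<in> classes" "a \<in> A" using A(1) core[OF A(1)] a by (auto simp: big_def)
        have aS: "a \<in> S" "a \<in> V" using a coreS similar_class_subset[OF A'(1)] A' by auto
        have af: "(f, a) \<in> similar L M" using similar_class_iff[OF A'(1) A(2)] A'(2) by blast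
        have av: "a \<noteq> f" "a \<noteq> v" using aS fv by auto
        define t where "t = transpose f a"
        define s where "s = transpose f v"
        have tV: "t ` X \<subseteq> V" and sV: "s ` X \<subseteq> V" if "X \<subseteq> V" for X
          using that fv aS by (auto simp: t_def s_def transpose_def)
        have rt: "rel M i (map t ys) = rel M i ys" if "length ys = L ! i" "set ys \<subseteq> V" for ys
          using similar_rel[OF af xs(1) that] by (simp add: t_def)
        have rs: "rel M i ys = rel M i (map s ys)"
          if "length ys = L ! i" "set ys \<subseteq> V" "f \<notin> set ys \<or> v \<notin> set ys" for ys
          using NS[OF fv ne xs(1) that] by (simp add: s_def)
        \<comment> \<open>On the entries of \<open>xs\<close> the swap \<open>s\<close> equals
          \<open>t s t s t\<close>. Each \<open>t\<close> is an automorphism, and the two inner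
          applications of \<open>s\<close> act on tuples that miss \<open>f\<close> and
          \<open>v\<close> respectively, where \<open>NS\<close> permits them.\<close>
        let ?y1 = "map t xs" let ?y2 = "map s ?y1" let ?y3 = "map t ?y2" let ?y4 = "map s ?y3"
        have V1: "set ?y1 \<subseteq> V" using tV[OF xs(3)] by (simp only: set_map)
        have V2: "set ?y2 \<subseteq> V" using sV[OF V1] by (simp only: set_map)
        have V3: "set ?y3 \<subseteq> V" using tV[OF V2] by (simp only: set_map)
        have V4: "set ?y4 \<subseteq> V" using sV[OF V3] by (simp only: set_map)
        have f1: "f \<notin> set ?y1" using a(2) by (auto simp: t_def transpose_def)
        have v3: "v \<notin> set ?y3"
        proof
          assume "v \<in> set ?y3"
          then obtain x where x: "x \<in> set ?y1" "v = t (s x)" by auto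
          have "t v = v" using av ne by (auto simp: t_def transpose_def)
          then have "s x = v" using x(2) by (metis t_def transpose_involutory)
          then have "x = f" by (metis s_def transpose_apply_second transpose_involutory)
          then show False using f1 x(1) by blast
        qed
        have "rel M i xs = rel M i ?y1" using rt[OF xs(2,3)] by simp
        also have "\<dots> = rel M i ?y2" by (rule rs) (use xs(2) V1 f1 in auto)
        also have "\<dots> = rel M i ?y3" by (rule rt[symmetric]) (use xs(2) V2 in auto)
        also have "\<dots> = rel M i ?y4" by (rule rs) (use xs(2) V3 v3 in auto)
        also have "\<dots> = rel M i (map t ?y4)" by (rule rt[symmetric]) (use xs(2) V4 in auto)
        also have "map t ?y4 = map s xs"
          using a(2) av ne by (auto simp: t_def s_def transpose_def)
        finally show ?thesis by (simp add: s_def)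
      qed
    qed (use fv in auto)
  qed
  have sim_large: "(u, v) \<in> similar L M"
    if uv: "u \<in> V - S" "v \<in> V - S" "tp L M S u = tp L M S v" and Q: "k < card (tp_class S u)" for u v
  proof (cases "u = v")
    case True
    then show ?thesis using uv similar_refl by auto
  next
    case ne: False
    show ?thesis
    proof (rule similarI)
      fix i and xs :: "'a list" assume xs: "i < length L" "length xs = L ! i" "set xs \<subseteq> V"
      show "rel M i xs = rel M i (map (transpose u v) xs)"
      proof (cases "u \<in> set xs \<and> v \<in> set xs")
        case False
        then show ?thesis using NS[OF uv ne xs] by blast
      next
        case True
        \<comment> \<open>More than \<open>k\<close> elements share the type, so one of them,
          \<open>a\<close>, does not occur in the tuple. The swap is made in three moves through
          \<open>a\<close>, each applied to a tuple missing one of the two elements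
          exchanged.\<close>
        have "\<not> tp_class S u \<subseteq> set xs"
          using len[OF xs(1,2)] Q card_mono[of "set xs" "tp_class S u"] by fastforce
        then obtain a where a: "a \<in> V - S" "tp L M S a = tp L M S u" "a \<notin> set xs"
          by (auto simp: tp_class_def)
        have au: "a \<noteq> u" "a \<noteq> v" using a True by auto
        let ?y1 = "map (transpose u a) xs" let ?y2 = "map (transpose v u) ?y1"
        have V1: "set ?y1 \<subseteq> V" using xs(3) uv a by (auto simp: transpose_def)
        have V2: "set ?y2 \<subseteq> V" using V1 uv by (auto simp: transpose_def)
        have u1: "u \<notin> set ?y1" using a(3) by (auto simp: transpose_def)
        have v2: "v \<notin> set ?y2"
        proof
          assume "v \<in> set ?y2"
          then obtain x where x: "x \<in> set ?y1" "v = transpose v u x" by auto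
          then have "x = u" by (metis transpose_apply_first transpose_involutory)
          then show False using u1 x by blast
        qed
        have "rel M i xs = rel M i ?y1" by (rule NS) (use xs uv a au in auto)
        also have "\<dots> = rel M i ?y2" by (rule NS) (use xs(1,2) V1 u1 uv ne in auto)
        also have "\<dots> = rel M i (map (transpose a v) ?y2)"
          by (rule NS) (use xs(1,2) V2 v2 uv a au in auto)
        also have "map (transpose a v) ?y2 = map (transpose u v) xs"
          using a(3) au ne by (auto simp: transpose_def)
        finally show ?thesis .
      qed
    qed (use uv in auto)
  qed
  have sim: "(u, v) \<in> similar L M"
    if uv: "u \<in> V - U" "v \<in> V - U" "tp L M S u = tp L M S v" for u v
  proof (cases "k < card (tp_class S u)")
    case True
    then show ?thesis using sim_large uv by (auto simp: U_def)
  next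
    case False
    then obtain f where f: "f \<in> tp_class S u" "f \<in> free" using large[of u] uv by (auto simp: U_def)
    then have "(f, u) \<in> similar L M" "(f, v) \<in> similar L M"
      using sim_free[of f] uv by (auto simp: tp_class_def U_def)
    then show ?thesis using similar_sym similar_trans by metis
  qed
  have VU: "V - U = free"
  proof
    show "free \<subseteq> V - U" using st free_cores by (auto simp: stage_def)
    show "V - U \<subseteq> free"
    proof
      fix u assume u: "u \<in> V - U"
      let ?A = "similar L M `` {u}"
      have A: "?A \<in> classes" "u \<in> ?A" using class_of u by auto
      have cls: "tp_class S u \<subseteq> V - U" using disj[of u] u by (auto simp: U_def tp_class_def)
      have sub: "tp_class S u \<subseteq> ?A"
        using sim[OF u] cls by (auto simp: tp_class_def)
      have big: "?A \<in> big"
      proof (cases "k < card (tp_class S u)")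
        case True
        then have "k < card ?A" using card_mono[OF finite_class[OF A(1)] sub] by linarith
        then show ?thesis using A by (simp add: big_def)
      next
        case False
        then obtain f where f: "f \<in> tp_class S u" "f \<in> free" using large[of u] u by (auto simp: U_def)
        then obtain A' where A': "A' \<in> big" "f \<in> A'" by (auto simp: free_def)
        then have "A' = ?A" using class_eqI[of A' ?A f] A sub f by (auto simp: big_def)
        then show ?thesis using A' by simp
      qed
      have "u \<notin> core ?A" using u coresS big by (auto simp: cores_def U_def)
      then show "u \<in> free" using A big by (auto simp: free_def)
    qed
  qed
  \<comment> \<open>Only free elements lie outside \<open>U\<close>. Similar ones have equal types
    over \<open>U\<close>, so there are no more types than big classes.\<close>
  have "type_count U \<le> card big"
  proof -
    have "card (tp L M U ` free) \<le> card ((\<lambda>u. similar L M `` {u}) ` free)"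
    proof (rule card_image_refine(1))
      show "finite free" using free_cores fin finite_subset by blast
      fix u v assume uv: "u \<in> free" "v \<in> free" "similar L M `` {u} = similar L M `` {v}"
      then have "(u, v) \<in> similar L M"
        using class_of(2)[of v] free_cores by auto
      then show "tp L M U u = tp L M U v"
        using similar_type[of u v U] uv VU st by (auto simp: stage_def)
    qed
    also have "\<dots> \<le> card big"
    proof (rule card_mono)
      show "finite big" using finite_classes by (simp add: big_def)
      show "(\<lambda>u. similar L M `` {u}) ` free \<subseteq> big"
      proof
        fix B assume "B \<in> (\<lambda>u. similar L M `` {u}) ` free"
        then obtain u A where u: "B = similar L M `` {u}" "A \<in> big" "u \<in> A"
          by (auto simp: free_def)
        then have A: "A \<in> classes" by (simp add: big_def)
        then have "u \<in> V" using similar_class_subset u(3) by blast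
        then have "A = B" using class_eqI[OF A _ u(3)] u(1) class_of by blast
        then show "B \<in> big" using u by simp
      qed
    qed
    finally show ?thesis by (simp add: type_count_def VU)
  qed
  then have "(k - 1) * (type_count U + 2 * card Y) \<le> (k - 1) * (card big + 2 * card Y)"
    by (intro mult_le_mono2) simp
  moreover have "(k - 1) * (2 * card big + 2 * card Y) = (k - 1) * card big + (k - 1) * (card big + 2 * card Y)"
    by (simp add: algebra_simps)
  ultimately have "card (U - Y) + (k - 1) \<le> (k - 1) * (2 * card big + 2 * card Y)"
    using st card_cores unfolding stage_def by linarith
  moreover have "levels L M k S U Y" "S \<subseteq> U" "U \<subseteq> V" "Y \<subseteq> U" using st by (auto simp: stage_def U_def)
  ultimately show ?thesis using that VU sim by blast
qed

end

subsection \<open>Recovering labels in another structure\<close>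

lemma levels_subset: "levels L M j S U Y \<Longrightarrow> Y \<subseteq> U \<and> S \<subseteq> U \<and> U \<subseteq> univ M \<and> (j = 0 \<longrightarrow> Y = {})"
  by (induction rule: levels.induct) auto

text \<open>A tuple of \<open>N\<close> is evaluated through any tuple of \<open>M\<close> with the
  same equalities and the classes prescribed by the labels. What remains to be determined is the
  number of elements carrying labels from each class.\<close>

locale labelled = bounded_structure L M k
  for L :: vocabulary and M :: "'a struct" and k :: nat +
  fixes N :: "'b struct" and \<rho> :: "'b \<Rightarrow> 'a"
  assumes fin_N: "finite (univ N)" and \<rho>_univ: "\<rho> ` univ N \<subseteq> V"
    and rel_label: "\<And>i xs ys. i < length L \<Longrightarrow> length xs = L ! i \<Longrightarrow> set ys \<subseteq> univ N \<Longrightarrow>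
      same_pattern xs ys \<Longrightarrow> (\<And>j. j < length xs \<Longrightarrow> (xs ! j, \<rho> (ys ! j)) \<in> similar L M) \<Longrightarrow>
      rel M i xs = rel N i ys"

section \<open>Positions of the one-sided games and pinned elements\<close>

locale matched = bounded_structure L M k
  for L :: vocabulary and M :: "'a struct" and k :: nat +
  fixes N :: "'b struct" and bs :: "'a list" and bs' :: "'b list" and e :: nat
  assumes univ_N: "univ N \<noteq> {}" "finite (univ N)" and univ_M: "univ M \<noteq> {}"
    and bs: "set bs \<subseteq> univ M" and bs': "set bs' \<subseteq> univ N" and length_bs: "length bs' = length bs"
    and forward: "survives L e M bs N bs'" and backward: "survives L e N bs' M bs"
begin

text \<open>The disjunction forgets in which structure the first player moves, because the pinning
  argument treats both games alike.\<close>

definition pos :: "nat \<Rightarrow> 'a list \<Rightarrow> 'b list \<Rightarrow> bool" where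
  "pos m xs ys \<longleftrightarrow> take (length bs) xs = bs \<and> take (length bs) ys = bs' \<and>
     set xs \<subseteq> univ M \<and> set ys \<subseteq> univ N \<and>
     (survives L m M xs N ys \<or> survives L m N ys M xs)"

lemma pos_atoms: "pos m xs ys \<Longrightarrow> same_atoms L M xs N ys"
  using survives_same_atoms univ_M univ_N same_atoms_sym unfolding pos_def by metis

lemma pos_pattern: "pos m xs ys \<Longrightarrow> same_pattern xs ys"
  using pos_atoms by (auto simp: same_atoms_def)

lemma pos_length: "pos m xs ys \<Longrightarrow> length ys = length xs"
  using pos_pattern by (auto simp: same_pattern_def)

lemma pos_mono: "pos m xs ys \<Longrightarrow> m' \<le> m \<Longrightarrow> pos m' xs ys"
  using survives_mono univ_M univ_N unfolding pos_def by metis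

lemma pos_forth:
  assumes "set zs \<subseteq> univ M" "m + length zs \<le> e"
  obtains zs' where "length zs' = length zs" "set zs' \<subseteq> univ N" "pos m (bs @ zs) (bs' @ zs')"
proof -
  have "survives L (m + length zs) M bs N bs'" using survives_mono[OF forward univ_M assms(2)] .
  from survives_append[OF this assms(1)] obtain zs' where "length zs' = length zs"
    "set zs' \<subseteq> univ N" "survives L m M (bs @ zs) N (bs' @ zs')" by blast
  then show ?thesis using that bs bs' length_bs assms(1) by (auto simp: pos_def)
qed

lemma pos_back:
  assumes "set zs' \<subseteq> univ N" "m + length zs' \<le> e"
  obtains zs where "length zs = length zs'" "set zs \<subseteq> univ M" "pos m (bs @ zs) (bs' @ zs')"
proof -
  have "survives L (m + length zs') N bs' M bs" using survives_mono[OF backward univ_N(1) assms(2)] .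
  from survives_append[OF this assms(1)] obtain zs where "length zs = length zs'"
    "set zs \<subseteq> univ M" "survives L m N (bs' @ zs') M (bs @ zs)" by blast
  then show ?thesis using that bs bs' length_bs assms(1) by (auto simp: pos_def)
qed

text \<open>The partner has to be correct in every position with at least \<open>m\<close> rounds
  left, in either game; this is what forces replies in later play.\<close>

definition pins :: "nat \<Rightarrow> ('a \<Rightarrow> 'b) \<Rightarrow> 'a set \<Rightarrow> bool" where
  "pins m \<phi> W \<longleftrightarrow> W \<subseteq> univ M \<and> \<phi> ` W \<subseteq> univ N \<and>
     (\<forall>m' xs ys l w. m \<le> m' \<and> pos m' xs ys \<and> l < length xs \<and> w \<in> W \<longrightarrow> (xs ! l = w \<longleftrightarrow> ys ! l = \<phi> w))"

lemma pinsD: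
  "pins m \<phi> W \<Longrightarrow> pos m' xs ys \<Longrightarrow> m \<le> m' \<Longrightarrow> l < length xs \<Longrightarrow> w \<in> W \<Longrightarrow> xs ! l = w \<longleftrightarrow> ys ! l = \<phi> w"
  unfolding pins_def by blast

text \<open>Let the first player choose \<open>w\<close> or \<open>\<phi> w\<close>, according to
  the structure being played. The answer is forced, so both games arrive at the same extended
  position, at one round per element.\<close>

lemma pos_extend:
  assumes "pins m \<phi> W" "set ws \<subseteq> W" "pos (m + length ws) xs ys"
  shows "pos m (xs @ ws) (ys @ map \<phi> ws)"
  using assms(2,3)
proof (induction ws arbitrary: xs ys)
  case (Cons w ws)
  let ?n = "m + length ws"
  have w: "w \<in> W" "w \<in> univ M" "\<phi> w \<in> univ N" using Cons.prems assms(1) by (auto simp: pins_def)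
  have len: "length ys = length xs" using pos_length[OF Cons.prems(2)] .
  have n: "m + length (w # ws) = Suc ?n" by simp
  have p: "take (length bs) xs = bs" "take (length bs) ys = bs'" "set xs \<subseteq> univ M" "set ys \<subseteq> univ N"
    "survives L (Suc ?n) M xs N ys \<or> survives L (Suc ?n) N ys M xs"
    using Cons.prems(2) unfolding n pos_def by blast+
  have tk: "take (length bs) (xs @ [a]) = bs \<and> take (length bs) (ys @ [b]) = bs'" for a b
  proof -
    have "length bs \<le> length xs" using p(1) by (metis length_take min.cobounded1)
    then show ?thesis using p(1,2) len by simp
  qed
  have "pos ?n (xs @ [w]) (ys @ [\<phi> w])"
    using p(5)
  proof
    assume "survives L (Suc ?n) M xs N ys"
    then obtain b where b: "b \<in> univ N" "survives L ?n M (xs @ [w]) N (ys @ [b])" using w by auto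
    then have pb: "pos ?n (xs @ [w]) (ys @ [b])" using p w tk by (auto simp: pos_def)
    have "b = \<phi> w" using pinsD[OF assms(1) pb _ _ w(1), of "length xs"] len by (simp add: nth_append)
    then show ?thesis using pb by simp
  next
    assume "survives L (Suc ?n) N ys M xs"
    then obtain a where a: "a \<in> univ M" "survives L ?n N (ys @ [\<phi> w]) M (xs @ [a])" using w by auto
    then have pa: "pos ?n (xs @ [a]) (ys @ [\<phi> w])" using p w tk by (auto simp: pos_def)
    have "a = w" using pinsD[OF assms(1) pa _ _ w(1), of "length xs"] len by (simp add: nth_append)
    then show ?thesis using pa by simp
  qed
  then have "pos m ((xs @ [w]) @ ws) ((ys @ [\<phi> w]) @ map \<phi> ws)"
    using Cons.prems(1) by (intro Cons.IH) auto
  then show ?case by simp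
qed simp

lemma pos_bs:
  assumes "pos m xs ys" "w \<in> set bs"
  obtains l where "l < length xs" "xs ! l = w"
proof -
  have "set bs \<subseteq> set xs" using assms(1) unfolding pos_def by (metis set_take_subset)
  then show ?thesis using that assms(2) by (meson in_set_conv_nth subsetD)
qed

text \<open>Parameters outside \<open>bs\<close> are pinned and at most \<open>k - 1\<close> in
  number; once they are appended, \<open>same_atoms\<close> sees the whole tuple. If
  \<open>Y\<close> is empty, all parameters lie in \<open>bs\<close> and no round is spent.\<close>

lemma pos_type:
  assumes pins: "pins m \<phi> (Y \<union> set bs)" and S: "S \<subseteq> Y \<union> set bs"
    and pos: "pos m' xs ys" and l: "l < length xs" and m': "m + (if Y = {} then 0 else k - 1) \<le> m'"
  shows "tp L M S (xs ! l) = type_over L N \<phi> S (ys ! l)"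
proof (rule type_over_eqI)
  fix i cs assume cs: "i < length L" "length cs = L ! i" "None \<in> set cs" "names cs \<subseteq> S"
  obtain ws where ws: "set ws = names cs - set bs" "distinct ws"
    using finite_distinct_list[of "names cs - set bs"] finite_names by blast
  have len: "length ws \<le> (if Y = {} then 0 else k - 1)"
  proof (cases "Y = {}")
    case True
    then have "set ws = {}" using ws cs S by auto
    then show ?thesis by simp
  next
    case False
    have "length ws = card (set ws)" using distinct_card[OF ws(2)] by simp
    also have "\<dots> \<le> card (names cs)" using ws by (auto intro: card_mono finite_names)
    finally show ?thesis using card_names_less[OF cs(3)] arity[OF cs(1)] cs(2) False by simp
  qed
  have p: "pos m (xs @ ws) (ys @ map \<phi> ws)"
  proof (rule pos_extend[OF pins])
    show "set ws \<subseteq> Y \<union> set bs" using ws cs S by auto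
    show "pos (m + length ws) xs ys" by (rule pos_mono[OF pos]) (use len m' in linarith)
  qed
  have lys: "length ys = length xs" using pos_length[OF pos] .
  show "rel M i (map (case_option (xs ! l) id) cs) = rel N i (map (case_option (ys ! l) \<phi>) cs)"
  proof (rule same_atoms_rel[OF pos_atoms[OF p] cs(1,2)])
    fix c assume c: "c \<in> set cs"
    show "\<exists>h<length (xs @ ws). case_option (xs ! l) id c = (xs @ ws) ! h \<and>
        case_option (ys ! l) \<phi> c = (ys @ map \<phi> ws) ! h"
    proof (cases c)
      case None
      then show ?thesis using l lys by (intro exI[of _ l]) (auto simp: nth_append)
    next
      case (Some w)
      then have w: "w \<in> names cs" using c by (simp add: names_def)
      then have "w \<in> set (xs @ ws)"
        using ws pos_bs[OF pos, of w] by (cases "w \<in> set bs") (auto simp: in_set_conv_nth)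
      then obtain h where h: "h < length (xs @ ws)" "(xs @ ws) ! h = w" by (meson in_set_conv_nth)
      moreover have "w \<in> Y \<union> set bs" using w cs S by auto
      ultimately have "(ys @ map \<phi> ws) ! h = \<phi> w" using pinsD[OF pins p] by blast
      then show ?thesis using h Some by auto
    qed
  qed
qed

text \<open>Appending parameters takes \<open>k - 1\<close> rounds per layer, except in the first
  layer, whose parameters all lie in \<open>bs\<close>. Truncated subtraction makes both
  \<open>cost 0\<close> and \<open>cost 1\<close> vanish.\<close>

definition cost :: "nat \<Rightarrow> nat" where "cost j = (j - 1) * (k - 1)"

lemma cost_Suc: "cost (Suc j) = cost j + (if j = 0 then 0 else k - 1)"
  by (cases j) (auto simp: cost_def)

text \<open>Once a layer is pinned it supplies parameters for the types that pin the next one. The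
  two rounds beyond \<open>cost j\<close> allow two candidate partners of one element to be shown in
  a single position. Equality of types over the final \<open>S\<close> is recorded for use in
  \<open>label_map\<close>.\<close>

lemma levels_pins:
  assumes "levels L M j S U Y" "U - Y \<subseteq> set bs" "set bs \<inter> Y = {}" "cost j + 2 \<le> e"
  shows "\<exists>\<phi>. pins (cost j) \<phi> (Y \<union> set bs) \<and>
    (\<forall>m xs ys l. cost j \<le> m \<and> pos m xs ys \<and> l < length xs \<longrightarrow>
       tp L M S (xs ! l) = type_over L N \<phi> S (ys ! l))"
  using assms
proof (induction rule: levels.induct)
  case (levels_0 U)
  have p0: "same_pattern bs bs'"
    using survives_same_atoms[OF forward univ_M] by (simp add: same_atoms_def)
  define \<phi> where "\<phi> w = bs' ! (SOME l. l < length bs \<and> bs ! l = w)" for w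
  have \<phi>: "\<phi> (bs ! l) = bs' ! l" if "l < length bs" for l
  proof -
    let ?h = "SOME h. h < length bs \<and> bs ! h = bs ! l"
    have "?h < length bs \<and> bs ! ?h = bs ! l" by (rule someI[of _ l]) (use that in simp)
    then show ?thesis using p0 that by (auto simp: \<phi>_def same_pattern_def)
  qed
  have pins: "pins (cost 0) \<phi> ({} \<union> set bs)"
    unfolding pins_def
  proof (intro conjI allI impI)
    show "{} \<union> set bs \<subseteq> univ M" using bs by simp
    have "bs' ! i \<in> univ N" if "i < length bs" for i using that bs' length_bs nth_mem[of i bs'] by auto
    then show "\<phi> ` ({} \<union> set bs) \<subseteq> univ N" using \<phi> by (auto simp: in_set_conv_nth)
    fix m' xs ys l w
    assume a: "cost 0 \<le> m' \<and> pos m' xs ys \<and> l < length xs \<and> w \<in> {} \<union> set bs"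
    then obtain h where h: "h < length bs" "bs ! h = w" by (auto simp: in_set_conv_nth)
    have t: "take (length bs) xs = bs" "take (length bs) ys = bs'" using a by (auto simp: pos_def)
    have hx: "h < length xs" using h t(1) by (metis length_take min_less_iff_conj)
    have "xs ! h = w" "ys ! h = \<phi> w"
      using h t \<phi>[OF h(1)] by (metis nth_take)+
    then show "xs ! l = w \<longleftrightarrow> ys ! l = \<phi> w"
      using pos_pattern[of m' xs ys] a hx unfolding same_pattern_def by metis
  qed
  moreover have "tp L M {} (xs ! l) = type_over L N \<phi> {} (ys ! l)"
    if "pos m xs ys" "l < length xs" for m xs ys l
    by (rule pos_type[OF pins _ that]) (auto simp: cost_def)
  ultimately show ?case by blast
next
  case (levels_Suc j S0 U Y S R Y')
  note sub = levels_subset[OF levels_Suc.hyps(1)]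
  note h = levels_Suc.hyps(2-5) levels_Suc.prems(1,2)
  let ?W = "Y \<union> set bs"
  let ?c = "cost (Suc j)"
  have c: "cost j \<le> ?c" "?c + 2 \<le> e" using levels_Suc.prems by (auto simp: cost_Suc)
  have "U - Y \<subseteq> set bs" "set bs \<inter> Y = {}" using h by blast+
  then obtain \<phi> where pins: "pins (cost j) \<phi> ?W" using levels_Suc.IH c by auto
  have SW: "S \<subseteq> ?W" and RW: "R - Y' \<subseteq> ?W" using h sub by blast+
  have Y'W: "Y' \<inter> ?W = {}" using h sub by blast
  have Y'V: "Y' \<subseteq> univ M" using h by blast
  have T: "tp L M S (xs ! l) = type_over L N \<phi> S (ys ! l)"
    if "pos m xs ys" "?c \<le> m" "l < length xs" for m xs ys l
    by (rule pos_type[OF pins SW that(1,3)]) (use that(2) sub in \<open>auto simp: cost_Suc split: if_splits\<close>)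
  have "\<exists>b. pos ?c (bs @ [y]) (bs' @ [b])" if y: "y \<in> Y'" for y
  proof -
    have "set [y] \<subseteq> univ M" "?c + length [y] \<le> e" using y Y'V c by auto
    then obtain zs' where "length zs' = length [y]" "pos ?c (bs @ [y]) (bs' @ zs')"
      using pos_forth by metis
    then show ?thesis by (auto simp: length_Suc_conv)
  qed
  then obtain \<psi> where \<psi>: "\<And>y. y \<in> Y' \<Longrightarrow> pos ?c (bs @ [y]) (bs' @ [\<psi> y])" by metis
  \<comment> \<open>A twin is a not yet pinned element with the type of \<open>y\<close>. By the
    uniqueness clause of \<open>levels\<close>, only \<open>y\<close> itself can be paired with
    it.\<close>
  define twin where "twin y a \<longleftrightarrow> a \<notin> \<phi> ` ?W \<and> tp L M S y = type_over L N \<phi> S a" for y a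
  have twinI: "twin (xs ! l) (ys ! l)" if "pos m xs ys" "?c \<le> m" "l < length xs" "xs ! l \<in> Y'" for m xs ys l
    using T[OF that(1-3)] pinsD[OF pins that(1) _ that(3)] that c Y'W unfolding twin_def
    by (metis disjoint_iff imageE le_trans)
  have twin\<psi>: "twin y (\<psi> y)" if "y \<in> Y'" for y
    using twinI[OF \<psi>[OF that], of "length bs"] that length_bs by (simp add: nth_append)
  have twinD: "xs ! l = y" if p: "pos m xs ys" "?c \<le> m" "l < length xs" and y: "y \<in> Y'" and tw: "twin y (ys ! l)"
    for m xs ys l y
  proof -
    have nW: "xs ! l \<notin> ?W"
      using pinsD[OF pins p(1) _ p(3)] p(2) c tw unfolding twin_def by (metis image_eqI le_trans)
    moreover have "xs ! l \<in> univ M" using p by (auto simp: pos_def)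
    moreover have "tp L M S (xs ! l) = tp L M S y" using T[OF p] tw by (simp add: twin_def)
    ultimately have "xs ! l = y \<or> xs ! l \<in> R - Y'"
      using levels_Suc.hyps(6)[OF y, of "xs ! l"] SW by blast
    then show ?thesis using nW RW by blast
  qed
  \<comment> \<open>Playing two distinct twins in \<open>N\<close> would pair both with the single
    element \<open>y\<close>, against equality of patterns.\<close>
  have unique: "a = \<psi> y" if y: "y \<in> Y'" and a: "twin y a" "a \<in> univ N" for y a
  proof (rule ccontr)
    assume ne: "a \<noteq> \<psi> y"
    have \<psi>N: "\<psi> y \<in> univ N" using \<psi>[OF y] by (auto simp: pos_def)
    then have "set [a, \<psi> y] \<subseteq> univ N" "?c + length [a, \<psi> y] \<le> e" using a c by auto
    then obtain zs where zs: "length zs = length [a, \<psi> y]" "pos ?c (bs @ zs) (bs' @ [a, \<psi> y])"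
      using pos_back by metis
    then obtain x1 x2 where x: "zs = [x1, x2]" by (auto simp: length_Suc_conv)
    have p: "pos ?c (bs @ [x1, x2]) (bs' @ [a, \<psi> y])" using zs x by simp
    have "x1 = y" using twinD[OF p _ _ y, of "length bs"] a length_bs by (simp add: nth_append)
    moreover have "x2 = y"
      using twinD[OF p _ _ y, of "Suc (length bs)"] twin\<psi>[OF y] length_bs by (simp add: nth_append)
    moreover have "x1 \<noteq> x2"
    proof -
      have "(bs @ [x1, x2]) ! length bs = (bs @ [x1, x2]) ! Suc (length bs) \<longleftrightarrow>
         (bs' @ [a, \<psi> y]) ! length bs = (bs' @ [a, \<psi> y]) ! Suc (length bs)"
        using pos_pattern[OF p] unfolding same_pattern_def by simp
      then show ?thesis using ne length_bs by (simp add: nth_append)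
    qed
    ultimately show False by simp
  qed
  define \<phi>' where "\<phi>' w = (if w \<in> Y' then \<psi> w else \<phi> w)" for w
  have new: "pins ?c \<phi>' (Y \<union> Y' \<union> set bs)"
    unfolding pins_def
  proof (intro conjI allI impI)
    show "Y \<union> Y' \<union> set bs \<subseteq> univ M" using pins Y'V by (auto simp: pins_def)
    have "\<psi> y \<in> univ N" if "y \<in> Y'" for y using \<psi>[OF that] by (auto simp: pos_def)
    then show "\<phi>' ` (Y \<union> Y' \<union> set bs) \<subseteq> univ N" using pins by (auto simp: pins_def \<phi>'_def)
    fix m' xs ys l w
    assume a: "?c \<le> m' \<and> pos m' xs ys \<and> l < length xs \<and> w \<in> Y \<union> Y' \<union> set bs"
    show "xs ! l = w \<longleftrightarrow> ys ! l = \<phi>' w"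
    proof (cases "w \<in> Y'")
      case False
      then show ?thesis using pinsD[OF pins, of m' xs ys l w] a c by (auto simp: \<phi>'_def)
    next
      case True
      have ysN: "ys ! l \<in> univ N" using a pos_length[of m' xs ys] unfolding pos_def by (metis nth_mem subsetD)
      show ?thesis
      proof
        assume "xs ! l = w"
        then have "twin w (ys ! l)" using twinI[of m' xs ys l] a True by auto
        then show "ys ! l = \<phi>' w" using unique[OF True] ysN True by (simp add: \<phi>'_def)
      next
        assume "ys ! l = \<phi>' w"
        then have "twin w (ys ! l)" using twin\<psi>[OF True] True by (simp add: \<phi>'_def)
        then show "xs ! l = w" using twinD a True by blast
      qed
    qed
  qed
  have old: "type_over L N \<phi>' S a = type_over L N \<phi> S a" for a
  proof (rule type_over_eqI)
    fix i and cs :: "'a option list" assume "names cs \<subseteq> S"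
    then have "\<phi>' w = \<phi> w" if "Some w \<in> set cs" for w
      using that SW Y'W by (auto simp: \<phi>'_def names_def)
    then have "map (case_option a \<phi>') cs = map (case_option a \<phi>) cs" by (auto split: option.splits)
    then show "rel N i (map (case_option a \<phi>') cs) = rel N i (map (case_option a \<phi>) cs)" by (rule arg_cong)
  qed
  show ?case
  proof (intro exI[of _ \<phi>'] conjI allI impI)
    fix m xs ys l assume "?c \<le> m \<and> pos m xs ys \<and> l < length xs"
    then show "tp L M S (xs ! l) = type_over L N \<phi>' S (ys ! l)" using T unfolding old by blast
  qed (rule new)
qed

text \<open>Once \<open>U\<close> is pinned, any answer to \<open>y\<close> can serve as its label,
  since answers are unique up to similarity. Beyond \<open>(k - 1) * (k - 1)\<close> rounds,
  \<open>k\<close> suffice to play the tuple of a relation, and \<open>card (A - U) + 1\<close> to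
  count a class from both sides; the pinned part of a class is already matched.\<close>

lemma label_map:
  assumes lev: "levels L M k S U Y" and bsU: "set bs = U - Y"
    and sim: "\<forall>u\<in>V - U. \<forall>v\<in>V - U. tp L M S u = tp L M S v \<longrightarrow> (u, v) \<in> similar L M"
    and e: "(k - 1) * (k - 1) + 2 \<le> e" "(k - 1) * (k - 1) + k \<le> e"
  obtains \<rho> where "labelled L M k N \<rho>"
    "\<forall>A\<in>classes. (k - 1) * (k - 1) + card (A - U) + 1 \<le> e \<longrightarrow>
       card {y \<in> univ N. \<rho> y \<in> A} = card A"
    "\<forall>A\<in>classes. A - U \<noteq> {} \<longrightarrow> card (A \<inter> U) < card {y \<in> univ N. \<rho> y \<in> A}"
proof -
  let ?c = "(k - 1) * (k - 1)"
  have cost: "cost k = ?c" by (simp add: cost_def)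
  note sub = levels_subset[OF lev]
  have U: "Y \<union> set bs = U" using bsU sub by blast
  obtain \<phi> where pins: "pins ?c \<phi> U"
    and T: "\<And>m xs ys l. ?c \<le> m \<Longrightarrow> pos m xs ys \<Longrightarrow> l < length xs \<Longrightarrow>
       tp L M S (xs ! l) = type_over L N \<phi> S (ys ! l)"
    using levels_pins[OF lev] bsU e unfolding cost U by blast
  have "\<exists>x\<in>V. pos ?c (bs @ [x]) (bs' @ [y])" if y: "y \<in> univ N" for y
  proof -
    obtain zs where "length zs = length [y]" "set zs \<subseteq> V" "pos ?c (bs @ zs) (bs' @ [y])"
      using pos_back[of "[y]" ?c] y e k_pos by auto
    then show ?thesis by (auto simp: length_Suc_conv)
  qed
  then obtain \<rho> where \<rho>: "\<And>y. y \<in> univ N \<Longrightarrow> \<rho> y \<in> V \<and> pos ?c (bs @ [\<rho> y]) (bs' @ [y])" by metis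
  have \<rho>_pin: "\<rho> y = w \<longleftrightarrow> y = \<phi> w" if "y \<in> univ N" "w \<in> U" for y w
    using pinsD[OF pins conjunct2[OF \<rho>[OF that(1)]] _ _ that(2), of "length bs"] length_bs
    by (simp add: nth_append)
  \<comment> \<open>In \<open>U\<close> the pins decide. Outside \<open>U\<close> both
    \<open>?x\<close> and the label have the type of \<open>?y\<close> over \<open>S\<close>, and
    equal types there mean similarity.\<close>
  have R1: "(xs ! l, \<rho> (ys ! l)) \<in> similar L M"
    if p: "pos m xs ys" "?c \<le> m" "l < length xs" for m xs ys l
  proof -
    let ?x = "xs ! l" and ?y = "ys ! l"
    have xV: "?x \<in> V" and yN: "?y \<in> univ N"
      using p pos_length[OF p(1)] unfolding pos_def by (auto simp: subset_iff)
    show ?thesis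
    proof (cases "?x \<in> U \<or> \<rho> ?y \<in> U")
      case True
      then have "?x = \<rho> ?y" using pinsD[OF pins p(1,2,3)] \<rho>_pin[OF yN] by metis
      then show ?thesis using similar_refl[OF xV] by metis
    next
      case False
      have "tp L M S ?x = type_over L N \<phi> S ?y" by (rule T[OF p(2,1,3)])
      also have "\<dots> = tp L M S (\<rho> ?y)"
        using T[OF _ conjunct2[OF \<rho>[OF yN]], of "length bs"] length_bs by (simp add: nth_append)
      finally show ?thesis using sim False xV \<rho>[OF yN] by blast
    qed
  qed
  have rel: "rel M i xs = rel N i ys"
    if i: "i < length L" "length xs = L ! i" "set ys \<subseteq> univ N" "same_pattern xs ys"
      and lab: "\<And>j. j < length xs \<Longrightarrow> (xs ! j, \<rho> (ys ! j)) \<in> similar L M" for i xs ys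
  proof -
    have len: "length ys = length xs" using i(4) by (simp add: same_pattern_def)
    then have "?c + length ys \<le> e" using i arity[OF i(1)] e by simp
    then obtain zs where zs: "length zs = length ys" "pos ?c (bs @ zs) (bs' @ ys)"
      using pos_back[OF i(3)] by metis
    have n: "(bs @ zs) ! (length bs + j) = zs ! j" "(bs' @ ys) ! (length bs + j) = ys ! j" for j
      using length_bs by (auto simp: nth_append)
    have "rel M i xs = rel M i zs"
    proof (rule rel_similar_pattern[OF i(1,2)])
      have "zs ! j = zs ! h \<longleftrightarrow> ys ! j = ys ! h" if "j < length zs" "h < length zs" for j h
        using pos_pattern[OF zs(2)] that n unfolding same_pattern_def by (metis add_less_cancel_left length_append)
      then have "same_pattern ys zs" using zs(1) by (auto simp: same_pattern_def)
      then show "same_pattern xs zs" using same_pattern_trans[OF i(4)] by blast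
      fix j assume j: "j < length xs"
      have "(zs ! j, \<rho> (ys ! j)) \<in> similar L M"
        using R1[OF zs(2), of "length bs + j"] n[of j] j zs(1) len by simp
      then show "(xs ! j, zs ! j) \<in> similar L M"
        using lab[OF j] similar_sym similar_trans by metis
    qed
    also have "\<dots> = rel N i ys"
    proof -
      have "rel M i (map ((!) zs) [0..<length zs]) = rel N i (map ((!) ys) [0..<length zs])"
      proof (rule same_atoms_rel[OF pos_atoms[OF zs(2)] i(1)])
        show "length [0..<length zs] = L ! i" using zs len i by simp
        show "\<exists>l<length (bs @ zs). zs ! j = (bs @ zs) ! l \<and> ys ! j = (bs' @ ys) ! l"
          if "j \<in> set [0..<length zs]" for j
          using that n[of j] by (intro exI[of _ "length bs + j"]) auto
      qed
      moreover have "map ((!) ys) [0..<length zs] = ys" unfolding zs(1) by (rule map_nth)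
      ultimately show ?thesis by (simp only: map_nth)
    qed
    finally show ?thesis .
  qed
  have inj: "inj_on \<phi> U"
  proof (rule inj_onI)
    fix w w' assume w: "w \<in> U" "w' \<in> U" "\<phi> w = \<phi> w'"
    have "\<phi> w \<in> univ N" using pins w by (auto simp: pins_def)
    then show "w = w'" using \<rho>_pin w by metis
  qed
  define Z where "Z A = {y \<in> univ N - \<phi> ` U. \<rho> y \<in> A}" for A
  have split: "{y \<in> univ N. \<rho> y \<in> A} = \<phi> ` (A \<inter> U) \<union> Z A" for A
  proof -
    have "\<rho> (\<phi> w) = w" "\<phi> w \<in> univ N" if "w \<in> U" for w
      using \<rho>_pin[of "\<phi> w" w] pins that by (auto simp: pins_def)
    then show ?thesis by (auto simp: Z_def)
  qed
  have card_split: "card {y \<in> univ N. \<rho> y \<in> A} = card (A \<inter> U) + card (Z A)" if "A \<in> classes" for A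
  proof -
    have "finite (A \<inter> U)" "finite (Z A)" using finite_class[OF that] univ_N by (auto simp: Z_def)
    then have "card (\<phi> ` (A \<inter> U) \<union> Z A) = card (\<phi> ` (A \<inter> U)) + card (Z A)"
      by (intro card_Un_disjoint) (auto simp: Z_def)
    moreover have "card (\<phi> ` (A \<inter> U)) = card (A \<inter> U)"
      by (rule card_image) (use inj in \<open>auto intro: inj_on_subset\<close>)
    ultimately show ?thesis unfolding split by simp
  qed
  have corr: "(x \<in> A - U) \<longleftrightarrow> (y \<in> Z A)"
    if A: "A \<in> classes" and p: "pos ?c (bs @ zs) (bs' @ zs')" and j: "j < length zs"
      and xy: "x = zs ! j" "y = zs' ! j" for A zs zs' j x y
  proof -
    have n: "(bs @ zs) ! (length bs + j) = x" "(bs' @ zs') ! (length bs + j) = y"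
      using length_bs xy by (auto simp: nth_append)
    have s: "(x, \<rho> y) \<in> similar L M" using R1[OF p, of "length bs + j"] n j by simp
    have "x = w \<longleftrightarrow> y = \<phi> w" if "w \<in> U" for w
      using pinsD[OF pins p _ _ that, of "length bs + j"] n j by simp
    then have "x \<in> U \<longleftrightarrow> y \<in> \<phi> ` U" by blast
    moreover have "y \<in> univ N"
      using p j xy pos_length[OF p] length_bs unfolding pos_def by (auto simp: subset_iff)
    moreover have "x \<in> A \<longleftrightarrow> \<rho> y \<in> A"
      using similar_class_iff[OF A] s similar_sym by metis
    ultimately show ?thesis by (auto simp: Z_def)
  qed
  have pat: "distinct zs \<longleftrightarrow> distinct zs'" if p: "pos ?c (bs @ zs) (bs' @ zs')" for zs zs'
  proof -
    have len: "length zs' = length zs" using pos_length[OF p] length_bs by simp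
    have "zs ! j = zs ! h \<longleftrightarrow> zs' ! j = zs' ! h" if "j < length zs" "h < length zs" for j h
    proof -
      have "(bs @ zs) ! (length bs + j) = (bs @ zs) ! (length bs + h) \<longleftrightarrow>
          (bs' @ zs') ! (length bs + j) = (bs' @ zs') ! (length bs + h)"
        using pos_pattern[OF p] that unfolding same_pattern_def
        by (metis add_less_cancel_left length_append)
      then show ?thesis using length_bs by (simp add: nth_append)
    qed
    then show ?thesis using len by (auto simp: distinct_conv_nth)
  qed
  have lower: "card (set zs) \<le> card (Z A)"
    if A: "A \<in> classes" and zs: "set zs \<subseteq> A - U" "distinct zs" "?c + length zs \<le> e" for A zs
  proof -
    have "set zs \<subseteq> V" using zs(1) similar_class_subset[OF A] by auto
    then obtain zs' where p: "length zs' = length zs" "pos ?c (bs @ zs) (bs' @ zs')"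
      using pos_forth zs(3) by metis
    have "set zs' \<subseteq> Z A"
      using corr[OF A p(2)] zs(1) p(1) by (metis in_set_conv_nth subset_iff)
    then have "card (set zs') \<le> card (Z A)" using univ_N by (intro card_mono) (auto simp: Z_def)
    then show ?thesis using pat[OF p(2)] zs(2) p(1) distinct_card by metis
  qed
  have count: "card {y \<in> univ N. \<rho> y \<in> A} = card A"
    if A: "A \<in> classes" and eA: "?c + card (A - U) + 1 \<le> e" for A
  proof -
    have fA: "finite A" using finite_class[OF A] .
    obtain zs where zs: "set zs = A - U" "distinct zs" using finite_distinct_list[of "A - U"] fA by auto
    then have "card (A - U) \<le> card (Z A)" using lower[OF A, of zs] eA distinct_card[OF zs(2)] by simp
    moreover have "card (Z A) \<le> card (A - U)"
    proof (rule ccontr)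
      assume "\<not> card (Z A) \<le> card (A - U)"
      then obtain Q where Q: "Q \<subseteq> Z A" "card Q = card (A - U) + 1" "finite Q"
        using obtain_subset_with_card_n[of "card (A - U) + 1" "Z A"] by auto
      obtain ys where ys: "set ys = Q" "distinct ys" using finite_distinct_list[OF Q(3)] by blast
      have len: "length ys = card (A - U) + 1" using ys Q distinct_card by metis
      have "set ys \<subseteq> univ N" "?c + length ys \<le> e" using Q ys len eA by (auto simp: Z_def)
      then obtain xs where p: "length xs = length ys" "pos ?c (bs @ xs) (bs' @ ys)"
        using pos_back by metis
      have "set xs \<subseteq> A - U"
        using corr[OF A p(2)] Q(1) ys(1) p(1) by (metis in_set_conv_nth subset_iff)
      then have "card (set xs) \<le> card (A - U)" using fA by (intro card_mono) auto
      moreover have "card (set xs) = length ys" using pat[OF p(2)] ys(2) p(1) distinct_card by metis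
      ultimately show False using len by simp
    qed
    ultimately have "card {y \<in> univ N. \<rho> y \<in> A} = card (A \<inter> U) + card (A - U)"
      using card_split[OF A] by simp
    also have "\<dots> = card A" using fA by (metis card_Int_Diff)
    finally show ?thesis .
  qed
  have "card (A \<inter> U) < card {y \<in> univ N. \<rho> y \<in> A}" if A: "A \<in> classes" "A - U \<noteq> {}" for A
  proof -
    obtain a where "a \<in> A - U" using A by blast
    then have "1 \<le> card (Z A)" using lower[OF A(1), of "[a]"] e by simp
    then show ?thesis using card_split[OF A(1)] by simp
  qed
  moreover have "labelled L M k N \<rho>"
    by unfold_locales (use univ_N \<rho> rel in auto)
  ultimately show ?thesis using that[of \<rho>] count by blast
qed

end

subsection \<open>Structures with the same labelled tuples\<close>

lemma same_pattern_fun: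
  assumes "same_pattern xs ys"
  obtains h where "\<And>l. l < length xs \<Longrightarrow> h (xs ! l) = ys ! l" "inj_on h (set xs)"
proof -
  define h where "h x = ys ! (SOME l. l < length xs \<and> xs ! l = x)" for x
  have h: "h (xs ! l) = ys ! l" if "l < length xs" for l
  proof -
    let ?l = "SOME h. h < length xs \<and> xs ! h = xs ! l"
    have "?l < length xs \<and> xs ! ?l = xs ! l" by (rule someI[of _ l]) (use that in simp)
    then show ?thesis using assms that by (auto simp: h_def same_pattern_def)
  qed
  moreover have "inj_on h (set xs)"
  proof (rule inj_onI)
    fix x y assume "x \<in> set xs" "y \<in> set xs" "h x = h y"
    then show "x = y" using h assms unfolding same_pattern_def by (metis in_set_conv_nth)
  qed
  ultimately show ?thesis using that by blast
qed

text \<open>A tuple on which a transposition fails contains one of the two exchanged elements, so it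
  has at most \<open>k - 1\<close> others. Failure of similarity in \<open>P\<close> is thus exposed
  by \<open>k - 1\<close> moves in \<open>P\<close>, which is why similarity passes from
  \<open>Q\<close> to \<open>P\<close> in a game played on \<open>P\<close>.\<close>

lemma similar_transfer:
  assumes surv: "survives L (k - 1) P xs Q ys" and ne: "univ P \<noteq> {}"
    and arity: "\<And>i. i < length L \<Longrightarrow> L ! i \<le> k"
    and xs: "set xs \<subseteq> univ P" "i < length xs" "j < length xs"
    and ys: "set ys \<subseteq> univ Q" and sim: "(ys ! i, ys ! j) \<in> similar L Q"
  shows "(xs ! i, xs ! j) \<in> similar L P"
proof (rule similarI)
  show "xs ! i \<in> univ P" "xs ! j \<in> univ P" using xs by auto
  let ?a = "xs ! i" and ?b = "xs ! j" and ?a' = "ys ! i" and ?b' = "ys ! j"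
  fix r zs assume r: "r < length L" "length zs = L ! r" "set zs \<subseteq> univ P"
  show "rel P r zs = rel P r (map (transpose ?a ?b) zs)"
  proof (cases "?a \<in> set zs \<or> ?b \<in> set zs")
    case False
    then have "map (transpose ?a ?b) zs = zs" by (intro map_idI) (auto simp: transpose_def)
    then show ?thesis by simp
  next
    case True
    obtain ws where ws: "set ws = set zs - {?a, ?b}" "distinct ws"
      using finite_distinct_list[of "set zs - {?a, ?b}"] by auto
    have "card (set ws) < card (set zs)" using ws(1) True by (intro psubset_card_mono) auto
    then have "length ws \<le> k - 1"
      using arity[OF r(1)] r(2) card_length[of zs] distinct_card[OF ws(2)] by linarith
    then have "survives L (0 + length ws) P xs Q ys" using survives_mono[OF surv ne] by simp
    from survives_append[OF this] ws(1) r(3) obtain ws' where ws': "length ws' = length ws"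
      "set ws' \<subseteq> univ Q" and at: "same_atoms L P (xs @ ws) Q (ys @ ws')" by auto
    have len: "length ys = length xs"
      using at ws' by (auto simp: same_atoms_def same_pattern_def)
    obtain h where h: "\<And>l. l < length (xs @ ws) \<Longrightarrow> h ((xs @ ws) ! l) = (ys @ ws') ! l"
      and inj: "inj_on h (set (xs @ ws))"
      using same_pattern_fun[of "xs @ ws" "ys @ ws'"] at unfolding same_atoms_def by blast
    have ha: "h ?a = ?a'" "h ?b = ?b'"
      using h[of i] h[of j] xs len by (simp_all add: nth_append)
    have zsub: "set zs \<subseteq> set (xs @ ws)" using ws(1) xs by auto
    have hQ: "h z \<in> univ Q" if z: "z \<in> set (xs @ ws)" for z
    proof -
      obtain l where "l < length (xs @ ws)" "(xs @ ws) ! l = z" using z unfolding in_set_conv_nth by blast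
      then have "h z \<in> set (ys @ ws')" using h[of l] len ws'(1) by (metis length_append nth_mem)
      then show ?thesis using ys ws'(2) by auto
    qed
    have rel: "rel P r (map f zs) = rel Q r (map (\<lambda>z. h (f z)) zs)" if "f ` set zs \<subseteq> set (xs @ ws)" for f
    proof (rule same_atoms_rel[OF at r(1,2)])
      fix c assume "c \<in> set zs"
      then have "f c \<in> set (xs @ ws)" using that by blast
      then obtain l where "l < length (xs @ ws)" "(xs @ ws) ! l = f c"
        unfolding in_set_conv_nth by blast
      then show "\<exists>l<length (xs @ ws). f c = (xs @ ws) ! l \<and> h (f c) = (ys @ ws') ! l" using h by metis
    qed
    have "rel P r zs = rel Q r (map h zs)" using rel[of "\<lambda>z. z"] zsub by simp
    also have "\<dots> = rel Q r (map (transpose ?a' ?b') (map h zs))"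
      using similar_rel[OF sim r(1), of "map h zs"] r(2) hQ zsub by auto
    also have "map (transpose ?a' ?b') (map h zs) = map (\<lambda>z. h (transpose ?a ?b z)) zs"
    proof -
      have "transpose ?a' ?b' (h z) = h (transpose ?a ?b z)" if "z \<in> set zs" for z
      proof (cases "z = ?a \<or> z = ?b")
        case True
        then show ?thesis using ha by auto
      next
        case False
        have "z \<in> set (xs @ ws)" "?a \<in> set (xs @ ws)" "?b \<in> set (xs @ ws)" using zsub that xs by auto
        then have "h z \<noteq> ?a'" "h z \<noteq> ?b'" using False ha inj_onD[OF inj] by metis+
        then show ?thesis using False by simp
      qed
      then show ?thesis by simp
    qed
    also have "rel Q r (map (\<lambda>z. h (transpose ?a ?b z)) zs) = rel P r (map (transpose ?a ?b) zs)"
      by (rule rel[symmetric]) (use zsub xs in \<open>auto simp: transpose_def\<close>)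
    finally show ?thesis .
  qed
qed

lemma inj_on_with_value:
  assumes "finite X" "finite Y" "card X \<le> card Y" "x \<in> X" "y \<in> Y"
  obtains g where "inj_on g X" "g ` X \<subseteq> Y" "g x = y"
proof -
  obtain f where f: "inj_on f X" "f ` X \<subseteq> Y" using inj_on_iff_card_le[OF assms(1,2)] assms(3) by blast
  define g where "g z = transpose (f x) y (f z)" for z
  have "inj_on g X"
  proof (rule inj_onI)
    fix z w assume zw: "z \<in> X" "w \<in> X" "g z = g w"
    then have "f z = f w" unfolding g_def by (metis transpose_involutory)
    then show "z = w" using inj_onD[OF f(1)] zw by blast
  qed
  moreover have "g ` X \<subseteq> Y"
    using f(2) assms(4,5) by (auto simp: g_def transpose_def image_subset_iff)
  moreover have "g x = y" by (simp add: g_def)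
  ultimately show ?thesis using that by blast
qed

section \<open>Class sizes and similarity read off the labels\<close>

context labelled
begin

abbreviation fibre :: "'a set \<Rightarrow> 'b set" where "fibre A \<equiv> {y \<in> univ N. \<rho> y \<in> A}"

abbreviation cl :: "'a \<Rightarrow> 'a set" where "cl x \<equiv> similar L M `` {x}"

lemma rel_label_map:
  assumes "i < length L" "length cs = L ! i" "\<And>c. c \<in> set cs \<Longrightarrow> g c \<in> univ N"
    and "\<And>c d. c \<in> set cs \<Longrightarrow> d \<in> set cs \<Longrightarrow> f c = f d \<longleftrightarrow> g c = g d"
    and "\<And>c. c \<in> set cs \<Longrightarrow> (f c, \<rho> (g c)) \<in> similar L M"
  shows "rel M i (map f cs) = rel N i (map g cs)"
proof (rule rel_label)
  show "same_pattern (map f cs) (map g cs)" by (rule same_pattern_maps) (use assms in auto)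
qed (use assms in auto)

text \<open>Injections chosen class by class combine, because the label of an image reveals the
  class of its origin.\<close>

lemma glue_into:
  assumes "X \<subseteq> V" and h: "\<forall>A\<in>classes. inj_on (h A) (X \<inter> A) \<and> h A ` (X \<inter> A) \<subseteq> fibre A"
  shows "inj_on (\<lambda>x. h (cl x) x) X" "\<And>x. x \<in> X \<Longrightarrow> h (cl x) x \<in> univ N"
    "\<And>x. x \<in> X \<Longrightarrow> (x, \<rho> (h (cl x) x)) \<in> similar L M"
proof -
  have m: "h (cl x) x \<in> fibre (cl x)" if "x \<in> X" for x
    using bspec[OF h, of "cl x"] class_of[of x] that assms(1) by blast
  then show "h (cl x) x \<in> univ N" "(x, \<rho> (h (cl x) x)) \<in> similar L M" if "x \<in> X" for x
    using that by auto
  show "inj_on (\<lambda>x. h (cl x) x) X"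
  proof (rule inj_onI)
    fix x y assume xy: "x \<in> X" "y \<in> X" "h (cl x) x = h (cl y) y"
    have "(x, y) \<in> similar L M"
      using m[OF xy(1)] m[OF xy(2)] xy(3) similar_sym similar_trans by (metis (mono_tags, lifting) Image_singleton_iff mem_Collect_eq)
    then have e: "cl x = cl y" by (rule equiv_class_eq[OF equiv_similar])
    have "x \<in> X \<inter> cl x" "y \<in> X \<inter> cl x" "cl x \<in> classes"
      using xy(1,2) assms(1) class_of e by auto
    then show "x = y" using bspec[OF h, of "cl x"] xy(3) e inj_onD by metis
  qed
qed

lemma isomorphic_if_counts:
  assumes "\<And>A. A \<in> classes \<Longrightarrow> card (fibre A) = card A"
  shows "isomorphic L M N"
proof -
  have "\<exists>h. bij_betw h A (fibre A)" if "A \<in> classes" for A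
    using finite_same_card_bij[of A "fibre A"] assms[OF that] finite_class[OF that] fin_N by auto
  then obtain h where h: "\<And>A. A \<in> classes \<Longrightarrow> bij_betw (h A) A (fibre A)" by metis
  have h': "\<forall>A\<in>classes. inj_on (h A) (V \<inter> A) \<and> h A ` (V \<inter> A) \<subseteq> fibre A"
  proof
    fix A assume A: "A \<in> classes"
    have "V \<inter> A = A" using similar_class_subset[OF A] by blast
    then show "inj_on (h A) (V \<inter> A) \<and> h A ` (V \<inter> A) \<subseteq> fibre A"
      using h[OF A] by (auto simp: bij_betw_def)
  qed
  let ?f = "\<lambda>x. h (cl x) x"
  note g = glue_into[of V h, OF order_refl h']
  have "y \<in> ?f ` V" if "y \<in> univ N" for y
  proof -
    have c: "cl (\<rho> y) \<in> classes" "\<rho> y \<in> cl (\<rho> y)" using class_of \<rho>_univ that by auto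
    then have "y \<in> h (cl (\<rho> y)) ` cl (\<rho> y)" using h[OF c(1)] that by (auto simp: bij_betw_def)
    then obtain x where x: "x \<in> cl (\<rho> y)" "y = h (cl (\<rho> y)) x" by blast
    then have s: "(\<rho> y, x) \<in> similar L M" by simp
    have "x \<in> V" "y = ?f x" using similar_univ[OF s] x(2) equiv_class_eq[OF equiv_similar s] by auto
    then show ?thesis by blast
  qed
  then have "bij_betw ?f V (univ N)" using g(1,2) by (auto simp: bij_betw_def)
  moreover have "rel M i xs = rel N i (map ?f xs)"
    if "i < length L" "length xs = L ! i" "set xs \<subseteq> V" for i xs
  proof -
    have "rel M i (map (\<lambda>x. x) xs) = rel N i (map ?f xs)"
    proof (rule rel_label_map[OF that(1,2)])
      fix c d assume "c \<in> set xs" "d \<in> set xs"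
      then show "c = d \<longleftrightarrow> ?f c = ?f d" using g(1) that(3) inj_onD[OF g(1)] by blast
    qed (use g(2,3) that(3) in auto)
    then show ?thesis by simp
  qed
  ultimately show ?thesis unfolding isomorphic_def is_iso_def by blast
qed

text \<open>A class of \<open>M\<close> with at least \<open>k\<close> elements looks the same to tuples of length \<open>k\<close> whatever
  its exact size, so the next two lemmas need the right class sizes only outside such an \<open>A1\<close>.\<close>

lemma fibre_similar:
  assumes A1: "A1 \<in> classes" "k \<le> card A1"
    and count: "\<And>A. A \<in> classes \<Longrightarrow> A \<noteq> A1 \<Longrightarrow> card (fibre A) = card A"
    and A: "A \<in> classes" "x \<in> fibre A" "y \<in> fibre A"
  shows "(x, y) \<in> similar L N"
proof (rule similarI)
  show "x \<in> univ N" "y \<in> univ N" using A by auto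
  fix i and ys :: "'b list" assume ys: "i < length L" "length ys = L ! i" "set ys \<subseteq> univ N"
  have "\<exists>g. inj_on g (set ys \<inter> fibre B) \<and> g ` (set ys \<inter> fibre B) \<subseteq> B" if B: "B \<in> classes" for B
  proof -
    have "card (set ys \<inter> fibre B) \<le> card B"
    proof (cases "B = A1")
      case True
      have "card (set ys \<inter> fibre B) \<le> card (set ys)" by (intro card_mono) auto
      then have "card (set ys \<inter> fibre B) \<le> card A1"
        using arity[OF ys(1)] ys(2) card_length[of ys] A1(2) by linarith
      then show ?thesis using True by simp
    next
      case False
      have "card (set ys \<inter> fibre B) \<le> card (fibre B)" using fin_N by (intro card_mono) auto
      then show ?thesis using count[OF B False] by simp
    qed
    then show ?thesis using inj_on_iff_card_le[of "set ys \<inter> fibre B" B] finite_class[OF B] by simp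
  qed
  then have "\<forall>B\<in>classes. \<exists>g. inj_on g (set ys \<inter> fibre B) \<and> g ` (set ys \<inter> fibre B) \<subseteq> B"
    by (rule ballI)
  from bchoice[OF this] obtain g
    where "\<forall>B\<in>classes. inj_on (g B) (set ys \<inter> fibre B) \<and> g B ` (set ys \<inter> fibre B) \<subseteq> B" by (rule exE)
  note g = this[rule_format]
  let ?f = "\<lambda>z. g (cl (\<rho> z)) z"
  have c: "cl (\<rho> z) \<in> classes" "\<rho> z \<in> cl (\<rho> z)" if "z \<in> set ys" for z
    using class_of[of "\<rho> z"] \<rho>_univ subsetD[OF ys(3) that] by auto
  have m: "(\<rho> z, ?f z) \<in> similar L M" if "z \<in> set ys" for z
    using g[OF c(1)[OF that]] c(2)[OF that] that ys(3) by auto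
  have inj: "inj_on ?f (set ys)"
  proof (rule inj_onI)
    fix z w assume zw: "z \<in> set ys" "w \<in> set ys" "?f z = ?f w"
    have "(\<rho> z, \<rho> w) \<in> similar L M"
      using m[OF zw(1)] m[OF zw(2)] zw(3) similar_sym similar_trans by metis
    then have e: "cl (\<rho> z) = cl (\<rho> w)" by (rule equiv_class_eq[OF equiv_similar])
    have "z \<in> set ys \<inter> fibre (cl (\<rho> z))" "w \<in> set ys \<inter> fibre (cl (\<rho> z))"
      using zw(1,2) c e ys(3) by auto
    moreover have "g (cl (\<rho> z)) z = g (cl (\<rho> z)) w" using zw(3) e by simp
    ultimately show "z = w" using inj_onD[OF conjunct1[OF g[OF c(1)[OF zw(1)]]]] by blast
  qed
  have \<rho>t: "(\<rho> z, \<rho> (transpose x y z)) \<in> similar L M" if "z \<in> univ N" for z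
  proof -
    have "(\<rho> x, \<rho> y) \<in> similar L M" using similar_class_iff[OF A(1)] A by blast
    then show ?thesis using similar_sym similar_refl[of "\<rho> z" M L] \<rho>_univ that
      by (auto simp: transpose_def)
  qed
  have "rel M i (map ?f ys) = rel N i (map (\<lambda>z. z) ys)"
  proof (rule rel_label_map[OF ys(1,2)])
    fix z w assume zw: "z \<in> set ys" "w \<in> set ys"
    show "z \<in> univ N" using zw ys by auto
    show "?f z = ?f w \<longleftrightarrow> z = w" by (rule inj_on_eq_iff[OF inj zw])
    show "(?f z, \<rho> z) \<in> similar L M" by (rule similar_sym[OF m[OF zw(1)]])
  qed
  moreover have "rel M i (map ?f ys) = rel N i (map (transpose x y) ys)"
  proof (rule rel_label_map[OF ys(1,2)])
    fix z w assume zw: "z \<in> set ys" "w \<in> set ys"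
    show "transpose x y z \<in> univ N" using zw ys A by (auto simp: transpose_def)
    show "?f z = ?f w \<longleftrightarrow> transpose x y z = transpose x y w"
    proof -
      have "transpose x y z = transpose x y w \<longleftrightarrow> z = w" by (metis transpose_involutory)
      then show ?thesis using inj_on_eq_iff[OF inj zw] by blast
    qed
    show "(?f z, \<rho> (transpose x y z)) \<in> similar L M"
      by (rule similar_trans[OF similar_sym[OF m[OF zw(1)]] \<rho>t]) (use zw ys in auto)
  qed
  ultimately show "rel N i ys = rel N i (map (transpose x y) ys)" by simp
qed

text \<open>Assuming the labels dissimilar makes room: a relevant tuple contains one of them, so
  with both it has at most \<open>k + 1\<close> elements, and no class contains both labels. Hence
  at most \<open>k\<close> elements go into any one fibre, and the tuple can be copied into
  \<open>N\<close> with the two labels sent to \<open>x\<close> and \<open>y\<close>, where the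
  transposition is an automorphism.\<close>

lemma similar_fibre:
  assumes A1: "A1 \<in> classes" "k \<le> card (fibre A1)"
    and count: "\<And>A. A \<in> classes \<Longrightarrow> A \<noteq> A1 \<Longrightarrow> card (fibre A) = card A"
    and xy: "(x, y) \<in> similar L N"
  shows "(\<rho> x, \<rho> y) \<in> similar L M"
proof (rule ccontr)
  let ?a = "\<rho> x" and ?b = "\<rho> y"
  assume ns: "(?a, ?b) \<notin> similar L M"
  have xyN: "x \<in> univ N" "y \<in> univ N" using similar_univ[OF xy] by auto
  then have ab: "?a \<in> V" "?b \<in> V" using \<rho>_univ by auto
  have diff: "\<not> (?a \<in> B \<and> ?b \<in> B)" if "B \<in> classes" for B
    using similar_class_iff[OF that] ns by blast
  have "(?a, ?b) \<in> similar L M"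
  proof (rule similarI[OF ab])
    fix i and zs :: "'a list" assume zs: "i < length L" "length zs = L ! i" "set zs \<subseteq> V"
    show "rel M i zs = rel M i (map (transpose ?a ?b) zs)"
    proof (cases "?a \<in> set zs \<or> ?b \<in> set zs")
      case False
      then have "map (transpose ?a ?b) zs = zs" by (intro map_idI) (auto simp: transpose_def)
      then show ?thesis by simp
    next
      case True
      let ?X = "set zs \<union> {?a, ?b}"
      have XV: "?X \<subseteq> V" using zs ab by auto
      have "\<exists>g. inj_on g (?X \<inter> B) \<and> g ` (?X \<inter> B) \<subseteq> fibre B \<and> (?a \<in> B \<longrightarrow> g ?a = x) \<and> (?b \<in> B \<longrightarrow> g ?b = y)"
        if B: "B \<in> classes" for B
      proof -
        have cardX: "card ?X \<le> Suc k"
        proof -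
          have "\<exists>c. ?X \<subseteq> insert c (set zs)" using True by blast
          then obtain c where "?X \<subseteq> insert c (set zs)" by blast
          then have "card ?X \<le> card (insert c (set zs))" by (intro card_mono) auto
          also have "\<dots> \<le> Suc (card (set zs))" by (rule card_insert_le_m1) auto
          also have "\<dots> \<le> Suc k" using arity[OF zs(1)] zs(2) card_length[of zs] by linarith
          finally show ?thesis .
        qed
        have cardB: "card (?X \<inter> B) \<le> card (fibre B)"
        proof (cases "B = A1")
          case True
          have "?X \<inter> B \<subset> ?X" using diff[OF B] by blast
          then have "card (?X \<inter> B) < card ?X" by (intro psubset_card_mono) auto
          then show ?thesis using cardX A1(2) True by simp
        next
          case False
          have "card (?X \<inter> B) \<le> card B" using finite_class[OF B] by (intro card_mono) auto
          then show ?thesis using count[OF B False] by simp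
        qed
        have fins: "finite (?X \<inter> B)" "finite (fibre B)" using fin_N by auto
        consider "?a \<in> B" "?b \<notin> B" | "?b \<in> B" "?a \<notin> B" | "?a \<notin> B" "?b \<notin> B" using diff[OF B] by blast
        then show ?thesis
        proof cases
          case 1
          obtain g where "inj_on g (?X \<inter> B)" "g ` (?X \<inter> B) \<subseteq> fibre B" "g ?a = x"
            by (rule inj_on_with_value[OF fins cardB, of ?a x]) (use 1 xyN in auto)
          then show ?thesis using 1 by blast
        next
          case 2
          obtain g where "inj_on g (?X \<inter> B)" "g ` (?X \<inter> B) \<subseteq> fibre B" "g ?b = y"
            by (rule inj_on_with_value[OF fins cardB, of ?b y]) (use 2 xyN in auto)
          then show ?thesis using 2 by blast
        next
          case 3
          then show ?thesis using inj_on_iff_card_le[OF fins] cardB by blast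
        qed
      qed
      then have "\<forall>B\<in>classes. \<exists>g. inj_on g (?X \<inter> B) \<and> g ` (?X \<inter> B) \<subseteq> fibre B \<and>
          (?a \<in> B \<longrightarrow> g ?a = x) \<and> (?b \<in> B \<longrightarrow> g ?b = y)" by (rule ballI)
      from bchoice[OF this] obtain h where "\<forall>B\<in>classes. inj_on (h B) (?X \<inter> B) \<and>
          h B ` (?X \<inter> B) \<subseteq> fibre B \<and> (?a \<in> B \<longrightarrow> h B ?a = x) \<and> (?b \<in> B \<longrightarrow> h B ?b = y)" by (rule exE)
      note h = this[rule_format]
      let ?g = "\<lambda>x. h (cl x) x"
      have "\<forall>A\<in>classes. inj_on (h A) (?X \<inter> A) \<and> h A ` (?X \<inter> A) \<subseteq> fibre A"
      proof
        fix A assume "A \<in> classes"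
        from h[OF this] show "inj_on (h A) (?X \<inter> A) \<and> h A ` (?X \<inter> A) \<subseteq> fibre A" by blast
      qed
      note g = glue_into[OF XV this]
      have gab: "?g ?a = x" "?g ?b = y" using h class_of ab by auto
      have "rel M i (map (\<lambda>z. z) zs) = rel N i (map ?g zs)"
        by (rule rel_label_map[OF zs(1,2)]) (use g inj_on_eq_iff[OF g(1)] in auto)
      moreover have "rel M i (map (transpose ?a ?b) zs) = rel N i (map (\<lambda>z. ?g (transpose ?a ?b z)) zs)"
      proof (rule rel_label_map[OF zs(1,2)])
        fix c d assume cd: "c \<in> set zs" "d \<in> set zs"
        have tX: "transpose ?a ?b c \<in> ?X" "transpose ?a ?b d \<in> ?X" using cd by (auto simp: transpose_def)
        show "?g (transpose ?a ?b c) \<in> univ N" "(transpose ?a ?b c, \<rho> (?g (transpose ?a ?b c))) \<in> similar L M"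
          using g(2,3)[OF tX(1)] by auto
        show "transpose ?a ?b c = transpose ?a ?b d \<longleftrightarrow> ?g (transpose ?a ?b c) = ?g (transpose ?a ?b d)"
          using inj_on_eq_iff[OF g(1) tX] by blast
      qed
      moreover have "map (\<lambda>z. ?g (transpose ?a ?b z)) zs = map (transpose x y) (map ?g zs)"
      proof -
        have "?g (transpose ?a ?b z) = transpose x y (?g z)" if "z \<in> set zs" for z
        proof (cases "z = ?a \<or> z = ?b")
          case True
          then show ?thesis using gab by auto
        next
          case False
          then have "?g z \<noteq> ?g ?a" "?g z \<noteq> ?g ?b" using that inj_onD[OF g(1), of z] by auto
          then show ?thesis using False gab by simp
        qed
        then show ?thesis by simp
      qed
      moreover have "rel N i (map (transpose x y) (map ?g zs)) = rel N i (map ?g zs)"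
        by (rule similar_rel[OF xy zs(1)]) (use zs(2) g(2) in auto)
      ultimately show ?thesis by simp
    qed
  qed
  then show False using ns by contradiction
qed

text \<open>If the fibre of \<open>A1\<close> were too large, \<open>many\<close> would yield
  \<open>card A1 + 1\<close> pairwise similar elements of \<open>M\<close>. If it were too small,
  the similar elements \<open>cs'\<close> would have labels in one class whose fibre has at least
  \<open>card A1\<close> elements; this class is not \<open>A1\<close>, so its own size is that of
  its fibre, against strict maximality.\<close>

lemma isomorphic_if_survives:
  assumes A1: "A1 \<in> classes" "k \<le> card A1" "k \<le> card (fibre A1)"
    and max: "\<And>A. A \<in> classes \<Longrightarrow> A \<noteq> A1 \<Longrightarrow> card A < card A1"
    and count: "\<And>A. A \<in> classes \<Longrightarrow> A \<noteq> A1 \<Longrightarrow> card (fibre A) = card A"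
    and cs: "set cs = A1" "distinct cs"
    and few: "set cs' \<subseteq> univ N" "survives L (k - 1) N cs' M cs" "length cs' = length cs"
    and many: "\<And>ys. length ys = length cs + 1 \<Longrightarrow> set ys \<subseteq> univ N \<Longrightarrow>
      \<exists>xs. length xs = length ys \<and> set xs \<subseteq> V \<and> survives L (k - 1) M xs N ys"
  shows "isomorphic L M N"
proof (rule isomorphic_if_counts)
  have len: "length cs = card A1" using distinct_card[OF cs(2)] cs(1) by simp
  have neM: "V \<noteq> {}" using similar_class_nonempty[OF A1(1)] similar_class_subset[OF A1(1)] by blast
  have neN: "univ N \<noteq> {}" using A1(3) k_pos by (auto simp: card_gt_0_iff)
  have pos: "0 < card A1" using A1(2) k_pos by simp
  have "\<not> card A1 < card (fibre A1)"
  proof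
    assume "card A1 < card (fibre A1)"
    then obtain Q where Q: "Q \<subseteq> fibre A1" "card Q = card A1 + 1" "finite Q"
      using obtain_subset_with_card_n[of "card A1 + 1" "fibre A1"] by auto
    obtain ys where ys: "set ys = Q" "distinct ys" using finite_distinct_list[OF Q(3)] by blast
    have lys: "length ys = card A1 + 1" using ys Q(2) distinct_card by metis
    have ysN: "set ys \<subseteq> univ N" using ys Q by auto
    then obtain xs where xs: "length xs = length ys" "set xs \<subseteq> V" "survives L (k - 1) M xs N ys"
      using many lys len by metis
    have "distinct xs"
      using same_pattern_distinct[OF same_pattern_sym ys(2)] survives_same_atoms[OF xs(3) neM]
      by (auto simp: same_atoms_def)
    then have card: "card (set xs) = card A1 + 1" using distinct_card xs(1) lys by metis
    have "(xs ! 0, xs ! j) \<in> similar L M" if "j < length xs" for j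
    proof (rule similar_transfer[OF xs(3) neM arity xs(2) _ that ysN])
      have "ys ! h \<in> fibre A1" if "h < length ys" for h using nth_mem[OF that] ys(1) Q(1) by blast
      then show "(ys ! 0, ys ! j) \<in> similar L N"
        using that xs(1) lys by (intro fibre_similar[OF A1(1,2) count A1(1)]) simp_all
    qed (use xs lys in auto)
    then have sub: "set xs \<subseteq> cl (xs ! 0)" by (auto simp: in_set_conv_nth)
    have "xs ! 0 \<in> V" using xs lys by (metis add_gr_0 nth_mem subsetD zero_less_one)
    then have B: "cl (xs ! 0) \<in> classes" using class_of by blast
    have "card (set xs) \<le> card (cl (xs ! 0))" using card_mono[OF finite_class[OF B] sub] .
    moreover have "card (cl (xs ! 0)) \<le> card A1" using max[OF B] by (cases "cl (xs ! 0) = A1") auto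
    ultimately show False using card by simp
  qed
  moreover have "\<not> card (fibre A1) < card A1"
  proof
    assume less: "card (fibre A1) < card A1"
    have pat: "same_pattern cs' cs" using survives_same_atoms[OF few(2) neN] by (auto simp: same_atoms_def)
    then have "distinct cs'" using same_pattern_distinct[OF same_pattern_sym cs(2)] by blast
    then have card: "card (set cs') = card A1" using distinct_card few(3) len by metis
    have csV: "set cs \<subseteq> V" using cs(1) similar_class_subset[OF A1(1)] by simp
    have sim: "(\<rho> (cs' ! 0), \<rho> (cs' ! j)) \<in> similar L M" if "j < length cs'" for j
    proof (rule similar_fibre[OF A1(1,3) count])
      show "(cs' ! 0, cs' ! j) \<in> similar L N"
      proof (rule similar_transfer[OF few(2) neN arity few(1) _ that csV])
        show "0 < length cs'" using few(3) len pos by simp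
        show "(cs ! 0, cs ! j) \<in> similar L M"
          using similar_class_iff[OF A1(1)] cs(1) that few(3) len pos by (metis nth_mem)
      qed
    qed
    let ?B = "cl (\<rho> (cs' ! 0))"
    have "cs' ! 0 \<in> univ N" using few(1,3) len pos by (metis nth_mem subsetD)
    then have B: "?B \<in> classes" using class_of \<rho>_univ by blast
    have "set cs' \<subseteq> fibre ?B" using sim few(1) by (auto simp: in_set_conv_nth)
    then have "card A1 \<le> card (fibre ?B)" using card_mono[of "fibre ?B" "set cs'"] fin_N card by simp
    then show False using less count[OF B] max[OF B] by (cases "?B = A1") auto
  qed
  ultimately have "card (fibre A1) = card A1" by simp
  then show "card (fibre A) = card A" if "A \<in> classes" for A using count that by metis
qed

end

subsection \<open>The defining formula\<close>

lemma sum_two_le: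
  fixes f :: "'c \<Rightarrow> nat"
  assumes "finite X" "x \<in> X" "y \<in> X" "x \<noteq> y" "\<And>z. z \<in> X \<Longrightarrow> 1 \<le> f z"
  shows "f x + f y + card X \<le> sum f X + 2"
proof -
  have "X = insert x (insert y (X - {x, y}))" using assms by auto
  then have "sum f X = f x + (f y + sum f (X - {x, y}))"
    using assms by (metis (no_types, lifting) Diff_iff finite.insertI finite_Diff insertCI insertE sum.insert)
  moreover have "card (X - {x, y}) \<le> sum f (X - {x, y})"
    using sum_mono[of "X - {x, y}" "\<lambda>_. 1" f] assms by simp
  moreover have "card (X - {x, y}) = card X - 2" using assms by (simp add: card_Diff_subset)
  ultimately show ?thesis by simp
qed

section \<open>Choice of parameters and the arithmetic of the rank\<close>

context bounded_structure
begin

lemma free_inter_class: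
  assumes "A \<in> classes" shows "A \<inter> free = (if A \<in> big then A - core A else {})"
proof -
  have "B = A" if "B \<in> big" "x \<in> B" "x \<in> A" for B x
    using class_eqI[OF _ assms, of B x] that by (auto simp: big_def)
  then show ?thesis by (auto simp: free_def)
qed

lemma card_free: "card free = (\<Sum>A\<in>big. card (A - core A))"
  unfolding free_def
proof (rule card_UN_disjoint)
  show "finite big" using finite_classes by (simp add: big_def)
  show "\<forall>A\<in>big. finite (A - core A)" using finite_class by (auto simp: big_def)
  show "\<forall>A\<in>big. \<forall>B\<in>big. A \<noteq> B \<longrightarrow> (A - core A) \<inter> (B - core B) = {}"
    using class_eqI by (fastforce simp: big_def)
qed

lemma card_minus_core: "A \<in> big \<Longrightarrow> card (A - core A) = card A - (k - 1)"
  using core[of A] finite_class[of A] finite_subset[of "core A" A]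
  by (auto simp: big_def card_Diff_subset)

lemma defining_formula_exists:
  assumes V: "V \<noteq> {}"
    and A1: "A1 \<in> classes" "\<And>A. A \<in> classes \<Longrightarrow> card A \<le> card A1"
  obtains p b where "defining_formula L p M" "alternation_number p \<le> 1"
    "quantifier_rank p \<le> max b (card A1 + k)"
    "2 * k * b \<le> (2 * k - 1) * card V + 2 * k * (k * k - k + 2)"
proof -
  obtain S U Y where lev: "levels L M k S U Y" and SU: "S \<subseteq> U" "U \<subseteq> V" "Y \<subseteq> U" and free: "V - U = free"
    and sim: "\<forall>u\<in>V - U. \<forall>v\<in>V - U. tp L M S u = tp L M S v \<longrightarrow> (u, v) \<in> similar L M"
    and cardB: "card (U - Y) + (k - 1) \<le> (k - 1) * (2 * card big + 2 * card Y)"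
    using final_stage[OF V] by metis
  have fins: "finite U" "finite Y" "finite free" "finite big"
    using finite_subset[OF _ fin] SU free_cores(1) finite_classes by (auto simp: big_def)
  have AU: "A - U = A \<inter> free" if "A \<in> classes" for A
    using similar_class_subset[OF that] free by blast
  have AU_big: "A - U = A - core A" if "A \<in> big" for A
    using AU[of A] free_inter_class[of A] that by (auto simp: big_def)
  have AU_small: "A \<in> big" if "A \<in> classes" "A - U \<noteq> {}" for A
    using AU[OF that(1)] free_inter_class[OF that(1)] that(2) by (auto split: if_splits)
  define uniq where "uniq \<longleftrightarrow> (\<forall>A\<in>classes. A \<noteq> A1 \<longrightarrow> card A < card A1)"
  \<comment> \<open>A strictly largest class is left to the tuple \<open>cs\<close>; all others are
    counted in the rounds after \<open>bs\<close>, where \<open>c\<close> is the largest number of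
    elements to be counted.\<close>
  define C where "C = {A \<in> classes. A = A1 \<longrightarrow> \<not> uniq}"
  define c where "c = Max (insert 0 ((\<lambda>A. card (A - U)) ` C))"
  have finC: "finite C" using finite_classes by (simp add: C_def)
  have c: "card (A - U) \<le> c" if "A \<in> C" for A
    unfolding c_def using finC that by (intro Max_ge) auto
  \<comment> \<open>Beyond the \<open>(k - 1) * (k - 1)\<close> rounds kept for the layers, two
    serve the uniqueness of twins, \<open>k\<close> the play of a relation tuple and
    \<open>c + 1\<close> the count. The first entry equals \<open>(k - 1) * (k - 1) + k + 1\<close>
    and so covers the first two needs.\<close>
  define e where "e = max (k * k - k + 2) ((k - 1) * (k - 1) + c + 1)"
  define b where "b = card (U - Y) + e"
  obtain bs where bsU: "set bs = U - Y" "distinct bs" using finite_distinct_list[of "U - Y"] fins by auto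
  obtain cs where cs: "set cs = A1" "distinct cs"
    using finite_distinct_list[OF finite_class[OF A1(1)]] by blast
  have len: "length bs = card (U - Y)" "length cs = card A1"
    using distinct_card[OF bsU(2)] distinct_card[OF cs(2)] bsU(1) cs(1) by simp_all
  have bsV: "set bs \<subseteq> V" "set cs \<subseteq> V" using bsU cs SU similar_class_subset[OF A1(1)] by auto
  have cs0: "cs \<noteq> []" using cs similar_class_nonempty[OF A1(1)] by auto
  obtain p where p: "closed_formula L p" "alternation_number p \<le> 1"
      "quantifier_rank p \<le> max (length bs + e) (length cs + 1 + (k - 1))" "true_on M p"
    and sound: "\<And>N :: nat struct. true_on N p \<Longrightarrow>
       (\<exists>bs'. set bs' \<subseteq> univ N \<and> survives L e M bs N bs' \<and> survives L e N bs' M bs \<and>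
         length bs' = length bs) \<and>
       (\<exists>cs'. set cs' \<subseteq> univ N \<and> survives L (k - 1) N cs' M cs \<and> length cs' = length cs) \<and>
       (\<forall>ys. length ys = length cs + 1 \<and> set ys \<subseteq> univ N \<longrightarrow>
         (\<exists>xs. length xs = length ys \<and> set xs \<subseteq> univ M \<and> survives L (k - 1) M xs N ys))"
    by (rule two_block_sentence[OF fin V bsV _ cs0, of e L "k - 1"]) (auto simp: e_def)
  have kk: "k * k = (k - 1) * (k - 1) + (k - 1) + k" using k_pos by (cases k) auto
  have "k * k - k + 2 \<le> e" by (simp add: e_def)
  then have e1: "(k - 1) * (k - 1) + 2 \<le> e" "(k - 1) * (k - 1) + k \<le> e"
    using kk k_pos by linarith+
  have "isomorphic L M N" if N: "is_structure L N" "true_on N p" for N :: "nat struct"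
  proof -
    obtain bs' cs' where bs': "set bs' \<subseteq> univ N" "survives L e M bs N bs'" "survives L e N bs' M bs"
        "length bs' = length bs"
      and cs': "set cs' \<subseteq> univ N" "survives L (k - 1) N cs' M cs" "length cs' = length cs"
      and many: "\<And>ys. length ys = length cs + 1 \<Longrightarrow> set ys \<subseteq> univ N \<Longrightarrow>
         \<exists>xs. length xs = length ys \<and> set xs \<subseteq> univ M \<and> survives L (k - 1) M xs N ys"
      using sound[OF N(2)] by blast
    have finN: "finite (univ N)" using N(1) by (simp add: is_structure_def)
    have neN: "univ N \<noteq> {}" using cs' cs0 by auto
    interpret matched L M k N bs bs' e
      by unfold_locales (use finN neN V bsV bs' in auto)
    obtain \<rho> where lab: "labelled L M k N \<rho>"
      and count: "\<forall>A\<in>classes. (k - 1) * (k - 1) + card (A - U) + 1 \<le> e \<longrightarrow>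
        card {y \<in> univ N. \<rho> y \<in> A} = card A"
      and some: "\<forall>A\<in>classes. A - U \<noteq> {} \<longrightarrow> card (A \<inter> U) < card {y \<in> univ N. \<rho> y \<in> A}"
      by (rule label_map[OF lev bsU(1) sim e1])
    interpret labelled L M k N \<rho> by (rule lab)
    have countC: "card (fibre A) = card A" if "A \<in> C" for A
      using bspec[OF count, of A] c[OF that] that by (simp add: C_def e_def)
    show ?thesis
    proof (cases "uniq \<and> A1 - U \<noteq> {}")
      case True
      have A1b: "A1 \<in> big" using AU_small A1(1) True by blast
      \<comment> \<open>The core has \<open>k - 1\<close> partners in \<open>N\<close>; one further
        element labelled in \<open>A1\<close> brings the fibre to \<open>k\<close>.\<close>
      have "A1 \<inter> U = core A1" using AU_big[OF A1b] core[OF A1b] by blast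
      then have k': "k \<le> card (fibre A1)" using bspec[OF some A1(1)] True core[OF A1b] by auto
      show ?thesis
      proof (rule isomorphic_if_survives[OF A1(1) _ k' _ _ cs cs' many])
        show "k \<le> card A1" using A1b by (simp add: big_def)
      qed (use True countC in \<open>auto simp: uniq_def C_def\<close>)
    next
      case False
      have "card (fibre A) = card A" if A: "A \<in> classes" for A
      proof (cases "A \<in> C")
        case True
        then show ?thesis by (rule countC)
      next
        case nC: False
        then have "A - U = {}" using False A by (auto simp: C_def)
        then have "card (A - U) = 0" by (metis card.empty)
        then have "(k - 1) * (k - 1) + card (A - U) + 1 \<le> e" using e1(1) by linarith
        then show ?thesis using bspec[OF count A] by blast
      qed
      then show ?thesis by (rule isomorphic_if_counts)
    qed
  qed
  then have def: "defining_formula L p M" using p by (auto simp: defining_formula_def)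
  have rank: "quantifier_rank p \<le> max b (card A1 + k)" using p(3) k_pos by (simp add: b_def len)
  have n: "card V = card (U - Y) + card Y + card free"
  proof -
    have "card V = card U + card free" using card_Un_disjoint[of U free] fins free SU
      by (metis Diff_disjoint Un_Diff_cancel sup.absorb2)
    moreover have "card U = card (U - Y) + card Y"
      using fins SU card_Diff_subset[of Y U] card_mono[of U Y] by simp
    ultimately show ?thesis by simp
  qed
  have one: "1 \<le> card (A - core A)" if "A \<in> big" for A
    using card_minus_core[OF that] that k_pos by (auto simp: big_def)
  have h: "card big \<le> card free"
    using sum_mono[of big "\<lambda>_. 1" "\<lambda>A. card (A - core A)"] one by (simp add: card_free)
  \<comment> \<open>A class attaining \<open>c\<close> is not strictly largest, so another class is
    at least as large. Two free parts of size at least \<open>c\<close> and one element from each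
    other big class fit into \<open>free\<close>.\<close>
  have two: "2 * c + card big \<le> card free + 2" if c0: "c \<noteq> 0"
  proof -
    have "c \<in> insert 0 ((\<lambda>A. card (A - U)) ` C)" unfolding c_def using finC by (intro Max_in) auto
    then obtain A where A: "A \<in> C" "c = card (A - U)" using c0 by auto
    have A': "A \<in> classes" using A by (simp add: C_def)
    have "A - U \<noteq> {}" using A(2) c0 by (metis card.empty)
    then have Ab: "A \<in> big" using AU_small[OF A'] by blast
    obtain B where B: "B \<in> classes" "B \<noteq> A" "card A \<le> card B"
    proof (cases "A = A1")
      case True
      then have "\<not> uniq" using A by (simp add: C_def)
      then show ?thesis using that True by (auto simp: uniq_def not_less)
    next
      case False
      then show ?thesis using that A1 A' by metis
    qed
    have Bb: "B \<in> big" using B Ab by (auto simp: big_def)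
    have "c \<le> card (A - core A)" "c \<le> card (B - core B)"
      using A(2) AU_big[OF Ab] card_minus_core[OF Ab] card_minus_core[OF Bb] diff_le_mono[OF B(3)]
      by simp_all
    then show ?thesis
      using sum_two_le[OF fins(4) Ab Bb, of "\<lambda>A. card (A - core A)"] B(2) one
      by (simp add: card_free)
  qed
  have "2 * k * b \<le> (2 * k - 1) * card V + 2 * k * (k * k - k + 2)"
  proof -
    obtain q where q: "k = Suc q" using k_pos by (cases k) auto
    define x y f g where "x = card (U - Y)" and "y = card Y" and "f = card free" and "g = card big"
    have x: "x \<le> q * (2 * g + 2 * y)" using cardB by (simp add: q x_def y_def g_def)
    have gf: "g \<le> f" using h by (simp add: g_def f_def)
    have xx: "x \<le> 2 * q * g + 2 * q * y" using x by (simp add: algebra_simps)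
    \<comment> \<open>Since \<open>card V = x + y + f\<close>, this is
      \<open>2 * k * x \<le> (2 * k - 1) * card V\<close> with \<open>(2 * k - 1) * x\<close>
      cancelled.\<close>
    have 1: "x \<le> (2 * q + 1) * (y + f)"
    proof -
      have "x \<le> 2 * q * g + 2 * q * y + (y + f)" using xx by linarith
      also have "\<dots> \<le> 2 * q * f + 2 * q * y + (y + f)" using mult_le_mono2[OF gf, of "2 * q"] by linarith
      also have "\<dots> = (2 * q + 1) * (y + f)" by (simp add: algebra_simps)
      finally show ?thesis .
    qed
    \<comment> \<open>The same with the count included: \<open>2 * (q + 1) * (q + 1)\<close> is what
      \<open>2 * k * (k * k - k + 2)\<close> leaves after paying for
      \<open>2 * k * (q * q + 1)\<close>.\<close>
    have 2: "x + 2 * (q + 1) * c \<le> (2 * q + 1) * (y + f) + 2 * (q + 1) * (q + 1)"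
    proof (cases "c = 0")
      case True
      then show ?thesis using 1 by simp
    next
      case False
      have "(2 * q + 1) * (2 * c + g) \<le> (2 * q + 1) * (f + 2)"
        using two[OF False] by (intro mult_le_mono2) (simp add: f_def g_def)
      then have m: "4 * (q * c) + 2 * (q * g) + 2 * c + g \<le> 2 * (q * f) + 4 * q + f + 2"
        by (simp add: algebra_simps)
      have "x \<le> 2 * (q * g) + 2 * (q * y)" using xx by simp
      then have "x + (2 * (q * c) + 2 * c) \<le>
          2 * (q * y) + 2 * (q * f) + y + f + (2 * (q * q) + 4 * q + 2)"
        using m by linarith
      then show ?thesis by (simp add: algebra_simps)
    qed
    have V': "card V = x + y + f" using n by (simp add: x_def y_def f_def)
    have "b = x + (q * q + q + 2) \<or> b = x + (q * q + c + 1)"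
      unfolding b_def x_def[symmetric] e_def q by (auto simp: max_def)
    then show ?thesis
    proof
      assume b: "b = x + (q * q + q + 2)"
      show ?thesis using 1 unfolding b V' q by (simp add: algebra_simps)
    next
      assume b: "b = x + (q * q + c + 1)"
      show ?thesis using 2 unfolding b V' q by (simp add: algebra_simps)
    qed
  qed
  then show ?thesis using that[OF def p(2) rank] by blast
qed

end

text \<open>An empty universe has no similarity class from which the general construction could
  start. As all arities are positive, saying that nothing exists already defines the
  structure.\<close>

lemma D1_empty:
  assumes "is_structure L M" "univ M = {}"
  shows "D1 L M \<le> 1"
proof -
  let ?p = "Forall 0 (Neg (Eq 0 0))"
  have "isomorphic L M N" if "is_structure L N" "true_on N ?p" for N :: "nat struct"
  proof -
    have "univ N = {}" using that(2) by (auto simp: true_on_def)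
    moreover have "L ! i > 0" if "i < length L" for i
      using assms(1) that by (auto simp: is_structure_def is_vocabulary_def)
    ultimately have "is_iso L M N undefined"
      using assms(2) by (fastforce simp: is_iso_def bij_betw_def)
    then show ?thesis by (auto simp: isomorphic_def)
  qed
  then have "defining_formula L ?p M"
    using assms(2) by (auto simp: defining_formula_def closed_formula_def true_on_def)
  moreover have "nest ?p = {replicate 1 QAll @ replicate 0 QAll}" by simp
  then have "quantifier_rank ?p \<le> 1" "alternation_number ?p \<le> 1"
    using two_block_bounds[of ?p 1] by (metis (no_types, lifting) singletonD length_append length_replicate add_0_right order_refl)+
  ultimately show ?thesis using D1_le by blast
qed

theorem theorem4p11:
  fixes L :: vocabulary and M :: "'a struct" and n k :: nat
  assumes "is_vocabulary L" and "L \<noteq> []" and "max_arity L = k"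
    and "is_structure L M" and "card (univ M) = n"
  shows "(real (sigma L M) \<le> (1 - 1 / (2 * real k)) * real n + (real k - 1)^2 + 1 \<longrightarrow>
            real (D1 L M) \<le> (1 - 1 / (2 * real k)) * real n + (real k)^2 - real k + 2)
       \<and> (\<not> real (sigma L M) \<le> (1 - 1 / (2 * real k)) * real n + (real k - 1)^2 + 1 \<longrightarrow>
            sigma L M + 1 \<le> D L M \<and> D L M \<le> D1 L M \<and> D1 L M \<le> sigma L M + k)"
proof -
  have fin: "finite (univ M)" using assms(4) by (simp add: is_structure_def)
  have ar: "L ! i \<le> k" if "i < length L" for i
    using that assms(3) by (auto simp: max_arity_def)
  have kpos: "0 < k"
  proof -
    have "0 < L ! 0" using assms(1,2) by (auto simp: is_vocabulary_def)
    then show ?thesis using ar[of 0] assms(2) by (metis length_greater_0_conv less_le_trans)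
  qed
  interpret bounded_structure L M k by unfold_locales (use fin ar kpos in auto)
  let ?t = "(1 - 1 / (2 * real k)) * real n"
  have "1 / (2 * real k) \<le> 1" using kpos by simp
  then have t0: "0 \<le> ?t" by (intro mult_nonneg_nonneg) simp_all
  \<comment> \<open>Adding \<open>k\<close> to the threshold for \<open>sigma L M\<close> gives the
    bound on \<open>b\<close>; the case distinction of the theorem thus decides which entry of
    \<open>max b (sigma L M + k)\<close> matters.\<close>
  have sq: "(real k - 1)^2 + 1 + real k = (real k)^2 - real k + 2"
    by (simp add: power2_eq_square algebra_simps)
  show ?thesis
  proof (cases "V = {}")
    case True
    have "real (D1 L M) \<le> 1" using D1_empty[OF assms(4) True] by simp
    moreover have "0 \<le> (real k)^2 - real k" using kpos by (simp add: power2_eq_square)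
    ultimately have "real (D1 L M) \<le> ?t + (real k)^2 - real k + 2" using t0 by linarith
    moreover have "real (sigma L M) \<le> ?t + (real k - 1)^2 + 1"
      using t0 True by (simp add: sigma_def quotient_def)
    ultimately show ?thesis by blast
  next
    case False
    have ne: "classes \<noteq> {}" using False by (simp add: quotient_def)
    have sig: "sigma L M = Max (card ` classes)"
      using ne finite_classes by (simp add: sigma_def)
    have "sigma L M \<in> card ` classes" unfolding sig using ne finite_classes by (intro Max_in) auto
    then obtain A1 where A1: "A1 \<in> classes" "card A1 = sigma L M" by force
    have max: "card A \<le> card A1" if "A \<in> classes" for A
      using that finite_classes A1(2) sig by simp
    obtain p b where p: "defining_formula L p M" "alternation_number p \<le> 1"
      "quantifier_rank p \<le> max b (card A1 + k)"
      and b: "2 * k * b \<le> (2 * k - 1) * card V + 2 * k * (k * k - k + 2)"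
      using defining_formula_exists[OF False A1(1) max] by metis
    have D1: "D1 L M \<le> max b (sigma L M + k)" using D1_le[OF p(1,2)] p(3) A1(2) by simp
    have b': "real b \<le> ?t + (real k)^2 - real k + 2"
    proof -
      have "real (2 * k * b) \<le> real ((2 * k - 1) * card V + 2 * k * (k * k - k + 2))"
        using b by (rule of_nat_mono)
      moreover have "real (2 * k - 1) = 2 * real k - 1" "real (k * k - k + 2) = (real k)^2 - real k + 2"
        using kpos by (simp_all add: of_nat_diff power2_eq_square)
      ultimately have "2 * real k * real b \<le> (2 * real k - 1) * real n + 2 * real k * ((real k)^2 - real k + 2)"
        using assms(5) by (simp add: distrib_left)
      also have "\<dots> = 2 * real k * (?t + (real k)^2 - real k + 2)"
        using kpos by (simp add: field_simps)
      finally show ?thesis by (rule mult_left_le_imp_le) (use kpos in simp)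
    qed
    show ?thesis
    proof (intro conjI impI)
      assume "real (sigma L M) \<le> ?t + (real k - 1)^2 + 1"
      then have "real (sigma L M + k) \<le> ?t + (real k)^2 - real k + 2" using sq by simp
      then show "real (D1 L M) \<le> ?t + (real k)^2 - real k + 2"
        using D1 b' by (cases "b \<le> sigma L M + k") auto
    next
      assume "\<not> real (sigma L M) \<le> ?t + (real k - 1)^2 + 1"
      then have "real b < real (sigma L M + k)" using sq b' by simp
      then show "D1 L M \<le> sigma L M + k" using D1 by simp
    next
      show "sigma L M + 1 \<le> D L M" using card_class_less_D[OF assms(4) A1(1) p(1)] A1(2) by simp
      show "D L M \<le> D1 L M" using D_le_D1[OF p(1,2)] .
    qed
  qed
qed

end
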